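(* Let $G$ be a second countable locally compact Hausdorff groupoid with a left Haar system. Then the Fourier-Stieltjes algebra $B(G)$, with the norm $\|\cdot\|$, is a unital commutative Banach algebra under pointwise operations on $G$.
   Context: Hilbert spaces are separable and inner products are conjugate linear in the first variable. $G$ has unit space $G^0$ and range and source maps $r,s$. A $G$-Hilbert bundle is a continuous Hilbert bundle $\mathfrak H=\{\mathfrak H^u\}_{u\in G^0}$ over $G^0$ (a continuous field of Hilbert spaces in Dixmier's sense) together with, for each $x\in G$, a linear isometry $L_x$ of $\mathfrak H^{s(x)}$ onto $\mathfrak H^{r(x)}$ such that $x\mapsto L_x$ is a groupoid homomorphism and, for all $\xi,\eta\in\Delta_b(\mathfrak H)$, the function $(\xi,\eta):x\mapsto (L_x\xi(s(x)),\eta(r(x)))$ is continuous on $G$. Here $\Delta_b(\mathfrak H)$ is the Banach space of bounded continuous sections of $\mathfrak H$, with norm $\|\xi\|=\sup_u\|\xi(u)\|$. The function $(\xi,\eta)$ is called a coefficient of $\mathfrak H$. $B(G)$ is the set of all coefficients $(\xi,\eta)$ with $\xi,\eta\in\Delta_b(\mathfrak H)$, for some $G$-Hilbert bundle $\mathfrak H$. For $\phi\in B(G)$, $\|\phi\|=\inf\|\xi\|\|\eta\|$, the infimum over all representations $\phi=(\xi,\eta)$ (over all $G$-Hilbert bundles). *)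

theory Defs
  imports "HOL-Analysis.Analysis"
begin

section \<open>Complex vector spaces, Banach algebras and Hilbert spaces on carrier sets\<close>

locale complex_vector_space =
  fixes V :: "'a set" and zero :: 'a and add :: "'a \<Rightarrow> 'a \<Rightarrow> 'a" and scal :: "complex \<Rightarrow> 'a \<Rightarrow> 'a"
  assumes zero_closed: "zero \<in> V"
    and add_closed: "\<lbrakk>v \<in> V; w \<in> V\<rbrakk> \<Longrightarrow> add v w \<in> V"
    and scale_closed: "v \<in> V \<Longrightarrow> scal c v \<in> V"
    and add_assoc: "\<lbrakk>u \<in> V; v \<in> V; w \<in> V\<rbrakk> \<Longrightarrow> add (add u v) w = add u (add v w)"
    and add_commute: "\<lbrakk>v \<in> V; w \<in> V\<rbrakk> \<Longrightarrow> add v w = add w v"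
    and add_zero: "v \<in> V \<Longrightarrow> add v zero = v"
    and add_inverse: "v \<in> V \<Longrightarrow> \<exists>w\<in>V. add v w = zero"
    and scale_add_right: "\<lbrakk>v \<in> V; w \<in> V\<rbrakk> \<Longrightarrow> scal c (add v w) = add (scal c v) (scal c w)"
    and scale_add_left: "v \<in> V \<Longrightarrow> scal (c + d) v = add (scal c v) (scal d v)"
    and scale_scale: "v \<in> V \<Longrightarrow> scal c (scal d v) = scal (c * d) v"
    and scale_one: "v \<in> V \<Longrightarrow> scal 1 v = v"

text \<open>The distance of a norm. It is set to 0 off the carrier because the locale
  \<^locale>\<open>Metric_space\<close> asks for nonnegativity and symmetry on the whole type; the values there
  have no influence on the metric topology or on completeness.\<close>

definition norm_dist ::
  "'a set \<Rightarrow> ('a \<Rightarrow> 'a \<Rightarrow> 'a) \<Rightarrow> (complex \<Rightarrow> 'a \<Rightarrow> 'a) \<Rightarrow> ('a \<Rightarrow> real) \<Rightarrow> 'a \<Rightarrow> 'a \<Rightarrow> real"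
  where "norm_dist V add scal nrm v w =
    (if v \<in> V \<and> w \<in> V then nrm (add v (scal (-1) w)) else 0)"

locale complex_banach_space = complex_vector_space +
  fixes nrm :: "'a \<Rightarrow> real"
  assumes nrm_nonneg: "v \<in> V \<Longrightarrow> 0 \<le> nrm v"
    and nrm_eq_0_iff: "v \<in> V \<Longrightarrow> nrm v = 0 \<longleftrightarrow> v = zero"
    and nrm_scale: "v \<in> V \<Longrightarrow> nrm (scal c v) = cmod c * nrm v"
    and nrm_triangle: "\<lbrakk>v \<in> V; w \<in> V\<rbrakk> \<Longrightarrow> nrm (add v w) \<le> nrm v + nrm w"
    and complete: "Metric_space.mcomplete V (norm_dist V add scal nrm)"

locale unital_commutative_banach_algebra = complex_banach_space +
  fixes mult :: "'a \<Rightarrow> 'a \<Rightarrow> 'a" and one :: 'a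
  assumes mult_closed: "\<lbrakk>v \<in> V; w \<in> V\<rbrakk> \<Longrightarrow> mult v w \<in> V"
    and one_closed: "one \<in> V"
    and mult_assoc: "\<lbrakk>u \<in> V; v \<in> V; w \<in> V\<rbrakk> \<Longrightarrow> mult (mult u v) w = mult u (mult v w)"
    and mult_commute: "\<lbrakk>v \<in> V; w \<in> V\<rbrakk> \<Longrightarrow> mult v w = mult w v"
    and mult_one: "v \<in> V \<Longrightarrow> mult one v = v"
    and mult_add: "\<lbrakk>u \<in> V; v \<in> V; w \<in> V\<rbrakk> \<Longrightarrow> mult u (add v w) = add (mult u v) (mult u w)"
    and mult_scale: "\<lbrakk>v \<in> V; w \<in> V\<rbrakk> \<Longrightarrow> mult v (scal c w) = scal c (mult v w)"
    and nrm_mult: "\<lbrakk>v \<in> V; w \<in> V\<rbrakk> \<Longrightarrow> nrm (mult v w) \<le> nrm v * nrm w"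
    and nrm_one: "nrm one = 1"

record 'h hspace =
  hcarrier :: "'h set"
  hzero :: 'h
  hadd :: "'h \<Rightarrow> 'h \<Rightarrow> 'h"
  hscale :: "complex \<Rightarrow> 'h \<Rightarrow> 'h"
  hinner :: "'h \<Rightarrow> 'h \<Rightarrow> complex"

definition hnorm :: "'h hspace \<Rightarrow> 'h \<Rightarrow> real"
  where "hnorm H v = sqrt (Re (hinner H v v))"

definition hdist :: "'h hspace \<Rightarrow> 'h \<Rightarrow> 'h \<Rightarrow> real"
  where "hdist H = norm_dist (hcarrier H) (hadd H) (hscale H) (hnorm H)"

definition htopology :: "'h hspace \<Rightarrow> 'h topology"
  where "htopology H = Metric_space.mtopology (hcarrier H) (hdist H)"

text \<open>Hilbert spaces are complex and separable, with inner product conjugate linear in the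
  first variable.\<close>

locale hilbert_space =
  complex_vector_space "hcarrier H" "hzero H" "hadd H" "hscale H" for H :: "'h hspace" +
  assumes hinner_cnj: "\<lbrakk>v \<in> hcarrier H; w \<in> hcarrier H\<rbrakk> \<Longrightarrow> hinner H w v = cnj (hinner H v w)"
    and hinner_add: "\<lbrakk>u \<in> hcarrier H; v \<in> hcarrier H; w \<in> hcarrier H\<rbrakk>
      \<Longrightarrow> hinner H u (hadd H v w) = hinner H u v + hinner H u w"
    and hinner_scale: "\<lbrakk>v \<in> hcarrier H; w \<in> hcarrier H\<rbrakk>
      \<Longrightarrow> hinner H v (hscale H c w) = c * hinner H v w"
    and hinner_nonneg: "v \<in> hcarrier H \<Longrightarrow> 0 \<le> Re (hinner H v v)"
    and hinner_definite: "\<lbrakk>v \<in> hcarrier H; hinner H v v = 0\<rbrakk> \<Longrightarrow> v = hzero H"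
    and hcomplete: "Metric_space.mcomplete (hcarrier H) (hdist H)"
    and hseparable: "separable_space (htopology H)"

definition linear_isometry_onto :: "'h hspace \<Rightarrow> 'h hspace \<Rightarrow> ('h \<Rightarrow> 'h) \<Rightarrow> bool"
  where "linear_isometry_onto H K T \<longleftrightarrow>
    T ` hcarrier H = hcarrier K \<and>
    (\<forall>v\<in>hcarrier H. \<forall>w\<in>hcarrier H. T (hadd H v w) = hadd K (T v) (T w)) \<and>
    (\<forall>c. \<forall>v\<in>hcarrier H. T (hscale H c v) = hscale K c (T v)) \<and>
    (\<forall>v\<in>hcarrier H. hnorm K (T v) = hnorm H v)"

section \<open>Topological groupoids and Haar systems\<close>

record 'g groupoid =
  composable :: "('g \<times> 'g) set"
  gmult :: "'g \<Rightarrow> 'g \<Rightarrow> 'g"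
  ginv :: "'g \<Rightarrow> 'g"

definition range_map :: "'g groupoid \<Rightarrow> 'g \<Rightarrow> 'g"
  where "range_map G x = gmult G x (ginv G x)"

definition source_map :: "'g groupoid \<Rightarrow> 'g \<Rightarrow> 'g"
  where "source_map G x = gmult G (ginv G x) x"

definition unit_space :: "'g groupoid \<Rightarrow> 'g set"
  where "unit_space G = range (range_map G)"

definition range_fibre :: "'g groupoid \<Rightarrow> 'g \<Rightarrow> 'g set"
  where "range_fibre G u = {x. range_map G x = u}"

text \<open>The groupoid is the whole type \<open>'g\<close>; only the product is partial, so that
  \<^term>\<open>gmult G x y\<close> is meaningless unless \<^term>\<open>(x, y) \<in> composable G\<close>.\<close>

locale topological_groupoid =
  fixes G :: "'g::topological_space groupoid"
  assumes assoc_composable: "\<lbrakk>(x, y) \<in> composable G; (y, z) \<in> composable G\<rbrakk>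
      \<Longrightarrow> (gmult G x y, z) \<in> composable G \<and> (x, gmult G y z) \<in> composable G"
    and assoc: "\<lbrakk>(x, y) \<in> composable G; (y, z) \<in> composable G\<rbrakk>
      \<Longrightarrow> gmult G (gmult G x y) z = gmult G x (gmult G y z)"
    and inv_inv: "ginv G (ginv G x) = x"
    and inv_composable: "(x, ginv G x) \<in> composable G"
    and inv_mult: "(x, y) \<in> composable G \<Longrightarrow> gmult G (ginv G x) (gmult G x y) = y"
    and mult_inv: "(x, y) \<in> composable G \<Longrightarrow> gmult G (gmult G x y) (ginv G y) = x"
    and continuous_mult: "continuous_on (composable G) (\<lambda>(x, y). gmult G x y)"
    and continuous_inv: "continuous_on UNIV (ginv G)"

definition regular_borel_measure :: "'a::topological_space measure \<Rightarrow> bool"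
  where "regular_borel_measure M \<longleftrightarrow>
    sets M = sets borel \<and>
    (\<forall>K. compact K \<longrightarrow> emeasure M K < \<infinity>) \<and>
    (\<forall>A\<in>sets borel. emeasure M A = (INF U\<in>{U. open U \<and> A \<subseteq> U}. emeasure M U)) \<and>
    (\<forall>U. open U \<longrightarrow> emeasure M U = (SUP K\<in>{K. compact K \<and> K \<subseteq> U}. emeasure M K))"

definition measure_support :: "'a::topological_space measure \<Rightarrow> 'a set"
  where "measure_support M = {x. \<forall>U. open U \<longrightarrow> x \<in> U \<longrightarrow> emeasure M U \<noteq> 0}"

definition compactly_supported_continuous :: "('a::topological_space \<Rightarrow> complex) set"
  where "compactly_supported_continuous =
    {f. continuous_on UNIV f \<and> compact (closure {x. f x \<noteq> 0})}"

text \<open>The measure \<open>\<lambda>\<^sup>u\<close> on the closed set \<open>r\<^sup>-\<^sup>1(u)\<close> is represented by the measure on the whole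
  groupoid which extends it by zero.\<close>

definition left_haar_system :: "'g::topological_space groupoid \<Rightarrow> ('g \<Rightarrow> 'g measure) \<Rightarrow> bool"
  where "left_haar_system G lam \<longleftrightarrow>
    (\<forall>u\<in>unit_space G. regular_borel_measure (lam u)
       \<and> emeasure (lam u) (- range_fibre G u) = 0
       \<and> measure_support (lam u) = range_fibre G u) \<and>
    (\<forall>f\<in>compactly_supported_continuous.
       continuous_on (unit_space G) (\<lambda>u. LINT y|lam u. f y)) \<and>
    (\<forall>f\<in>compactly_supported_continuous. \<forall>x.
       (LINT z:range_fibre G (source_map G x)|lam (source_map G x). f (gmult G x z)) =
       (LINT y|lam (range_map G x). f y))"

section \<open>Hilbert bundles\<close>

record ('b, 'h) hilbert_bundle =
  fibre :: "'b \<Rightarrow> 'h hspace"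
  sections :: "('b \<Rightarrow> 'h) set"

text \<open>Continuous fields of Hilbert spaces over \<open>X\<close> as in Dixmier, \<open>C*-Algebras\<close>, 10.1.2:
  \<^term>\<open>sections E\<close> is the set of continuous sections. Sections are extensional functions, so
  that equal sections over \<open>X\<close> are equal as functions.\<close>

locale continuous_hilbert_bundle =
  fixes X :: "'b::topological_space set" and E :: "('b, 'h) hilbert_bundle"
  assumes fibre_hilbert: "u \<in> X \<Longrightarrow> hilbert_space (fibre E u)"
    and sections_subset: "sections E \<subseteq> (\<Pi>\<^sub>E u\<in>X. hcarrier (fibre E u))"
    and sections_zero: "(\<lambda>u\<in>X. hzero (fibre E u)) \<in> sections E"
    and sections_add: "\<lbrakk>\<xi> \<in> sections E; \<eta> \<in> sections E\<rbrakk>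
      \<Longrightarrow> (\<lambda>u\<in>X. hadd (fibre E u) (\<xi> u) (\<eta> u)) \<in> sections E"
    and sections_scale: "\<xi> \<in> sections E \<Longrightarrow> (\<lambda>u\<in>X. hscale (fibre E u) c (\<xi> u)) \<in> sections E"
    and sections_dense: "u \<in> X
      \<Longrightarrow> htopology (fibre E u) closure_of ((\<lambda>\<xi>. \<xi> u) ` sections E) = hcarrier (fibre E u)"
    and sections_norm: "\<xi> \<in> sections E \<Longrightarrow> continuous_on X (\<lambda>u. hnorm (fibre E u) (\<xi> u))"
    and sections_local: "\<lbrakk>\<xi> \<in> (\<Pi>\<^sub>E u\<in>X. hcarrier (fibre E u));
        \<And>t \<epsilon>. \<lbrakk>t \<in> X; 0 < \<epsilon>\<rbrakk> \<Longrightarrow>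
          \<exists>\<xi>'\<in>sections E. \<exists>U. open U \<and> t \<in> U \<and> (\<forall>u\<in>U \<inter> X. hdist (fibre E u) (\<xi> u) (\<xi>' u) \<le> \<epsilon>)\<rbrakk>
      \<Longrightarrow> \<xi> \<in> sections E"

definition bounded_sections :: "'b set \<Rightarrow> ('b, 'h) hilbert_bundle \<Rightarrow> ('b \<Rightarrow> 'h) set"
  where "bounded_sections X E =
    {\<xi> \<in> sections E. bdd_above ((\<lambda>u. hnorm (fibre E u) (\<xi> u)) ` X)}"

definition section_norm :: "'b set \<Rightarrow> ('b, 'h) hilbert_bundle \<Rightarrow> ('b \<Rightarrow> 'h) \<Rightarrow> real"
  where "section_norm X E \<xi> = (SUP u\<in>X. hnorm (fibre E u) (\<xi> u))"

definition coefficient ::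
  "'g groupoid \<Rightarrow> ('g, 'h) hilbert_bundle \<Rightarrow> ('g \<Rightarrow> 'h \<Rightarrow> 'h) \<Rightarrow> ('g \<Rightarrow> 'h) \<Rightarrow> ('g \<Rightarrow> 'h) \<Rightarrow> 'g \<Rightarrow> complex"
  where "coefficient G E L \<xi> \<eta> x =
    hinner (fibre E (range_map G x)) (L x (\<xi> (source_map G x))) (\<eta> (range_map G x))"

locale G_hilbert_bundle = continuous_hilbert_bundle "unit_space G" E
  for G :: "'g::topological_space groupoid" and E :: "('g, 'h) hilbert_bundle" +
  fixes L :: "'g \<Rightarrow> 'h \<Rightarrow> 'h"
  assumes L_isometry:
      "linear_isometry_onto (fibre E (source_map G x)) (fibre E (range_map G x)) (L x)"
    and L_mult: "\<lbrakk>(x, y) \<in> composable G; v \<in> hcarrier (fibre E (source_map G y))\<rbrakk>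
      \<Longrightarrow> L (gmult G x y) v = L x (L y v)"
    and coefficient_continuous:
      "\<lbrakk>\<xi> \<in> bounded_sections (unit_space G) E; \<eta> \<in> bounded_sections (unit_space G) E\<rbrakk>
      \<Longrightarrow> continuous_on UNIV (coefficient G E L \<xi> \<eta>)"

section \<open>The Fourier-Stieltjes algebra\<close>

text \<open>One cannot quantify over types, so the fibres range over all Hilbert spaces, with
  arbitrary operations, whose elements are taken from the type \<^typ>\<open>nat \<Rightarrow> complex\<close>. As fibres are
  separable, this loses nothing: the lemma \<open>G_hilbert_bundle_transfer\<close> below replaces a
  bundle with fibres in any type by such a one, with the same coefficients and norms.\<close>

definition FS_representation ::
  "'g::topological_space groupoid \<Rightarrow> ('g, nat \<Rightarrow> complex) hilbert_bundle
    \<Rightarrow> ('g \<Rightarrow> (nat \<Rightarrow> complex) \<Rightarrow> (nat \<Rightarrow> complex))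
    \<Rightarrow> ('g \<Rightarrow> nat \<Rightarrow> complex) \<Rightarrow> ('g \<Rightarrow> nat \<Rightarrow> complex) \<Rightarrow> ('g \<Rightarrow> complex) \<Rightarrow> bool"
  where "FS_representation G E L \<xi> \<eta> \<phi> \<longleftrightarrow>
    G_hilbert_bundle G E L \<and>
    \<xi> \<in> bounded_sections (unit_space G) E \<and> \<eta> \<in> bounded_sections (unit_space G) E \<and>
    \<phi> = coefficient G E L \<xi> \<eta>"

definition fourier_stieltjes :: "'g::topological_space groupoid \<Rightarrow> ('g \<Rightarrow> complex) set"
  where "fourier_stieltjes G = {\<phi>. \<exists>E L \<xi> \<eta>. FS_representation G E L \<xi> \<eta> \<phi>}"

definition FS_norm :: "'g::topological_space groupoid \<Rightarrow> ('g \<Rightarrow> complex) \<Rightarrow> real"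
  where "FS_norm G \<phi> = Inf {section_norm (unit_space G) E \<xi> * section_norm (unit_space G) E \<eta> |
    E L \<xi> \<eta>. FS_representation G E L \<xi> \<eta> \<phi>}"

subsection \<open>Changing the type of the fibres\<close>

context complex_vector_space
begin

abbreviation minus_on :: "'a \<Rightarrow> 'a \<Rightarrow> 'a"
  where "minus_on v w \<equiv> add v (scal (-1) w)"

lemma zero_add: "v \<in> V \<Longrightarrow> add zero v = v"
  by (simp add: add_commute add_zero zero_closed)

lemma scale_0:
  assumes v: "v \<in> V"
  shows "scal 0 v = zero"
proof -
  let ?s = "scal 0 v"
  have s: "?s \<in> V" by (rule scale_closed[OF v])
  obtain t where t: "t \<in> V" "add ?s t = zero" using add_inverse[OF s] by blast
  have "add ?s ?s = ?s" using scale_add_left[OF v, of 0 0] by simp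
  then have "add ?s (add ?s t) = add ?s t" using add_assoc[OF s s t(1)] by simp
  then show ?thesis using t(2) add_zero[OF s] by simp
qed

lemma add_minus_cancel: "v \<in> V \<Longrightarrow> add (scal (-1) v) v = zero"
  using scale_add_left[of v "-1" 1] scale_one[of v] scale_0[of v] by simp

lemma minus_closed: "\<lbrakk>v \<in> V; w \<in> V\<rbrakk> \<Longrightarrow> minus_on v w \<in> V"
  by (simp add: add_closed scale_closed)

lemma minus_add_cancel:
  assumes "v \<in> V" "w \<in> V"
  shows "add (minus_on v w) w = v"
  using assms by (simp add: add_assoc scale_closed add_minus_cancel add_zero)

lemma minus_eq_zero_iff:
  assumes "v \<in> V" "w \<in> V"
  shows "minus_on v w = zero \<longleftrightarrow> v = w"
proof
  assume "minus_on v w = zero"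
  then show "v = w" using minus_add_cancel[OF assms] zero_add[OF assms(2)] by simp
next
  assume "v = w"
  then show "minus_on v w = zero"
    using assms add_minus_cancel by (simp add: add_commute scale_closed)
qed

lemma minus_swap:
  assumes "v \<in> V" "w \<in> V"
  shows "minus_on w v = scal (-1) (minus_on v w)"
  using assms by (simp add: scale_add_right scale_closed scale_scale scale_one add_commute)

lemma minus_triangle:
  assumes "u \<in> V" "v \<in> V" "w \<in> V"
  shows "minus_on u w = add (minus_on u v) (minus_on v w)"
proof -
  have "add (minus_on u v) (minus_on v w) = add (add (minus_on u v) v) (scal (-1) w)"
    using assms by (intro add_assoc[symmetric] minus_closed scale_closed)
  then show ?thesis using minus_add_cancel assms by simp
qed

end

context hilbert_space
begin

lemma hinner_zero:
  assumes "v \<in> hcarrier H"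
  shows "hinner H v (hzero H) = 0"
  using hinner_add[OF assms zero_closed zero_closed] by (simp add: add_zero zero_closed)

lemma hnorm_zero: "hnorm H (hzero H) = 0"
  by (simp add: hnorm_def hinner_zero zero_closed)

lemma Im_hinner: "v \<in> hcarrier H \<Longrightarrow> Im (hinner H v v) = 0"
  using hinner_cnj[of v v] by (metis add_cancel_right_right complex_cnj complex_eq_iff cnj.simps(2) neg_equal_zero)

lemma hnorm_sq: "v \<in> hcarrier H \<Longrightarrow> (hnorm H v)\<^sup>2 = Re (hinner H v v)"
  by (simp add: hnorm_def hinner_nonneg)

lemma hnorm_eq_0_iff:
  assumes "v \<in> hcarrier H"
  shows "hnorm H v = 0 \<longleftrightarrow> v = hzero H"
proof
  assume "hnorm H v = 0"
  then have "hinner H v v = 0"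
    using hnorm_sq[OF assms] Im_hinner[OF assms] by (simp add: complex_eq_iff)
  then show "v = hzero H" using hinner_definite assms by blast
qed (simp add: hnorm_zero)

lemma hinner_scale_left:
  assumes "v \<in> hcarrier H" "w \<in> hcarrier H"
  shows "hinner H (hscale H c v) w = cnj c * hinner H v w"
proof -
  have "hinner H (hscale H c v) w = cnj (hinner H w (hscale H c v))"
    using assms by (intro hinner_cnj scale_closed)
  also have "\<dots> = cnj c * cnj (hinner H w v)" using assms by (simp add: hinner_scale)
  also have "cnj (hinner H w v) = hinner H v w" using hinner_cnj[OF assms(2,1)] by simp
  finally show ?thesis .
qed

lemma hnorm_scale:
  assumes "v \<in> hcarrier H"
  shows "hnorm H (hscale H c v) = cmod c * hnorm H v"
proof -
  have "hinner H (hscale H c v) (hscale H c v) = (c * cnj c) * hinner H v v"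
    using assms by (simp add: hinner_scale_left hinner_scale scale_closed)
  also have "Re \<dots> = (cmod c)\<^sup>2 * Re (hinner H v v)"
    by (simp add: complex_mult_cnj cmod_power2)
  finally show ?thesis by (simp add: hnorm_def real_sqrt_mult)
qed

lemma hinner_add_left:
  assumes "u \<in> hcarrier H" "v \<in> hcarrier H" "w \<in> hcarrier H"
  shows "hinner H (hadd H u v) w = hinner H u w + hinner H v w"
  using assms hinner_add[of w u v] hinner_cnj[of w "hadd H u v"] hinner_cnj[of w u] hinner_cnj[of w v]
  by (simp add: add_closed)

lemma hnorm_add_sq:
  assumes "v \<in> hcarrier H" "w \<in> hcarrier H"
  shows "(hnorm H (hadd H v w))\<^sup>2 = (hnorm H v)\<^sup>2 + 2 * Re (hinner H v w) + (hnorm H w)\<^sup>2"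
  using assms hinner_cnj[of v w] by (simp add: hnorm_sq add_closed hinner_add hinner_add_left)

lemma Re_hinner_le:
  assumes v: "v \<in> hcarrier H" and w: "w \<in> hcarrier H"
  shows "Re (hinner H v w) \<le> hnorm H v * hnorm H w"
proof -
  let ?R = "Re (hinner H v w)"
  have nn: "0 \<le> hnorm H v" "0 \<le> hnorm H w" using v w by (simp_all add: hnorm_def hinner_nonneg)
  have *: "0 \<le> (hnorm H v)\<^sup>2 + 2 * c * ?R + c\<^sup>2 * (hnorm H w)\<^sup>2" for c :: real
    using hnorm_add_sq[OF v scale_closed[OF w], of "complex_of_real c"] v w
      zero_le_power2[of "hnorm H (hadd H v (hscale H (complex_of_real c) w))"]
    by (simp add: hinner_scale hnorm_scale power_mult_distrib)
  show ?thesis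
  proof (cases "hnorm H w = 0")
    case True
    then show ?thesis using hnorm_eq_0_iff[OF w] hinner_zero[OF v] by simp
  next
    case False
    let ?q = "(hnorm H w)\<^sup>2"
    have q: "?q > 0" using False by simp
    have "0 \<le> (hnorm H v)\<^sup>2 - ?R\<^sup>2 / ?q"
    proof -
      have "2 * (- ?R / ?q) * ?R + (- ?R / ?q)\<^sup>2 * ?q = - (?R\<^sup>2 / ?q)"
        using q by (simp add: power2_eq_square)
      then show ?thesis using *[of "- ?R / ?q"] by simp
    qed
    then have "?R\<^sup>2 \<le> (hnorm H v * hnorm H w)\<^sup>2"
      using q by (simp add: field_simps power_mult_distrib)
    then show ?thesis using nn by (meson abs_le_square_iff abs_ge_self abs_of_nonneg mult_nonneg_nonneg order_trans power2_le_imp_le)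
  qed
qed

lemma hnorm_triangle:
  assumes "v \<in> hcarrier H" "w \<in> hcarrier H"
  shows "hnorm H (hadd H v w) \<le> hnorm H v + hnorm H w"
proof (rule power2_le_imp_le)
  show "(hnorm H (hadd H v w))\<^sup>2 \<le> (hnorm H v + hnorm H w)\<^sup>2"
    using hnorm_add_sq[OF assms] Re_hinner_le[OF assms] by (simp add: power2_sum)
  show "0 \<le> hnorm H v + hnorm H w" using assms by (simp add: hnorm_def hinner_nonneg)
qed

lemma hdist_in: "\<lbrakk>v \<in> hcarrier H; w \<in> hcarrier H\<rbrakk> \<Longrightarrow> hdist H v w = hnorm H (minus_on v w)"
  by (simp add: hdist_def norm_dist_def)

lemma hdist_commute: "hdist H v w = hdist H w v"
proof (cases "v \<in> hcarrier H \<and> w \<in> hcarrier H")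
  case True
  then have "hnorm H (minus_on w v) = hnorm H (minus_on v w)"
    using minus_swap[of v w] hnorm_scale[of "minus_on v w" "-1"] minus_closed[of v w] by simp
  then show ?thesis using True by (simp add: hdist_in)
qed (auto simp: hdist_def norm_dist_def)

lemma hdist_Metric_space: "Metric_space (hcarrier H) (hdist H)"
proof
  show "0 \<le> hdist H v w" for v w
    by (auto simp: hdist_def norm_dist_def hnorm_def intro!: hinner_nonneg minus_closed)
  show "hdist H v w = hdist H w v" for v w
    by (rule hdist_commute)
  show "hdist H v w = 0 \<longleftrightarrow> v = w" if "v \<in> hcarrier H" "w \<in> hcarrier H" for v w
    using that by (simp add: hdist_in hnorm_eq_0_iff minus_closed minus_eq_zero_iff)
  show "hdist H u w \<le> hdist H u v + hdist H v w"
    if "u \<in> hcarrier H" "v \<in> hcarrier H" "w \<in> hcarrier H" for u v w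
    using that minus_triangle[of u v w] hnorm_triangle[of "minus_on u v" "minus_on v w"]
    by (simp add: hdist_in minus_closed)
qed

sublocale hmetric: Metric_space "hcarrier H" "hdist H"
  by (rule hdist_Metric_space)

lemma ex_embedding: "\<exists>f :: 'h \<Rightarrow> nat \<Rightarrow> complex. inj_on f (hcarrier H)"
proof -
  obtain C where C: "countable C" "C \<subseteq> hcarrier H" "htopology H closure_of C = hcarrier H"
    using hseparable unfolding separable_space_def htopology_def by auto
  have "C \<noteq> {}" using C(3) zero_closed by auto
  then obtain e :: "nat \<Rightarrow> 'h" where e: "range e = C"
    using C(1) by (metis uncountable_def)
  define f where "f v n = complex_of_real (hdist H (e n) v)" for v n
  have "inj_on f (hcarrier H)"
  proof (rule inj_onI, rule ccontr)
    fix v w assume vw: "v \<in> hcarrier H" "w \<in> hcarrier H" and eq: "f v = f w" and "v \<noteq> w"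
    then have pos: "hdist H v w / 2 > 0" by simp
    have "v \<in> hmetric.mtopology closure_of C" using C(3) vw by (simp add: htopology_def)
    then obtain y where y: "y \<in> C" "hdist H v y < hdist H v w / 2"
      unfolding hmetric.metric_closure_of hmetric.in_mball using pos by blast
    then obtain n where "y = e n" using e by auto
    then have "hdist H y v = hdist H y w" using fun_cong[OF eq, of n] by (simp add: f_def)
    moreover have "hdist H v w \<le> hdist H v y + hdist H y w"
      using vw y(1) C(2) by (intro hmetric.triangle) auto
    ultimately show False using y(2) hdist_commute[of v y] by simp
  qed
  then show ?thesis by blast
qed

end

definition hmap :: "('h \<Rightarrow> 'k) \<Rightarrow> 'h hspace \<Rightarrow> 'k hspace"
  where "hmap f H = (let g = inv_into (hcarrier H) f in
    \<lparr>hcarrier = f ` hcarrier H, hzero = f (hzero H),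
     hadd = (\<lambda>a b. f (hadd H (g a) (g b))), hscale = (\<lambda>c a. f (hscale H c (g a))),
     hinner = (\<lambda>a b. hinner H (g a) (g b))\<rparr>)"

context
  fixes H :: "'h hspace" and f :: "'h \<Rightarrow> 'k"
  assumes inj: "inj_on f (hcarrier H)"
begin

lemma hmap_simps:
  "hcarrier (hmap f H) = f ` hcarrier H"
  "hzero (hmap f H) = f (hzero H)"
  "\<lbrakk>v \<in> hcarrier H; w \<in> hcarrier H\<rbrakk> \<Longrightarrow> hadd (hmap f H) (f v) (f w) = f (hadd H v w)"
  "v \<in> hcarrier H \<Longrightarrow> hscale (hmap f H) c (f v) = f (hscale H c v)"
  "\<lbrakk>v \<in> hcarrier H; w \<in> hcarrier H\<rbrakk> \<Longrightarrow> hinner (hmap f H) (f v) (f w) = hinner H v w"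
  "v \<in> hcarrier H \<Longrightarrow> hnorm (hmap f H) (f v) = hnorm H v"
  using inj by (auto simp: hmap_def Let_def hnorm_def)

lemma hmap_vector_space:
  assumes "hilbert_space H"
  shows "complex_vector_space (hcarrier (hmap f H)) (hzero (hmap f H)) (hadd (hmap f H)) (hscale (hmap f H))"
proof -
  interpret hilbert_space H by fact
  show ?thesis
  proof
    fix a assume "a \<in> hcarrier (hmap f H)"
    then obtain v where v: "v \<in> hcarrier H" "a = f v" by (auto simp: hmap_simps)
    obtain w where "w \<in> hcarrier H" "hadd H v w = hzero H" using add_inverse v by blast
    then show "\<exists>b\<in>hcarrier (hmap f H). hadd (hmap f H) a b = hzero (hmap f H)"
      using v by (auto simp: hmap_simps intro!: bexI[of _ w])
  qed (auto simp: hmap_simps zero_closed add_closed scale_closed add_assoc add_zero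
      scale_add_right scale_add_left scale_scale scale_one intro: arg_cong[OF add_commute])
qed

lemma hmap_hdist:
  assumes "hilbert_space H" "v \<in> hcarrier H" "w \<in> hcarrier H"
  shows "hdist (hmap f H) (f v) (f w) = hdist H v w"
proof -
  interpret hilbert_space H by fact
  show ?thesis
    using assms by (simp add: hdist_def norm_dist_def hmap_simps add_closed scale_closed)
qed

lemma hmap_Metric_space:
  assumes "hilbert_space H"
  shows "Metric_space (hcarrier (hmap f H)) (hdist (hmap f H))"
proof -
  interpret hilbert_space H by fact
  show ?thesis
  proof
    fix a b
    have *: "hdist (hmap f H) a b = (if a \<in> f ` hcarrier H \<and> b \<in> f ` hcarrier H
      then hdist H (inv_into (hcarrier H) f a) (inv_into (hcarrier H) f b) else 0)" for a b
      using hmap_hdist[OF assms] inj by (auto simp: hdist_def norm_dist_def hmap_simps)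
    show "0 \<le> hdist (hmap f H) a b" by (simp add: *)
    show "hdist (hmap f H) a b = hdist (hmap f H) b a" by (simp add: * hmetric.commute)
    show "hdist (hmap f H) a b = 0 \<longleftrightarrow> a = b"
      if "a \<in> hcarrier (hmap f H)" "b \<in> hcarrier (hmap f H)"
      using that inj by (auto simp: hmap_simps hmap_hdist[OF assms] inj_on_def)
    show "hdist (hmap f H) a c \<le> hdist (hmap f H) a b + hdist (hmap f H) b c"
      if "a \<in> hcarrier (hmap f H)" "b \<in> hcarrier (hmap f H)" "c \<in> hcarrier (hmap f H)" for c
      using that hmetric.triangle by (auto simp: hmap_simps hmap_hdist[OF assms])
  qed
qed

lemma hmap_closure_of:
  assumes "hilbert_space H" "S \<subseteq> hcarrier H"
  shows "htopology (hmap f H) closure_of (f ` S) = f ` (htopology H closure_of S)"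
proof -
  interpret hilbert_space H by fact
  interpret K: Metric_space "hcarrier (hmap f H)" "hdist (hmap f H)"
    by (rule hmap_Metric_space[OF assms(1)])
  have "f y \<in> K.mball (f x) r \<longleftrightarrow> y \<in> hmetric.mball x r"
    if "x \<in> hcarrier H" "y \<in> hcarrier H" for x y r
    using that unfolding K.in_mball hmetric.in_mball
    by (simp add: hmap_simps hmap_hdist[OF assms(1)])
  then show ?thesis
    unfolding htopology_def K.metric_closure_of hmetric.metric_closure_of
    using assms(2) by (auto simp: hmap_simps image_iff subset_iff)
qed

lemma hmap_hilbert_space:
  assumes "hilbert_space H"
  shows "hilbert_space (hmap f H)"
proof -
  interpret hilbert_space H by fact
  interpret K: complex_vector_space "hcarrier (hmap f H)" "hzero (hmap f H)" "hadd (hmap f H)"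
    "hscale (hmap f H)" by (rule hmap_vector_space[OF assms])
  interpret KM: Metric_space "hcarrier (hmap f H)" "hdist (hmap f H)"
    by (rule hmap_Metric_space[OF assms])
  show ?thesis
  proof
    show "KM.mcomplete"
      unfolding KM.mcomplete_def
    proof (intro allI impI)
      fix a assume a: "KM.MCauchy a"
      define v where "v n = inv_into (hcarrier H) f (a n)" for n
      have "a n \<in> f ` hcarrier H" for n
        using a unfolding KM.MCauchy_def by (auto simp: hmap_simps)
      then have av: "a n = f (v n)" and v: "v n \<in> hcarrier H" for n
        unfolding v_def by (simp add: f_inv_into_f, simp add: inv_into_into)
      have "hmetric.MCauchy v"
        using a v unfolding KM.MCauchy_def hmetric.MCauchy_def
        by (auto simp: av hmap_hdist[OF assms])
      then obtain l where l: "limitin hmetric.mtopology v l sequentially"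
        using hcomplete unfolding hmetric.mcomplete_def by blast
      then have lH: "l \<in> hcarrier H"
        using hmetric.limit_metric_sequentially by blast
      have "limitin KM.mtopology a (f l) sequentially"
        using l lH v unfolding hmetric.limit_metric_sequentially KM.limit_metric_sequentially
        by (auto simp: hmap_simps av hmap_hdist[OF assms])
      then show "\<exists>b. limitin KM.mtopology a b sequentially" ..
    qed
    obtain C where C: "countable C" "C \<subseteq> hcarrier H" "htopology H closure_of C = hcarrier H"
      using hseparable unfolding separable_space_def htopology_def by auto
    have "topspace (htopology (hmap f H)) = f ` hcarrier H"
      unfolding htopology_def KM.topspace_mtopology by (rule hmap_simps)
    then show "separable_space (htopology (hmap f H))"
      unfolding separable_space_def
      using hmap_closure_of[OF assms C(2)] C by (intro exI[of _ "f ` C"]) auto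
  qed (auto simp: hmap_simps zero_closed add_closed scale_closed hinner_add hinner_scale
      hinner_nonneg intro: hinner_cnj arg_cong[OF hinner_definite])
qed

end

lemma source_map_in_unit_space:
  assumes "topological_groupoid G"
  shows "source_map G x \<in> unit_space G"
proof -
  have "source_map G x = range_map G (ginv G x)"
    by (simp add: source_map_def range_map_def topological_groupoid.inv_inv[OF assms])
  then show ?thesis by (simp add: unit_space_def)
qed

lemma source_range_gmult:
  assumes "topological_groupoid G" "(x, y) \<in> composable G"
  shows "source_map G (gmult G x y) = source_map G y" "range_map G (gmult G x y) = range_map G x"
    "source_map G x = range_map G y"
proof -
  interpret topological_groupoid G by fact
  have inv_c: "(ginv G z, z) \<in> composable G" for z using inv_composable[of "ginv G z"] inv_inv by simp
  have xy: "(x, y) \<in> composable G" by fact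
  let ?p = "gmult G x y"
  have 1: "gmult G (ginv G x) ?p = y" by (rule inv_mult[OF xy])
  have 2: "gmult G ?p (ginv G y) = x" by (rule mult_inv[OF xy])
  have p_iy: "(?p, ginv G y) \<in> composable G"
    using assoc_composable[OF xy inv_composable[of y]] by simp
  have ix_p: "(ginv G x, ?p) \<in> composable G"
    using assoc_composable[OF inv_c xy] by simp
  have ip_x: "(ginv G ?p, x) \<in> composable G"
    using assoc_composable[OF inv_c p_iy] 2 by simp
  have y_ip: "(y, ginv G ?p) \<in> composable G"
    using assoc_composable[OF ix_p inv_composable] 1 by simp
  have 3: "gmult G (ginv G ?p) x = ginv G y" using inv_mult[OF p_iy] 2 by simp
  have 4: "gmult G y (ginv G ?p) = ginv G x" using mult_inv[OF ix_p] 1 by simp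
  show "source_map G ?p = source_map G y"
    unfolding source_map_def using assoc[OF ip_x xy] 3 by simp
  show "range_map G ?p = range_map G x"
    unfolding range_map_def using assoc[OF xy y_ip] 4 by simp
  have ix_x_y: "gmult G (gmult G (ginv G x) x) y = y"
    using assoc[OF inv_c xy] 1 by simp
  have "(gmult G (ginv G x) x, y) \<in> composable G"
    using assoc_composable[OF inv_c xy] by simp
  then have "gmult G (gmult G (gmult G (ginv G x) x) y) (ginv G y) = gmult G (ginv G x) x"
    by (rule mult_inv)
  then show "source_map G x = range_map G y"
    using ix_x_y by (simp add: source_map_def range_map_def)
qed

lemma G_hilbert_bundle_transfer:
  fixes E :: "('g::topological_space, 'h) hilbert_bundle"
  assumes G: "topological_groupoid G" and E: "G_hilbert_bundle G E L"
    and \<xi>: "\<xi> \<in> bounded_sections (unit_space G) E" and \<eta>: "\<eta> \<in> bounded_sections (unit_space G) E"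
  shows "\<exists>E' L' \<xi>' \<eta>'. FS_representation G E' L' \<xi>' \<eta>' (coefficient G E L \<xi> \<eta>) \<and>
    section_norm (unit_space G) E' \<xi>' = section_norm (unit_space G) E \<xi> \<and>
    section_norm (unit_space G) E' \<eta>' = section_norm (unit_space G) E \<eta>"
proof -
  interpret G_hilbert_bundle G E L by fact
  let ?X = "unit_space G"
  let ?H = "fibre E"
  note hs = fibre_hilbert
  have "\<forall>u\<in>?X. \<exists>f :: 'h \<Rightarrow> nat \<Rightarrow> complex. inj_on f (hcarrier (?H u))"
    using hilbert_space.ex_embedding[OF hs] by blast
  then obtain f :: "'g \<Rightarrow> 'h \<Rightarrow> nat \<Rightarrow> complex" where
    inj: "u \<in> ?X \<Longrightarrow> inj_on (f u) (hcarrier (?H u))" for u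
    by metis
  define g where "g u = inv_into (hcarrier (?H u)) (f u)" for u
  have gf[simp]: "g u (f u v) = v" if "u \<in> ?X" "v \<in> hcarrier (?H u)" for u v
    unfolding g_def using inj that by simp
  define T where "T \<xi> = (\<lambda>u\<in>?X. f u (\<xi> u))" for \<xi> :: "'g \<Rightarrow> 'h"
  define E' where "E' = \<lparr>fibre = (\<lambda>u. hmap (f u) (?H u)), sections = T ` sections E\<rparr>"
  define L' where "L' x = f (range_map G x) \<circ> L x \<circ> g (source_map G x)" for x
  have fib': "fibre E' u = hmap (f u) (?H u)" for u by (simp add: E'_def)
  have sec': "sections E' = T ` sections E" by (simp add: E'_def)
  note hm = hmap_simps[OF inj]
  have sX[simp]: "source_map G x \<in> ?X" and rX[simp]: "range_map G x \<in> ?X" for x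
    using source_map_in_unit_space[OF G] by (auto simp: unit_space_def)
  have secD: "\<xi> u \<in> hcarrier (?H u)" if "\<xi> \<in> sections E" "u \<in> ?X" for \<xi> u
    using sections_subset that by (auto simp: PiE_iff)
  have Tu: "T \<xi> u = f u (\<xi> u)" if "u \<in> ?X" for \<xi> u using that by (simp add: T_def)
  have norm_T: "hnorm (fibre E' u) (T \<xi> u) = hnorm (?H u) (\<xi> u)"
    if "\<xi> \<in> sections E" "u \<in> ?X" for \<xi> u
    using that by (simp add: Tu fib' hm secD)
  have L_in: "L x v \<in> hcarrier (?H (range_map G x))" if "v \<in> hcarrier (?H (source_map G x))" for x v
    using L_isometry[of x] that by (auto simp: linear_isometry_onto_def)
  have L'f: "L' x (f (source_map G x) v) = f (range_map G x) (L x v)"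
    if "v \<in> hcarrier (?H (source_map G x))" for x v
    using that by (simp add: L'_def)
  have E': "continuous_hilbert_bundle ?X E'"
  proof (rule continuous_hilbert_bundle.intro)
    show "hilbert_space (fibre E' u)" if "u \<in> ?X" for u
      using that by (simp add: fib' hmap_hilbert_space inj hs)
    show "sections E' \<subseteq> (\<Pi>\<^sub>E u\<in>?X. hcarrier (fibre E' u))"
      by (auto simp: sec' T_def fib' hm secD)
    show "(\<lambda>u\<in>?X. hzero (fibre E' u)) \<in> sections E'"
      unfolding sec' by (rule image_eqI[OF _ sections_zero]) (auto simp: T_def fib' hm)
    show "(\<lambda>u\<in>?X. hadd (fibre E' u) (a u) (b u)) \<in> sections E'"
      if a: "a \<in> sections E'" and b: "b \<in> sections E'" for a b
    proof -
      obtain \<alpha> \<beta> where ab: "\<alpha> \<in> sections E" "\<beta> \<in> sections E" "a = T \<alpha>" "b = T \<beta>"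
        using a b by (auto simp: sec')
      show ?thesis unfolding sec'
        by (rule image_eqI[OF _ sections_add[OF ab(1,2)]])
          (auto simp: T_def fib' hm secD ab)
    qed
    show "(\<lambda>u\<in>?X. hscale (fibre E' u) c (a u)) \<in> sections E'" if a: "a \<in> sections E'" for a c
    proof -
      obtain \<alpha> where ab: "\<alpha> \<in> sections E" "a = T \<alpha>"
        using a by (auto simp: sec')
      show ?thesis unfolding sec'
        by (rule image_eqI[OF _ sections_scale[OF ab(1), of c]])
          (auto simp: T_def fib' hm secD ab)
    qed
    show "htopology (fibre E' u) closure_of ((\<lambda>\<xi>. \<xi> u) ` sections E') = hcarrier (fibre E' u)"
      if u: "u \<in> ?X" for u
    proof -
      have "(\<lambda>\<xi>. \<xi> u) ` sections E' = f u ` ((\<lambda>\<xi>. \<xi> u) ` sections E)"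
        using u by (auto simp: sec' image_image Tu)
      moreover have "(\<lambda>\<xi>. \<xi> u) ` sections E \<subseteq> hcarrier (?H u)"
        using secD u by auto
      ultimately show ?thesis
        using hmap_closure_of[OF inj[OF u] hs[OF u]] sections_dense[OF u]
        by (simp add: fib' hm u)
    qed
    show "continuous_on ?X (\<lambda>u. hnorm (fibre E' u) (a u))" if a: "a \<in> sections E'" for a
    proof -
      obtain \<alpha> where ab: "\<alpha> \<in> sections E" "a = T \<alpha>"
        using a by (auto simp: sec')
      then show ?thesis
        using sections_norm[OF ab(1)] norm_T[OF ab(1)] by (simp cong: continuous_on_cong)
    qed
    show "a \<in> sections E'" if a: "a \<in> (\<Pi>\<^sub>E u\<in>?X. hcarrier (fibre E' u))"
      and loc: "\<And>t \<epsilon>. \<lbrakk>t \<in> ?X; 0 < \<epsilon>\<rbrakk> \<Longrightarrow> \<exists>\<xi>'\<in>sections E'. \<exists>U. open U \<and> t \<in> U \<and>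
          (\<forall>u\<in>U \<inter> ?X. hdist (fibre E' u) (a u) (\<xi>' u) \<le> \<epsilon>)" for a
    proof -
      define \<alpha> where "\<alpha> = (\<lambda>u\<in>?X. g u (a u))"
      have au: "a u \<in> f u ` hcarrier (?H u)" if "u \<in> ?X" for u
        using a that by (auto simp: fib' hm PiE_iff)
      have \<alpha>u: "\<alpha> u \<in> hcarrier (?H u)" "f u (\<alpha> u) = a u" if "u \<in> ?X" for u
        using au[OF that] that unfolding \<alpha>_def g_def by (auto simp: inj)
      have aT: "a = T \<alpha>"
      proof
        show "a u = T \<alpha> u" for u
          using a \<alpha>u(2) by (cases "u \<in> ?X") (auto simp: T_def PiE_iff extensional_def)
      qed
      have "\<alpha> \<in> sections E"
      proof (rule sections_local)
        show "\<alpha> \<in> (\<Pi>\<^sub>E u\<in>?X. hcarrier (?H u))"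
          using \<alpha>u(1) by (auto simp: PiE_iff \<alpha>_def)
        fix t :: 'g and \<epsilon> :: real assume "t \<in> ?X" "0 < \<epsilon>"
        then obtain b U where b: "b \<in> sections E'" "open U" "t \<in> U"
          "\<forall>u\<in>U \<inter> ?X. hdist (fibre E' u) (a u) (b u) \<le> \<epsilon>"
          using loc by meson
        obtain \<beta> where "\<beta> \<in> sections E" "b = T \<beta>" using b(1) unfolding sec' by blast
        then have *: "\<beta> \<in> sections E" "open U" "t \<in> U"
          "\<And>u. u \<in> U \<inter> ?X \<Longrightarrow> hdist (fibre E' u) (a u) (T \<beta> u) \<le> \<epsilon>"
          using b by simp_all
        have "hdist (?H u) (\<alpha> u) (\<beta> u) \<le> \<epsilon>" if "u \<in> U \<inter> ?X" for u
          using *(4)[OF that] that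
            hmap_hdist[OF inj hs, of u "\<alpha> u" "\<beta> u"] \<alpha>u(1)[of u] secD[OF *(1), of u]
          by (simp add: aT Tu fib')
        then show "\<exists>\<xi>'\<in>sections E. \<exists>U. open U \<and> t \<in> U \<and>
            (\<forall>u\<in>U \<inter> ?X. hdist (?H u) (\<alpha> u) (\<xi>' u) \<le> \<epsilon>)"
          using * by blast
      qed
      then show ?thesis using aT by (simp add: sec')
    qed
  qed
  have bdd_T: "T \<zeta> \<in> bounded_sections ?X E' \<longleftrightarrow> \<zeta> \<in> bounded_sections ?X E"
    if "\<zeta> \<in> sections E" for \<zeta>
    using that norm_T[OF that] by (auto simp: bounded_sections_def sec' cong: image_cong_simp)
  have coeff_T: "coefficient G E' L' (T \<alpha>) (T \<beta>) = coefficient G E L \<alpha> \<beta>"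
    if "\<alpha> \<in> sections E" "\<beta> \<in> sections E" for \<alpha> \<beta>
    using that by (auto simp: coefficient_def fun_eq_iff fib' Tu L'f secD hm L_in)
  have norm_T': "section_norm ?X E' (T \<zeta>) = section_norm ?X E \<zeta>" if "\<zeta> \<in> sections E" for \<zeta>
    using norm_T[OF that] by (simp add: section_norm_def cong: image_cong_simp)
  have "G_hilbert_bundle G E' L'"
  proof (intro G_hilbert_bundle.intro G_hilbert_bundle_axioms.intro E')
    fix x
    let ?s = "source_map G x" and ?r = "range_map G x"
    interpret S: hilbert_space "?H ?s" by (rule hs) simp
    have LL: "L x ` hcarrier (?H ?s) = hcarrier (?H ?r)"
      using L_isometry[of x] by (simp add: linear_isometry_onto_def)
    have img: "L' x ` (f ?s ` hcarrier (?H ?s)) = f ?r ` hcarrier (?H ?r)"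
      unfolding LL[symmetric] image_image by (intro image_cong refl L'f)
    show "linear_isometry_onto (fibre E' ?s) (fibre E' ?r) (L' x)"
      unfolding linear_isometry_onto_def
      using L_isometry[of x] img unfolding linear_isometry_onto_def
      by (simp add: fib' hm L'f S.add_closed S.scale_closed L_in)
  next
    fix x y a
    assume xy: "(x, y) \<in> composable G" and a: "a \<in> hcarrier (fibre E' (source_map G y))"
    then obtain v where v: "v \<in> hcarrier (?H (source_map G y))" "a = f (source_map G y) v"
      by (auto simp: fib' hm)
    note m = source_range_gmult[OF G xy]
    have "L y v \<in> hcarrier (?H (source_map G x))" using L_in[OF v(1)] m(3) by simp
    moreover have "L' y a = f (source_map G x) (L y v)" using v m(3) L'f by simp
    ultimately have "L' x (L' y a) = f (range_map G x) (L x (L y v))" using L'f by simp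
    moreover have "L' (gmult G x y) a = f (range_map G x) (L (gmult G x y) v)"
      using L'f[of v "gmult G x y"] v m by simp
    ultimately show "L' (gmult G x y) a = L' x (L' y a)"
      using L_mult[OF xy v(1)] by simp
  next
    fix a b assume "a \<in> bounded_sections ?X E'" "b \<in> bounded_sections ?X E'"
    then obtain \<alpha> \<beta> where "\<alpha> \<in> sections E" "\<beta> \<in> sections E" "a = T \<alpha>" "b = T \<beta>"
      "\<alpha> \<in> bounded_sections ?X E" "\<beta> \<in> bounded_sections ?X E"
      using bdd_T by (auto simp: bounded_sections_def sec')
    then show "continuous_on UNIV (coefficient G E' L' a b)"
      using coeff_T coefficient_continuous by simp
  qed
  moreover have "\<xi> \<in> sections E" "\<eta> \<in> sections E" using \<xi> \<eta> by (auto simp: bounded_sections_def)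
  ultimately have "FS_representation G E' L' (T \<xi>) (T \<eta>) (coefficient G E L \<xi> \<eta>) \<and>
    section_norm ?X E' (T \<xi>) = section_norm ?X E \<xi> \<and> section_norm ?X E' (T \<eta>) = section_norm ?X E \<eta>"
    using bdd_T coeff_T norm_T' \<xi> \<eta> by (simp add: FS_representation_def)
  then show ?thesis by blast
qed

end

theory Submission
  imports Defs
begin

text \<open>
  Everything follows from operations on bundles: the coefficients of a Hilbert sum are the sums of
  coefficients, those of a tensor product the products. With the two sections of each summand
  balanced to have equal norm, the countable Hilbert sum yields \<open>\<parallel>\<Sum>\<^sub>n \<phi>\<^sub>n\<parallel> \<le> \<Sum>\<^sub>n \<parallel>\<phi>\<^sub>n\<parallel>\<close>, which contains
  both the triangle inequality and completeness. The unit is the coefficient of the constant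
  section 1 of the trivial line bundle, and Cauchy-Schwarz bounds the supremum norm by \<open>\<parallel>\<cdot>\<parallel>\<close>.
\<close>

section \<open>Normed spaces and Hilbert spaces on carrier sets\<close>

text \<open>Continuity of a bundle is tested only on a family of sections whose values are total in
  every fibre. Locally uniform limits of linear combinations of such a family form a
  \<open>G\<close>-Hilbert bundle as soon as the inner products and coefficients of its members are
  continuous, so a new bundle requires only fibres, isometries and generators. Fibres can then be
  built with no regard to their neighbours: the tensor product uses an orthonormal basis picked
  arbitrarily at each unit, yet inner products of elementary tensors do not see that choice. For the
  same reason the isometries of the tensor bundle have no useful formula in coordinates; they are
  extended from elementary tensors by isometry. Sums and tensor products change the type of the
  fibres, and their coefficients return to \<open>fourier_stieltjes G\<close> through
  \<open>G_hilbert_bundle_transfer\<close>. The infimum in the norm is not known to be attained, so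
  all estimates use an arbitrary bound above it; the triangle inequality is the series estimate with
  small surplus terms.\<close>

locale complex_normed_space = complex_vector_space +
  fixes nrm :: "'a \<Rightarrow> real"
  assumes nonneg: "v \<in> V \<Longrightarrow> 0 \<le> nrm v"
    and eq_0_iff: "v \<in> V \<Longrightarrow> nrm v = 0 \<longleftrightarrow> v = zero"
    and scale: "v \<in> V \<Longrightarrow> nrm (scal c v) = cmod c * nrm v"
    and triangle: "\<lbrakk>v \<in> V; w \<in> V\<rbrakk> \<Longrightarrow> nrm (add v w) \<le> nrm v + nrm w"
begin

lemma norm_dist_Metric_space: "Metric_space V (norm_dist V add scal nrm)"
proof
  fix v w
  show "0 \<le> norm_dist V add scal nrm v w"
    by (simp add: norm_dist_def nonneg minus_closed)
  show "norm_dist V add scal nrm v w = norm_dist V add scal nrm w v"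
    using minus_swap[of v w] scale[of "minus_on v w" "-1"]
    by (simp add: norm_dist_def minus_closed)
  show "norm_dist V add scal nrm v w = 0 \<longleftrightarrow> v = w" if "v \<in> V" "w \<in> V"
    using that by (simp add: norm_dist_def eq_0_iff minus_closed minus_eq_zero_iff)
  show "norm_dist V add scal nrm v u \<le> norm_dist V add scal nrm v w + norm_dist V add scal nrm w u"
    if "v \<in> V" "w \<in> V" "u \<in> V" for u
    using that minus_triangle[of v w u] triangle[of "minus_on v w" "minus_on w u"]
    by (simp add: norm_dist_def minus_closed)
qed

text \<open>Completeness restated with plain norms of differences. The limit is asked for with \<le>
  only, because bounds that pass to a limit come out non-strict; applying them to \<epsilon>/2
  restores strictness.\<close>

lemma norm_dist_mcomplete:
  assumes lim: "\<And>f :: nat \<Rightarrow> _. \<lbrakk>\<And>n. f n \<in> V; \<And>\<epsilon>. 0 < \<epsilon> \<Longrightarrow> \<exists>N. \<forall>m\<ge>N. \<forall>n\<ge>N. nrm (minus_on (f m) (f n)) < \<epsilon>\<rbrakk>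
    \<Longrightarrow> \<exists>l\<in>V. \<forall>\<epsilon>>0. \<exists>N. \<forall>n\<ge>N. nrm (minus_on (f n) l) \<le> \<epsilon>"
  shows "Metric_space.mcomplete V (norm_dist V add scal nrm)"
proof -
  interpret M: Metric_space V "norm_dist V add scal nrm" by (rule norm_dist_Metric_space)
  show ?thesis unfolding M.mcomplete_def
  proof (intro allI impI)
    fix f assume f: "M.MCauchy f"
    then have fV: "f n \<in> V" for n unfolding M.MCauchy_def by auto
    have "\<exists>l\<in>V. \<forall>\<epsilon>>0. \<exists>N. \<forall>n\<ge>N. nrm (minus_on (f n) l) \<le> \<epsilon>"
    proof (rule lim[OF fV])
      fix \<epsilon> :: real assume "0 < \<epsilon>"
      then show "\<exists>N. \<forall>m\<ge>N. \<forall>n\<ge>N. nrm (minus_on (f m) (f n)) < \<epsilon>"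
        using f fV unfolding M.MCauchy_def norm_dist_def by simp
    qed
    then obtain l where l: "l \<in> V" "\<And>\<epsilon>. 0 < \<epsilon> \<Longrightarrow> \<exists>N. \<forall>n\<ge>N. nrm (minus_on (f n) l) \<le> \<epsilon>" by blast
    have "\<exists>N. \<forall>n\<ge>N. f n \<in> V \<and> norm_dist V add scal nrm (f n) l < \<epsilon>" if "\<epsilon> > 0" for \<epsilon>
    proof -
      obtain N where "\<forall>n\<ge>N. nrm (minus_on (f n) l) \<le> \<epsilon> / 2" using l(2)[OF half_gt_zero[OF \<open>\<epsilon> > 0\<close>]] by blast
      then have "norm_dist V add scal nrm (f n) l < \<epsilon>" if "n \<ge> N" for n
        using that l(1) fV[of n] \<open>\<epsilon> > 0\<close> by (force simp: norm_dist_def)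
      then show ?thesis using fV by blast
    qed
    then show "\<exists>l. limitin M.mtopology f l sequentially"
      unfolding M.limit_metric_sequentially using l(1) by blast
  qed
qed

end

text \<open>Positivity and definiteness of the inner product are read off from the norm axioms, so
  that for Hilbert sums the triangle inequality can be proved directly by Minkowski rather than
  through Cauchy-Schwarz.\<close>

lemma hilbert_spaceI:
  fixes H :: "'h hspace"
  assumes "complex_normed_space (hcarrier H) (hzero H) (hadd H) (hscale H) (hnorm H)"
    and cnj: "\<And>v w. \<lbrakk>v \<in> hcarrier H; w \<in> hcarrier H\<rbrakk> \<Longrightarrow> hinner H w v = cnj (hinner H v w)"
    and add: "\<And>u v w. \<lbrakk>u \<in> hcarrier H; v \<in> hcarrier H; w \<in> hcarrier H\<rbrakk>
      \<Longrightarrow> hinner H u (hadd H v w) = hinner H u v + hinner H u w"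
    and scale: "\<And>c v w. \<lbrakk>v \<in> hcarrier H; w \<in> hcarrier H\<rbrakk>
      \<Longrightarrow> hinner H v (hscale H c w) = c * hinner H v w"
    and lim: "\<And>f :: nat \<Rightarrow> _. \<lbrakk>\<And>n. f n \<in> hcarrier H;
        \<And>\<epsilon>. 0 < \<epsilon> \<Longrightarrow> \<exists>N. \<forall>m\<ge>N. \<forall>n\<ge>N. hdist H (f m) (f n) < \<epsilon>\<rbrakk>
      \<Longrightarrow> \<exists>l\<in>hcarrier H. \<forall>\<epsilon>>0. \<exists>N. \<forall>n\<ge>N. hdist H (f n) l \<le> \<epsilon>"
    and C: "countable C" "C \<subseteq> hcarrier H"
      "\<And>v \<epsilon>. \<lbrakk>v \<in> hcarrier H; 0 < \<epsilon>\<rbrakk> \<Longrightarrow> \<exists>c\<in>C. hdist H v c < \<epsilon>"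
  shows "hilbert_space H"
proof -
  interpret N: complex_normed_space "hcarrier H" "hzero H" "hadd H" "hscale H" "hnorm H" by fact
  interpret M: Metric_space "hcarrier H" "hdist H"
    unfolding hdist_def by (rule N.norm_dist_Metric_space)
  have d: "hdist H v w = hnorm H (N.minus_on v w)" if "v \<in> hcarrier H" "w \<in> hcarrier H" for v w
    using that by (simp add: hdist_def norm_dist_def)
  show ?thesis
  proof
    \<comment> \<open>In HOL \<open>sqrt\<close> is an odd function on the reals, so a nonnegative
      \<open>hnorm\<close> forces a nonnegative argument of the root.\<close>
    show "0 \<le> Re (hinner H v v)" if "v \<in> hcarrier H" for v
      using N.nonneg[OF that] by (simp add: hnorm_def)
    show "v = hzero H" if "v \<in> hcarrier H" "hinner H v v = 0" for v
      using N.eq_0_iff[OF that(1)] that(2) by (simp add: hnorm_def)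
    show "M.mcomplete" unfolding hdist_def
    proof (rule N.norm_dist_mcomplete)
      fix f :: "nat \<Rightarrow> 'h" assume f: "\<And>n. f n \<in> hcarrier H"
        "\<And>\<epsilon>. 0 < \<epsilon> \<Longrightarrow> \<exists>N. \<forall>m\<ge>N. \<forall>n\<ge>N. hnorm H (N.minus_on (f m) (f n)) < \<epsilon>"
      have "\<exists>l\<in>hcarrier H. \<forall>\<epsilon>>0. \<exists>N. \<forall>n\<ge>N. hdist H (f n) l \<le> \<epsilon>"
        using f by (intro lim) (simp_all add: d)
      then show "\<exists>l\<in>hcarrier H. \<forall>\<epsilon>>0. \<exists>N. \<forall>n\<ge>N. hnorm H (N.minus_on (f n) l) \<le> \<epsilon>"
        using f(1) by (simp add: d)
    qed
    have "M.mtopology closure_of C = hcarrier H"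
      unfolding M.metric_closure_of using C M.commute by (force simp: M.in_mball)
    then show "separable_space (htopology H)"
      unfolding separable_space_def htopology_def using C by (intro exI[of _ C]) auto
  qed (fact cnj add scale)+
qed

context hilbert_space
begin

lemma hnorm_nonneg: "v \<in> hcarrier H \<Longrightarrow> 0 \<le> hnorm H v"
  by (simp add: hnorm_def hinner_nonneg)

text \<open>Multiplying \<open>w\<close> by the conjugate phase of the inner product makes that
  product real and nonnegative without changing the norm of \<open>w\<close>; then the bound for
  real parts applies.\<close>

lemma cmod_hinner_le:
  assumes v: "v \<in> hcarrier H" and w: "w \<in> hcarrier H"
  shows "cmod (hinner H v w) \<le> hnorm H v * hnorm H w"
proof (cases "hinner H v w = 0")
  case True
  then show ?thesis using assms by (simp add: hnorm_nonneg)
next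
  case False
  define z where "z = hinner H v w"
  define c where "c = cnj z / complex_of_real (cmod z)"
  have "c * z = complex_of_real (cmod z)"
    using False complex_norm_square[of z]
    by (simp add: c_def z_def power2_eq_square field_simps)
  then have "Re (hinner H v (hscale H c w)) = cmod z"
    using assms by (simp add: hinner_scale z_def)
  moreover have "cmod c = 1"
    using False by (simp add: c_def z_def norm_divide)
  ultimately show ?thesis
    using Re_hinner_le[OF v scale_closed[OF w], of c] hnorm_scale[OF w, of c] by (simp add: z_def)
qed

lemma hnorm_hdist: "v \<in> hcarrier H \<Longrightarrow> hnorm H v = hdist H v (hzero H)"
  using hdist_in[of v "hzero H"] hnorm_scale[OF zero_closed] hnorm_zero
  by (simp add: zero_closed add_zero hnorm_eq_0_iff scale_closed)

lemma hdist_triangle: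
  "\<lbrakk>u \<in> hcarrier H; v \<in> hcarrier H; w \<in> hcarrier H\<rbrakk> \<Longrightarrow> hdist H u w \<le> hdist H u v + hdist H v w"
  by (rule hmetric.triangle)

lemma hnorm_diff_le_hdist:
  assumes "v \<in> hcarrier H" "w \<in> hcarrier H"
  shows "\<bar>hnorm H v - hnorm H w\<bar> \<le> hdist H v w"
  using hdist_triangle[of v w "hzero H"] hdist_triangle[of w v "hzero H"] assms
  by (simp add: hnorm_hdist zero_closed hdist_commute[of w v])

lemma minus_add_minus:
  assumes "v \<in> hcarrier H" "v' \<in> hcarrier H" "w \<in> hcarrier H" "w' \<in> hcarrier H"
  shows "minus_on (hadd H v v') (hadd H w w') = hadd H (minus_on v w) (minus_on v' w')"
proof -
  let ?w = "hscale H (-1) w" and ?w' = "hscale H (-1) w'"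
  have c: "?w \<in> hcarrier H" "?w' \<in> hcarrier H" using assms by (simp_all add: scale_closed)
  have "hadd H (hadd H v v') (hadd H ?w ?w') = hadd H v (hadd H (hadd H v' ?w) ?w')"
    using assms c by (simp add: add_assoc add_closed)
  also have "hadd H v' ?w = hadd H ?w v'" using assms c by (simp add: add_commute)
  also have "hadd H v (hadd H (hadd H ?w v') ?w') = hadd H (hadd H v ?w) (hadd H v' ?w')"
    using assms c by (simp add: add_assoc add_closed)
  finally show ?thesis using assms by (simp add: scale_add_right)
qed

lemma hdist_add_le:
  assumes "v \<in> hcarrier H" "v' \<in> hcarrier H" "w \<in> hcarrier H" "w' \<in> hcarrier H"
  shows "hdist H (hadd H v v') (hadd H w w') \<le> hdist H v w + hdist H v' w'"
  using assms hnorm_triangle[of "minus_on v w" "minus_on v' w'"]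
  by (simp add: hdist_in add_closed minus_closed minus_add_minus)

lemma hdist_scale:
  assumes "v \<in> hcarrier H" "w \<in> hcarrier H"
  shows "hdist H (hscale H c v) (hscale H c w) = cmod c * hdist H v w"
proof -
  have "minus_on (hscale H c v) (hscale H c w) = hscale H c (minus_on v w)"
    using assms by (simp add: scale_add_right scale_closed scale_scale)
  then show ?thesis using assms by (simp add: hdist_in scale_closed hnorm_scale minus_closed)
qed

lemma hinner_minus:
  assumes "u \<in> hcarrier H" "v \<in> hcarrier H" "w \<in> hcarrier H"
  shows "hinner H u (minus_on v w) = hinner H u v - hinner H u w"
    and "hinner H (minus_on v w) u = hinner H v u - hinner H w u"
  using assms by (simp_all add: hinner_add hinner_add_left hinner_scale hinner_scale_left scale_closed)

lemma hinner_zero_left: "v \<in> hcarrier H \<Longrightarrow> hinner H (hzero H) v = 0"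
  using hinner_cnj[of v "hzero H"] by (simp add: hinner_zero zero_closed)

lemma scale_zero: "hscale H c (hzero H) = hzero H"
  using scale_scale[of "hzero H" c 0] scale_0[of "hzero H"] by (simp add: zero_closed)

text \<open>Polarization: norms determine the inner product. The sign in \<open>im\<close> arises
  because \<i> leaves the second variable as a factor, and the real part of \<i> times a number is
  minus its imaginary part.\<close>

lemma hinner_eqI:
  assumes v: "v \<in> hcarrier H" and w: "w \<in> hcarrier H"
    and re: "2 * Re z = (hnorm H (hadd H v w))\<^sup>2 - (hnorm H v)\<^sup>2 - (hnorm H w)\<^sup>2"
    and im: "- 2 * Im z = (hnorm H (hadd H v (hscale H \<i> w)))\<^sup>2 - (hnorm H v)\<^sup>2 - (hnorm H w)\<^sup>2"
  shows "hinner H v w = z"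
  using re im hnorm_add_sq[OF v w] hnorm_add_sq[OF v scale_closed[OF w], of \<i>]
  by (simp add: complex_eq_iff hinner_scale hnorm_scale v w)

lemma hcauchy_convergent:
  assumes f: "\<And>n. f n \<in> hcarrier H"
    and "\<And>\<epsilon>. 0 < \<epsilon> \<Longrightarrow> \<exists>N. \<forall>m\<ge>N. \<forall>n\<ge>N. hdist H (f m) (f n) < \<epsilon>"
  obtains l where "l \<in> hcarrier H" "(\<lambda>n. hdist H (f n) l) \<longlonglongrightarrow> 0"
proof -
  have "hmetric.MCauchy f" using assms unfolding hmetric.MCauchy_def by auto
  then obtain l where l: "limitin hmetric.mtopology f l sequentially"
    using hcomplete unfolding hmetric.mcomplete_def by blast
  then have "l \<in> hcarrier H" unfolding hmetric.limit_metric_sequentially by blast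
  moreover have "(\<lambda>n. hdist H (f n) l) \<longlonglongrightarrow> 0"
  proof (rule LIMSEQ_I)
    fix r :: real assume "0 < r"
    then obtain N where "\<forall>n\<ge>N. f n \<in> hcarrier H \<and> hdist H (f n) l < r"
      using l unfolding hmetric.limit_metric_sequentially by blast
    then show "\<exists>N. \<forall>n\<ge>N. norm (hdist H (f n) l - 0) < r" by auto
  qed
  ultimately show ?thesis by (rule that)
qed

lemma ex_dense_sequence:
  obtains d :: "nat \<Rightarrow> 'h" where "\<And>n. d n \<in> hcarrier H"
    "\<And>v \<epsilon>. \<lbrakk>v \<in> hcarrier H; 0 < \<epsilon>\<rbrakk> \<Longrightarrow> \<exists>n. hdist H v (d n) < \<epsilon>"
proof -
  obtain C where C: "countable C" "C \<subseteq> hcarrier H" "htopology H closure_of C = hcarrier H"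
    using hseparable unfolding separable_space_def htopology_def by auto
  have "C \<noteq> {}" using C(3) zero_closed by auto
  then obtain d :: "nat \<Rightarrow> 'h" where d: "range d = C"
    using C(1) by (metis uncountable_def)
  have "\<exists>n. hdist H v (d n) < \<epsilon>" if "v \<in> hcarrier H" "0 < \<epsilon>" for v \<epsilon>
  proof -
    have "v \<in> hmetric.mtopology closure_of C" using C(3) that by (simp add: htopology_def)
    then have "\<exists>y\<in>C. hdist H v y < \<epsilon>"
      unfolding hmetric.metric_closure_of hmetric.in_mball mem_Collect_eq using that(2) by blast
    then show ?thesis using d by auto
  qed
  moreover have "d n \<in> hcarrier H" for n using d C(2) by auto
  ultimately show ?thesis using that by blast
qed

end

section \<open>Closed linear spans and extension of isometries\<close>

text \<open>Only the linear operations of the record enter, so the span also makes sense where no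
  Hilbert space is at hand: for pairs in \<open>hprod\<close>, giving linear relations, and for
  sections in \<open>section_space\<close>.\<close>

inductive_set hspan :: "'h hspace \<Rightarrow> 'h set \<Rightarrow> 'h set" for H S where
  hspan_zero: "hzero H \<in> hspan H S"
| hspan_base: "v \<in> S \<Longrightarrow> v \<in> hspan H S"
| hspan_add: "\<lbrakk>v \<in> hspan H S; w \<in> hspan H S\<rbrakk> \<Longrightarrow> hadd H v w \<in> hspan H S"
| hspan_scale: "v \<in> hspan H S \<Longrightarrow> hscale H c v \<in> hspan H S"

text \<open>Used for the two projections of a linear relation and for evaluation of sections at a
  point. Preservation of zero is a separate hypothesis since neither record need be a vector
  space.\<close>

lemma hspan_image:
  assumes zero: "T (hzero A) = hzero B"
    and add: "\<And>v w. \<lbrakk>v \<in> hspan A S; w \<in> hspan A S\<rbrakk> \<Longrightarrow> T (hadd A v w) = hadd B (T v) (T w)"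
    and scale: "\<And>c v. v \<in> hspan A S \<Longrightarrow> T (hscale A c v) = hscale B c (T v)"
  shows "T ` hspan A S = hspan B (T ` S)"
proof (intro equalityI subsetI)
  fix w assume "w \<in> T ` hspan A S"
  then obtain v where "v \<in> hspan A S" "w = T v" by blast
  then show "w \<in> hspan B (T ` S)"
    by (induction v arbitrary: w) (auto simp: zero add scale intro: hspan.intros)
next
  fix w assume "w \<in> hspan B (T ` S)"
  then show "w \<in> T ` hspan A S"
  proof induction
    case hspan_zero
    then show ?case by (metis hspan.hspan_zero image_eqI zero)
  next
    case (hspan_base v)
    then show ?case by (auto intro: hspan.intros)
  next
    case (hspan_add v w)
    then obtain a b where "a \<in> hspan A S" "b \<in> hspan A S" "v = T a" "w = T b" by auto
    then show ?case by (intro image_eqI[of _ _ "hadd A a b"]) (auto simp: add intro: hspan.intros)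
  next
    case (hspan_scale v c)
    then obtain a where "a \<in> hspan A S" "v = T a" by auto
    then show ?case by (intro image_eqI[of _ _ "hscale A c a"]) (auto simp: scale intro: hspan.intros)
  qed
qed

definition hclspan :: "'h hspace \<Rightarrow> 'h set \<Rightarrow> 'h set"
  where "hclspan H S = {v \<in> hcarrier H. \<forall>\<epsilon>>0. \<exists>w\<in>hspan H S. hdist H v w < \<epsilon>}"

definition htotal :: "'h hspace \<Rightarrow> 'h set \<Rightarrow> bool"
  where "htotal H S \<longleftrightarrow> S \<subseteq> hcarrier H \<and> hcarrier H \<subseteq> hclspan H S"

definition hlinear :: "'h hspace \<Rightarrow> 'k hspace \<Rightarrow> ('h \<Rightarrow> 'k) \<Rightarrow> bool"
  where "hlinear H K T \<longleftrightarrow> T ` hcarrier H \<subseteq> hcarrier K \<and>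
    (\<forall>v\<in>hcarrier H. \<forall>w\<in>hcarrier H. T (hadd H v w) = hadd K (T v) (T w)) \<and>
    (\<forall>c. \<forall>v\<in>hcarrier H. T (hscale H c v) = hscale K c (T v))"

lemma hlinearD:
  assumes "hlinear H K T" "v \<in> hcarrier H"
  shows "T v \<in> hcarrier K" "w \<in> hcarrier H \<Longrightarrow> T (hadd H v w) = hadd K (T v) (T w)"
    "T (hscale H c v) = hscale K c (T v)"
  using assms by (auto simp: hlinear_def)

lemma hlinear_zero:
  assumes "hilbert_space H" "hilbert_space K" "hlinear H K T"
  shows "T (hzero H) = hzero K"
proof -
  interpret H: hilbert_space H by fact
  interpret K: hilbert_space K by fact
  show ?thesis
    using hlinearD(1)[OF assms(3) H.zero_closed] hlinearD(3)[OF assms(3) H.zero_closed, of 0]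
      H.scale_0[OF H.zero_closed] K.scale_0 by metis
qed

lemma linear_isometry_onto_hlinear: "linear_isometry_onto H K T \<Longrightarrow> hlinear H K T"
  by (auto simp: linear_isometry_onto_def hlinear_def)

lemma htotalD:
  assumes "htotal H S" "v \<in> hcarrier H" "0 < \<epsilon>"
  obtains w where "w \<in> hspan H S" "hdist H v w < \<epsilon>"
  using assms unfolding htotal_def hclspan_def by blast

text \<open>The summand 1 keeps the denominator positive when \<open>c = 0\<close>, which saves a
  case distinction in each scaling argument.\<close>

lemma mult_less_of_less_divide:
  fixes x c :: real
  assumes "x < \<epsilon> / (c + 1)" "0 \<le> x" "0 \<le> c"
  shows "c * x < \<epsilon>"
proof -
  have "c * x \<le> x * (c + 1)" using assms by (simp add: algebra_simps)
  also have "\<dots> < \<epsilon>" using assms by (metis add_nonneg_pos pos_less_divide_eq zero_less_one)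
  finally show ?thesis .
qed

context hilbert_space
begin

lemma hspan_subset:
  assumes "S \<subseteq> hcarrier H"
  shows "hspan H S \<subseteq> hcarrier H"
proof
  fix v assume "v \<in> hspan H S"
  then show "v \<in> hcarrier H"
    by induction (use assms in \<open>auto intro: zero_closed add_closed scale_closed\<close>)
qed

lemma hspan_subset_hclspan:
  assumes "S \<subseteq> hcarrier H"
  shows "hspan H S \<subseteq> hclspan H S"
proof
  fix v assume v: "v \<in> hspan H S"
  then have "v \<in> hcarrier H" using hspan_subset[OF assms] by blast
  then show "v \<in> hclspan H S" unfolding hclspan_def using v by force
qed

lemma hclspan_add:
  assumes S: "S \<subseteq> hcarrier H" and v: "v \<in> hclspan H S" and w: "w \<in> hclspan H S"
  shows "hadd H v w \<in> hclspan H S"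
  unfolding hclspan_def
proof (intro CollectI conjI allI impI)
  have vw: "v \<in> hcarrier H" "w \<in> hcarrier H" using v w by (auto simp: hclspan_def)
  then show "hadd H v w \<in> hcarrier H" by (rule add_closed)
  fix \<epsilon> :: real assume "0 < \<epsilon>"
  then have "0 < \<epsilon> / 2" by simp
  then obtain a b where ab: "a \<in> hspan H S" "b \<in> hspan H S" "hdist H v a < \<epsilon> / 2" "hdist H w b < \<epsilon> / 2"
    using v w unfolding hclspan_def by blast
  then have "a \<in> hcarrier H" "b \<in> hcarrier H" using hspan_subset[OF S] by auto
  from hdist_add_le[OF vw this] ab show "\<exists>u\<in>hspan H S. hdist H (hadd H v w) u < \<epsilon>"
    by (intro bexI[OF _ hspan.hspan_add[OF ab(1,2)]]) simp
qed

lemma hclspan_scale: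
  assumes S: "S \<subseteq> hcarrier H" and v: "v \<in> hclspan H S"
  shows "hscale H c v \<in> hclspan H S"
  unfolding hclspan_def
proof (intro CollectI conjI allI impI)
  have vH: "v \<in> hcarrier H" using v by (auto simp: hclspan_def)
  then show "hscale H c v \<in> hcarrier H" by (rule scale_closed)
  fix \<epsilon> :: real assume "0 < \<epsilon>"
  then have "0 < \<epsilon> / (cmod c + 1)" by (simp add: add_nonneg_pos)
  then obtain a where a: "a \<in> hspan H S" "hdist H v a < \<epsilon> / (cmod c + 1)"
    using v unfolding hclspan_def by blast
  then have aH: "a \<in> hcarrier H" using hspan_subset[OF S] by auto
  show "\<exists>u\<in>hspan H S. hdist H (hscale H c v) u < \<epsilon>"
    using hdist_scale[OF vH aH, of c] mult_less_of_less_divide[OF a(2)]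
    by (intro bexI[OF _ hspan.hspan_scale[OF a(1), of c]]) simp
qed

end

text \<open>With \<open>T\<close> the identity this says that \<^const>\<open>hclspan\<close> is a closure operator.\<close>

lemma hclspan_map:
  assumes "hilbert_space H" "hilbert_space K" and T: "hlinear H K T"
    and bd: "\<And>v. v \<in> hcarrier H \<Longrightarrow> hnorm K (T v) \<le> C * hnorm H v"
    and S: "S \<subseteq> hcarrier H" "S' \<subseteq> hcarrier K" "T ` S \<subseteq> hclspan K S'"
    and v: "v \<in> hclspan H S"
  shows "T v \<in> hclspan K S'"
proof -
  interpret H: hilbert_space H by fact
  interpret K: hilbert_space K by fact
  have span: "w \<in> hcarrier H \<and> T w \<in> hclspan K S'" if "w \<in> hspan H S" for w
    using that
  proof induction
    case hspan_zero
    show ?case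
      using K.hspan_subset_hclspan[OF S(2)] hspan.hspan_zero[of K S'] hlinear_zero[OF assms(1,2) T] by (auto intro: H.zero_closed)
  next
    case (hspan_base w)
    then show ?case using S by auto
  next
    case (hspan_add a b)
    then show ?case
      by (auto simp: hlinearD[OF T] intro: H.add_closed K.hclspan_add[OF S(2)])
  next
    case (hspan_scale a c)
    then show ?case
      by (auto simp: hlinearD[OF T] intro: H.scale_closed K.hclspan_scale[OF S(2)])
  qed
  have vH: "v \<in> hcarrier H" using v by (simp add: hclspan_def)
  show ?thesis unfolding hclspan_def
  proof (intro CollectI conjI allI impI)
    show "T v \<in> hcarrier K" by (rule hlinearD[OF T vH])
    fix \<epsilon> :: real assume "0 < \<epsilon>"
    \<comment> \<open>Half of \<epsilon> pays for moving from \<open>v\<close> to \<open>w\<close>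
      under the Lipschitz map \<open>T\<close>, half for approximating \<open>T w\<close> in the
      target span. The bound \<open>C\<close> may have any sign, hence its absolute value.\<close>
    define \<delta> where "\<delta> = (\<epsilon> / 2) / (\<bar>C\<bar> + 1)"
    have "0 < \<delta>" using \<open>0 < \<epsilon>\<close> by (simp add: \<delta>_def add_nonneg_pos)
    then obtain w where w: "w \<in> hspan H S" "hdist H v w < \<delta>"
      using v unfolding hclspan_def by blast
    then have wH: "w \<in> hcarrier H" and Tw: "T w \<in> hclspan K S'" using span by auto
    have "0 < \<epsilon> / 2" using \<open>0 < \<epsilon>\<close> by simp
    then obtain y where y: "y \<in> hspan K S'" "hdist K (T w) y < \<epsilon> / 2"
      using Tw unfolding hclspan_def by blast
    have yK: "y \<in> hcarrier K" using y K.hspan_subset[OF S(2)] by auto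
    have TK: "T v \<in> hcarrier K" "T w \<in> hcarrier K" using hlinearD[OF T] vH wH by auto
    have "hdist K (T v) (T w) = hnorm K (T (H.minus_on v w))"
      using vH wH TK by (simp add: K.hdist_in hlinearD[OF T] H.scale_closed)
    also have "\<dots> \<le> C * hdist H v w"
      using bd[of "H.minus_on v w"] vH wH by (simp add: H.hdist_in H.minus_closed)
    also have "\<dots> \<le> \<bar>C\<bar> * hdist H v w"
      by (intro mult_right_mono) auto
    also have "\<dots> < \<epsilon> / 2" using w(2) unfolding \<delta>_def by (rule mult_less_of_less_divide) auto
    finally have "hdist K (T v) y < \<epsilon>" using y K.hdist_triangle[OF TK yK] by simp
    then show "\<exists>y\<in>hspan K S'. hdist K (T v) y < \<epsilon>" using y by blast
  qed
qed

context hilbert_space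
begin

lemma hclspan_hclspan:
  assumes "S \<subseteq> hclspan H S'" "S' \<subseteq> hcarrier H"
  shows "hclspan H S \<subseteq> hclspan H S'"
proof
  fix v assume v: "v \<in> hclspan H S"
  have hs: "hilbert_space H" by unfold_locales
  have "id v \<in> hclspan H S'"
  proof (rule hclspan_map[OF hs hs _ _ _ assms(2) _ v])
    show "hnorm H (id v) \<le> 1 * hnorm H v" if "v \<in> hcarrier H" for v by simp
  qed (use assms in \<open>auto simp: hlinear_def hclspan_def\<close>)
  then show "v \<in> hclspan H S'" by simp
qed

lemma htotal_trans:
  assumes "htotal H S" "S \<subseteq> hclspan H S'" "S' \<subseteq> hcarrier H"
  shows "htotal H S'"
  using assms hclspan_hclspan[OF assms(2,3)] by (auto simp: htotal_def)

end

text \<open>Bundle isometries are specified by norms alone; polarization upgrades this to inner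
  products.\<close>

lemma linear_isometry_onto_hinner:
  assumes "hilbert_space H" "hilbert_space K" "linear_isometry_onto H K T"
    and v: "v \<in> hcarrier H" and w: "w \<in> hcarrier H"
  shows "hinner K (T v) (T w) = hinner H v w"
proof -
  interpret H: hilbert_space H by fact
  interpret K: hilbert_space K by fact
  note T = hlinearD[OF linear_isometry_onto_hlinear[OF assms(3)]]
  have n: "hnorm K (T a) = hnorm H a" if "a \<in> hcarrier H" for a
    using assms(3) that by (simp add: linear_isometry_onto_def)
  have "hinner H v w = hinner K (T v) (T w)"
  proof (rule H.hinner_eqI[OF v w])
    show "2 * Re (hinner K (T v) (T w)) = (hnorm H (hadd H v w))\<^sup>2 - (hnorm H v)\<^sup>2 - (hnorm H w)\<^sup>2"
      using K.hnorm_add_sq[of "T v" "T w"] v w n[of "hadd H v w"]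
      by (simp add: n T H.add_closed)
    show "- 2 * Im (hinner K (T v) (T w)) =
      (hnorm H (hadd H v (hscale H \<i> w)))\<^sup>2 - (hnorm H v)\<^sup>2 - (hnorm H w)\<^sup>2"
      using K.hnorm_add_sq[of "T v" "hscale K \<i> (T w)"] v w n[of "hadd H v (hscale H \<i> w)"]
      by (simp add: n T H.add_closed H.scale_closed K.hinner_scale K.hnorm_scale K.scale_closed)
  qed
  then show ?thesis by simp
qed

lemma linear_isometry_onto_hdist:
  assumes "hilbert_space H" "hilbert_space K" "linear_isometry_onto H K T"
    and "v \<in> hcarrier H" "w \<in> hcarrier H"
  shows "hdist K (T v) (T w) = hdist H v w"
proof -
  interpret H: hilbert_space H by fact
  interpret K: hilbert_space K by fact
  note L = hlinearD[OF linear_isometry_onto_hlinear[OF assms(3)]]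
  have "K.minus_on (T v) (T w) = T (H.minus_on v w)"
    using assms(4,5) by (simp add: L H.scale_closed)
  then show ?thesis
    using assms(3-) H.minus_closed[OF assms(4,5)]
    by (simp add: K.hdist_in H.hdist_in L linear_isometry_onto_def)
qed

lemma linear_isometry_onto_compose:
  assumes "linear_isometry_onto H K T" "linear_isometry_onto K M T'"
  shows "linear_isometry_onto H M (\<lambda>v. T' (T v))"
proof -
  have "T v \<in> hcarrier K" if "v \<in> hcarrier H" for v
    using assms(1) that by (auto simp: linear_isometry_onto_def)
  moreover have "(\<lambda>v. T' (T v)) ` hcarrier H = hcarrier M"
    using assms unfolding linear_isometry_onto_def by (metis image_image)
  ultimately show ?thesis
    using assms by (simp add: linear_isometry_onto_def)
qed

text \<open>Linearity extends the agreement from \<open>S\<close> to its span, and isometry extends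
  it to limits. This later gives multiplicativity of the isometries on tensor products from the case
  of elementary tensors.\<close>

lemma linear_isometry_onto_eqI:
  assumes "hilbert_space H" "hilbert_space K"
    and T: "linear_isometry_onto H K T" and T': "linear_isometry_onto H K T'"
    and S: "htotal H S" and eq: "\<And>v. v \<in> S \<Longrightarrow> T v = T' v" and v: "v \<in> hcarrier H"
  shows "T v = T' v"
proof -
  interpret H: hilbert_space H by fact
  interpret K: hilbert_space K by fact
  note L = hlinearD[OF linear_isometry_onto_hlinear[OF T]]
  note L' = hlinearD[OF linear_isometry_onto_hlinear[OF T']]
  have SH: "S \<subseteq> hcarrier H" using S by (simp add: htotal_def)
  have span: "w \<in> hcarrier H \<and> T w = T' w" if "w \<in> hspan H S" for w
    using that
  proof induction
    case hspan_zero
    show ?case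
      using hlinear_zero[OF assms(1,2) linear_isometry_onto_hlinear[OF T]]
        hlinear_zero[OF assms(1,2) linear_isometry_onto_hlinear[OF T']] by (simp add: H.zero_closed)
  qed (use SH eq in \<open>auto simp: L L' H.add_closed H.scale_closed\<close>)
  note d = linear_isometry_onto_hdist[OF assms(1,2) T] linear_isometry_onto_hdist[OF assms(1,2) T']
  have "hdist K (T v) (T' v) \<le> \<epsilon>" if "\<epsilon> > 0" for \<epsilon>
  proof -
    have "0 < \<epsilon> / 2" using that by simp
    from htotalD[OF S v this] obtain w where w: "w \<in> hspan H S" "hdist H v w < \<epsilon> / 2" .
    then have wH: "w \<in> hcarrier H" "T w = T' w" using span by auto
    have "hdist K (T v) (T' v) \<le> hdist K (T v) (T w) + hdist K (T w) (T' v)"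
      using v wH by (intro K.hdist_triangle) (auto intro: L L')
    also have "\<dots> = hdist H v w + hdist H w v" 
      using d(1)[OF v wH(1)] d(2)[OF wH(1) v] wH(2) by simp
    finally show ?thesis using w(2) H.hdist_commute[of w v] by simp
  qed
  then have "hdist K (T v) (T' v) = 0"
    by (metis K.hmetric.nonneg antisym_conv field_le_epsilon add_0)
  then show ?thesis using v L(1) L'(1) by simp
qed

section \<open>Isometric linear relations and the extension of isometries\<close>

definition hprod :: "'h hspace \<Rightarrow> 'k hspace \<Rightarrow> ('h \<times> 'k) hspace"
  where "hprod H K = \<lparr>hcarrier = hcarrier H \<times> hcarrier K, hzero = (hzero H, hzero K),
    hadd = (\<lambda>p q. (hadd H (fst p) (fst q), hadd K (snd p) (snd q))),
    hscale = (\<lambda>c p. (hscale H c (fst p), hscale K c (snd p))),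
    hinner = (\<lambda>p q. hinner H (fst p) (fst q) + hinner K (snd p) (snd q))\<rparr>"

lemma hprod_simps:
  "hzero (hprod H K) = (hzero H, hzero K)"
  "hadd (hprod H K) p q = (hadd H (fst p) (fst q), hadd K (snd p) (snd q))"
  "hscale (hprod H K) c p = (hscale H c (fst p), hscale K c (snd p))"
  by (simp_all add: hprod_def)

text \<open>Relations replace functions on linear combinations because equality of norms already
  makes a linear relation single-valued: a pair with first entry 0 has second entry 0. No separate
  well-definedness argument is then required.\<close>

locale isometric_relation = H: hilbert_space H + K: hilbert_space K
  for H :: "'h hspace" and K :: "'k hspace" +
  fixes \<Gamma> :: "('h \<times> 'k) set"
  assumes rel_sub: "\<Gamma> \<subseteq> hcarrier H \<times> hcarrier K"
    and rel_add: "\<lbrakk>(v, w) \<in> \<Gamma>; (v', w') \<in> \<Gamma>\<rbrakk> \<Longrightarrow> (hadd H v v', hadd K w w') \<in> \<Gamma>"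
    and rel_scale: "(v, w) \<in> \<Gamma> \<Longrightarrow> (hscale H c v, hscale K c w) \<in> \<Gamma>"
    and rel_norm: "(v, w) \<in> \<Gamma> \<Longrightarrow> hnorm H v = hnorm K w"
begin

definition rel_closure :: "'h \<Rightarrow> 'k \<Rightarrow> bool"
  where "rel_closure v w \<longleftrightarrow> v \<in> hcarrier H \<and> w \<in> hcarrier K \<and>
    (\<forall>\<epsilon>>0. \<exists>(a, b)\<in>\<Gamma>. hdist H v a < \<epsilon> \<and> hdist K w b < \<epsilon>)"

lemma rel_closureE:
  assumes "rel_closure v w" "0 < \<epsilon>"
  obtains a b where "(a, b) \<in> \<Gamma>" "a \<in> hcarrier H" "b \<in> hcarrier K" "hdist H v a < \<epsilon>" "hdist K w b < \<epsilon>"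
  using assms rel_sub unfolding rel_closure_def by fastforce

lemma rel_closure_base: "(v, w) \<in> \<Gamma> \<Longrightarrow> rel_closure v w"
  unfolding rel_closure_def using rel_sub by force

lemma rel_closure_add:
  assumes "rel_closure v w" "rel_closure v' w'"
  shows "rel_closure (hadd H v v') (hadd K w w')"
  unfolding rel_closure_def
proof (intro conjI allI impI)
  have *: "v \<in> hcarrier H" "v' \<in> hcarrier H" "w \<in> hcarrier K" "w' \<in> hcarrier K"
    using assms by (auto simp: rel_closure_def)
  then show "hadd H v v' \<in> hcarrier H" "hadd K w w' \<in> hcarrier K"
    by (auto intro: H.add_closed K.add_closed)
  fix \<epsilon> :: real assume "0 < \<epsilon>"
  then have e: "0 < \<epsilon> / 2" by simp
  obtain a b where ab: "(a, b) \<in> \<Gamma>" "a \<in> hcarrier H" "b \<in> hcarrier K" "hdist H v a < \<epsilon> / 2" "hdist K w b < \<epsilon> / 2"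
    using rel_closureE[OF assms(1) e] by metis
  obtain a' b' where ab': "(a', b') \<in> \<Gamma>" "a' \<in> hcarrier H" "b' \<in> hcarrier K" "hdist H v' a' < \<epsilon> / 2" "hdist K w' b' < \<epsilon> / 2"
    using rel_closureE[OF assms(2) e] by metis
  show "\<exists>(a, b)\<in>\<Gamma>. hdist H (hadd H v v') a < \<epsilon> \<and> hdist K (hadd K w w') b < \<epsilon>"
    using H.hdist_add_le[OF *(1,2) ab(2) ab'(2)] K.hdist_add_le[OF *(3,4) ab(3) ab'(3)] ab(4,5) ab'(4,5)
    by (intro bexI[OF _ rel_add[OF ab(1) ab'(1)]]) auto
qed

lemma rel_closure_scale:
  assumes "rel_closure v w"
  shows "rel_closure (hscale H c v) (hscale K c w)"
  unfolding rel_closure_def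
proof (intro conjI allI impI)
  have *: "v \<in> hcarrier H" "w \<in> hcarrier K"
    using assms by (auto simp: rel_closure_def)
  then show "hscale H c v \<in> hcarrier H" "hscale K c w \<in> hcarrier K"
    by (auto intro: H.scale_closed K.scale_closed)
  fix \<epsilon> :: real assume \<epsilon>: "0 < \<epsilon>"
  define \<delta> where "\<delta> = \<epsilon> / (cmod c + 1)"
  have "0 < \<delta>" using \<epsilon> by (simp add: \<delta>_def add_nonneg_pos)
  then obtain a b where ab: "(a, b) \<in> \<Gamma>" "a \<in> hcarrier H" "b \<in> hcarrier K" "hdist H v a < \<delta>" "hdist K w b < \<delta>"
    using rel_closureE[OF assms] by metis
  have "cmod c * x < \<epsilon>" if "x < \<delta>" "0 \<le> x" for x
    using that unfolding \<delta>_def by (intro mult_less_of_less_divide) auto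
  then show "\<exists>(a, b)\<in>\<Gamma>. hdist H (hscale H c v) a < \<epsilon> \<and> hdist K (hscale K c w) b < \<epsilon>"
    using H.hdist_scale[OF *(1) ab(2), of c] K.hdist_scale[OF *(2) ab(3), of c] ab(4,5)
    by (intro bexI[OF _ rel_scale[OF ab(1), of c]]) auto
qed

lemma rel_closure_norm:
  assumes "rel_closure v w"
  shows "hnorm H v = hnorm K w"
proof -
  have *: "v \<in> hcarrier H" "w \<in> hcarrier K"
    using assms by (auto simp: rel_closure_def)
  have "\<bar>hnorm H v - hnorm K w\<bar> \<le> 0 + \<epsilon>" if "\<epsilon> > 0" for \<epsilon>
  proof -
    have e: "0 < \<epsilon> / 2" using that by simp
    obtain a b where "(a, b) \<in> \<Gamma>" "a \<in> hcarrier H" "b \<in> hcarrier K" "hdist H v a < \<epsilon> / 2" "hdist K w b < \<epsilon> / 2"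
      using rel_closureE[OF assms e] by metis
    then show ?thesis
      using H.hnorm_diff_le_hdist[OF *(1), of a] K.hnorm_diff_le_hdist[OF *(2), of b] rel_norm[of a b]
      by linarith
  qed
  then have "\<bar>hnorm H v - hnorm K w\<bar> \<le> 0" by (rule field_le_epsilon)
  then show ?thesis by simp
qed

text \<open>The difference of the two pairs has first entry 0, hence a second entry of norm
  0.\<close>

lemma rel_closure_unique:
  assumes "rel_closure v w" "rel_closure v w'"
  shows "w = w'"
proof -
  have "rel_closure (H.minus_on v v) (K.minus_on w w')"
    using assms rel_closure_add rel_closure_scale by blast
  then have "hnorm K (K.minus_on w w') = 0"
    using rel_closure_norm[of "H.minus_on v v"] assms H.minus_eq_zero_iff[of v v] H.hnorm_zero
    by (simp add: rel_closure_def)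
  then show ?thesis
    using assms by (simp add: rel_closure_def K.hnorm_eq_0_iff K.minus_closed K.minus_eq_zero_iff)
qed

text \<open>Choose pairs whose first entries tend to \<open>v\<close>. Equality of norms, applied to
  differences of pairs, makes the second entries Cauchy, and completeness of \<open>K\<close>
  supplies the partner of \<open>v\<close>.\<close>

lemma rel_closure_total:
  assumes dense: "\<And>\<epsilon>. 0 < \<epsilon> \<Longrightarrow> \<exists>(a, b)\<in>\<Gamma>. hdist H v a < \<epsilon>" and v: "v \<in> hcarrier H"
  shows "\<exists>w. rel_closure v w"
proof -
  have "\<exists>p. p \<in> \<Gamma> \<and> hdist H v (fst p) < inverse (real (Suc n))" for n
    using dense[of "inverse (real (Suc n))"] by fastforce
  then obtain p where p: "\<And>n. p n \<in> \<Gamma>" "\<And>n. hdist H v (fst (p n)) < inverse (real (Suc n))" by metis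
  have pc: "fst (p n) \<in> hcarrier H" "snd (p n) \<in> hcarrier K" for n using p(1)[of n] rel_sub by auto
  have pp: "hdist K (snd (p m)) (snd (p n)) = hdist H (fst (p m)) (fst (p n))" for m n
    using rel_norm[OF rel_add[OF _ rel_scale], of "fst (p m)" "snd (p m)" "fst (p n)" "snd (p n)" "-1"] p(1) pc
    by (simp add: H.hdist_in K.hdist_in)
  have small: "\<exists>N. \<forall>n\<ge>N. inverse (real (Suc n)) < \<epsilon>" if "\<epsilon> > 0" for \<epsilon>
    using order_tendstoD(2)[OF LIMSEQ_inverse_real_of_nat that] by (simp add: eventually_sequentially)
  obtain w where w: "w \<in> hcarrier K" "(\<lambda>n. hdist K (snd (p n)) w) \<longlonglongrightarrow> 0"
  proof (rule K.hcauchy_convergent[of "\<lambda>n. snd (p n)"])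
    show "snd (p n) \<in> hcarrier K" for n by (rule pc)
    fix \<epsilon> :: real assume "0 < \<epsilon>"
    then obtain N where N: "\<forall>n\<ge>N. inverse (real (Suc n)) < \<epsilon> / 2" using small[OF half_gt_zero] by blast
    have "hdist K (snd (p m)) (snd (p n)) < \<epsilon>" if "m \<ge> N" "n \<ge> N" for m n
    proof -
      have "inverse (real (Suc m)) < \<epsilon> / 2" "inverse (real (Suc n)) < \<epsilon> / 2" using N that by blast+
      then show ?thesis
        using H.hdist_triangle[OF pc(1) v pc(1), of m n] p(2)[of m] p(2)[of n]
          H.hdist_commute[of "fst (p m)" v] unfolding pp by linarith
    qed
    then show "\<exists>N. \<forall>m\<ge>N. \<forall>n\<ge>N. hdist K (snd (p m)) (snd (p n)) < \<epsilon>" by blast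
  qed auto
  have "\<exists>(a, b)\<in>\<Gamma>. hdist H v a < \<epsilon> \<and> hdist K w b < \<epsilon>" if "\<epsilon> > 0" for \<epsilon>
  proof -
    obtain N where N: "\<forall>n\<ge>N. inverse (real (Suc n)) < \<epsilon>" using small \<open>\<epsilon> > 0\<close> by blast
    obtain M where M: "\<forall>n\<ge>M. hdist K (snd (p n)) w < \<epsilon>"
      using order_tendstoD(2)[OF w(2) \<open>\<epsilon> > 0\<close>] by (auto simp: eventually_sequentially)
    let ?n = "max M N"
    have "inverse (real (Suc ?n)) < \<epsilon>" using N by (meson max.cobounded2)
    with p(2)[of ?n] have "hdist H v (fst (p ?n)) < \<epsilon>" by (rule less_trans)
    moreover have "hdist K w (snd (p ?n)) < \<epsilon>" using M K.hdist_commute[of w] by simp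
    ultimately show ?thesis using p(1)[of ?n] by force
  qed
  then show ?thesis using v w(1) unfolding rel_closure_def by blast
qed

end

text \<open>The extension is the closure of the linear relation spanned by \<open>P\<close>. The relation, like the
  hypotheses, is symmetric in the two spaces, so totality of the closure on one side gives
  surjectivity on the other.\<close>

lemma isometric_extension:
  assumes HK: "hilbert_space H" "hilbert_space K"
    and P: "\<And>a b a' b'. \<lbrakk>(a, b) \<in> P; (a', b') \<in> P\<rbrakk> \<Longrightarrow> hinner H a a' = hinner K b b'"
    and tot: "htotal H (fst ` P)" "htotal K (snd ` P)"
  shows "\<exists>T. linear_isometry_onto H K T \<and> (\<forall>(a, b)\<in>P. T a = b)"
proof -
  interpret H: hilbert_space H by fact
  interpret K: hilbert_space K by fact
  define \<Gamma> where "\<Gamma> = hspan (hprod H K) P"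
  have Pc: "fst ` P \<subseteq> hcarrier H" "snd ` P \<subseteq> hcarrier K" using tot by (auto simp: htotal_def)
  have fst: "fst ` \<Gamma> = hspan H (fst ` P)" unfolding \<Gamma>_def by (rule hspan_image) (auto simp: hprod_simps)
  have snd: "snd ` \<Gamma> = hspan K (snd ` P)" unfolding \<Gamma>_def by (rule hspan_image) (auto simp: hprod_simps)
  have c: "fst p \<in> hcarrier H" "snd p \<in> hcarrier K" if "p \<in> \<Gamma>" for p
    using fst snd that H.hspan_subset[OF Pc(1)] K.hspan_subset[OF Pc(2)] by auto
  \<comment> \<open>Equality of inner products spreads from \<open>P\<close> to its span one
    variable at a time: here in the second, in \<open>i2\<close> in the first.\<close>
  have i1: "hinner H (fst p) (fst q) = hinner K (snd p) (snd q)" if "p \<in> P" "q \<in> \<Gamma>" for p q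
    using that(2) unfolding \<Gamma>_def
  proof induction
    case hspan_zero
    then show ?case using that Pc by (simp add: hprod_simps H.hinner_zero K.hinner_zero image_subset_iff)
  next
    case (hspan_base v)
    then show ?case using that P[of "fst p" "snd p" "fst v" "snd v"] by simp
  next
    case (hspan_add v w)
    then have "v \<in> \<Gamma>" "w \<in> \<Gamma>" by (simp_all add: \<Gamma>_def)
    then show ?case using hspan_add that Pc
      by (simp add: hprod_simps H.hinner_add K.hinner_add c image_subset_iff)
  next
    case (hspan_scale v)
    then have "v \<in> \<Gamma>" by (simp_all add: \<Gamma>_def)
    then show ?case using hspan_scale that Pc
      by (simp add: hprod_simps H.hinner_scale K.hinner_scale c image_subset_iff)
  qed
  have i2: "hinner H (fst p) (fst q) = hinner K (snd p) (snd q)" if "p \<in> \<Gamma>" "q \<in> \<Gamma>" for p q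
    using that(1) unfolding \<Gamma>_def
  proof induction
    case hspan_zero
    then show ?case using that by (auto simp: hprod_simps H.hinner_zero_left K.hinner_zero_left c)
  next
    case (hspan_base v)
    then show ?case using that i1 by simp
  next
    case (hspan_add v w)
    then have "v \<in> \<Gamma>" "w \<in> \<Gamma>" by (simp_all add: \<Gamma>_def)
    then show ?case using hspan_add that
      by (simp add: hprod_simps H.hinner_add_left K.hinner_add_left c)
  next
    case (hspan_scale v)
    then have "v \<in> \<Gamma>" by (simp_all add: \<Gamma>_def)
    then show ?case using hspan_scale that
      by (simp add: hprod_simps H.hinner_scale_left K.hinner_scale_left c)
  qed
  have gadd: "(hadd H v v', hadd K w w') \<in> \<Gamma>" if "(v, w) \<in> \<Gamma>" "(v', w') \<in> \<Gamma>" for v w v' w'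
    using hspan.hspan_add[of "(v, w)" "hprod H K" P "(v', w')"] that by (simp add: \<Gamma>_def hprod_simps)
  have gscale: "(hscale H c v, hscale K c w) \<in> \<Gamma>" if "(v, w) \<in> \<Gamma>" for v w c
    using hspan.hspan_scale[of "(v, w)" "hprod H K" P] that by (simp add: \<Gamma>_def hprod_simps)
  have gnorm: "hnorm H v = hnorm K w" if "(v, w) \<in> \<Gamma>" for v w
    using i2[OF that that] by (simp add: hnorm_def)
  have gsub: "\<Gamma> \<subseteq> hcarrier H \<times> hcarrier K" using c by auto
  interpret A: isometric_relation H K \<Gamma>
    by unfold_locales (use gsub gadd gscale gnorm in auto)
  interpret B: isometric_relation K H "\<Gamma>\<inverse>"
    by unfold_locales (use gsub gadd gscale gnorm in auto)
  have AB: "B.rel_closure w v \<longleftrightarrow> A.rel_closure v w" for v w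
    \<comment> \<open>The closure of the converse relation is the converse of the closure, so
      totality for \<open>B\<close> produces preimages for the extension.\<close>
    unfolding A.rel_closure_def B.rel_closure_def by fastforce
  have exA: "\<exists>w. A.rel_closure v w" if "v \<in> hcarrier H" for v
  proof (rule A.rel_closure_total[OF _ that])
    fix \<epsilon> :: real assume "0 < \<epsilon>"
    from htotalD[OF tot(1) that this] obtain a where "a \<in> fst ` \<Gamma>" "hdist H v a < \<epsilon>"
      unfolding fst .
    then show "\<exists>(a, b)\<in>\<Gamma>. hdist H v a < \<epsilon>" by force
  qed
  have exB: "\<exists>v. A.rel_closure v w" if "w \<in> hcarrier K" for w
    unfolding AB[symmetric]
  proof (rule B.rel_closure_total[OF _ that])
    fix \<epsilon> :: real assume "0 < \<epsilon>"
    from htotalD[OF tot(2) that this] obtain a where "a \<in> snd ` \<Gamma>" "hdist K w a < \<epsilon>"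
      unfolding snd .
    then show "\<exists>(a, b)\<in>\<Gamma>\<inverse>. hdist K w a < \<epsilon>" by force
  qed
  define T where "T v = (SOME w. A.rel_closure v w)" for v
  have T: "A.rel_closure v (T v)" if "v \<in> hcarrier H" for v
    unfolding T_def using exA[OF that] by (rule someI_ex)
  have Teq: "T v = w" if "A.rel_closure v w" for v w
    using A.rel_closure_unique[OF T that] that by (simp add: A.rel_closure_def)
  have "linear_isometry_onto H K T" unfolding linear_isometry_onto_def
  proof (intro conjI ballI allI)
    show "T ` hcarrier H = hcarrier K"
    proof (intro equalityI subsetI)
      show "w \<in> hcarrier K" if "w \<in> T ` hcarrier H" for w
        using that T by (auto simp: A.rel_closure_def)
      show "w \<in> T ` hcarrier H" if w: "w \<in> hcarrier K" for w
      proof -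
        obtain v where "A.rel_closure v w" using exB[OF w] by blast
        then show ?thesis using Teq[of v w] by (auto simp: A.rel_closure_def)
      qed
    qed
  next
    fix v w assume "v \<in> hcarrier H" "w \<in> hcarrier H"
    then show "T (hadd H v w) = hadd K (T v) (T w)" by (intro Teq A.rel_closure_add T)
  next
    fix c v assume "v \<in> hcarrier H"
    then show "T (hscale H c v) = hscale K c (T v)" by (intro Teq A.rel_closure_scale T)
  next
    fix v assume "v \<in> hcarrier H"
    then show "hnorm K (T v) = hnorm H v" using A.rel_closure_norm[OF T] by simp
  qed
  moreover have "\<forall>(a, b)\<in>P. T a = b"
    by (auto intro!: Teq A.rel_closure_base simp: \<Gamma>_def intro: hspan.hspan_base)
  ultimately show ?thesis by blast
qed

section \<open>Orthonormal bases\<close>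

definition hnormalize :: "'h hspace \<Rightarrow> 'h \<Rightarrow> 'h"
  where "hnormalize H v = hscale H (complex_of_real (1 / hnorm H v)) v"

text \<open>Gram-Schmidt in terms of residuals: \<open>gs_residual H d n\<close> is the projection onto the orthogonal
  complement of \<open>d 0, \<dots>, d (n - 1)\<close>. As \<open>1 / 0 = 0\<close>, redundant vectors of \<open>d\<close> contribute the basis
  vector 0.\<close>

primrec gs_residual :: "'h hspace \<Rightarrow> (nat \<Rightarrow> 'h) \<Rightarrow> nat \<Rightarrow> 'h \<Rightarrow> 'h" where
  "gs_residual H d 0 = (\<lambda>w. w)"
| "gs_residual H d (Suc n) = (\<lambda>w.
    let e = hnormalize H (gs_residual H d n (d n)); v = gs_residual H d n w
    in hadd H v (hscale H (-1) (hscale H (hinner H e v) e)))"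

definition gs_vector :: "'h hspace \<Rightarrow> (nat \<Rightarrow> 'h) \<Rightarrow> nat \<Rightarrow> 'h"
  where "gs_vector H d n = hnormalize H (gs_residual H d n (d n))"

context hilbert_space
begin

lemma hinner_hnorm: "v \<in> hcarrier H \<Longrightarrow> hinner H v v = complex_of_real ((hnorm H v)\<^sup>2)"
  by (simp add: complex_eq_iff hnorm_sq Im_hinner)

text \<open>The last claim, that a vector is its own projection onto its normalization, holds for 0
  as well; it is what makes Gram-Schmidt annihilate the vector just treated.\<close>

lemma hnormalize_cases:
  assumes v: "v \<in> hcarrier H"
  shows "hnormalize H v \<in> hcarrier H"
    and "v = hzero H \<Longrightarrow> hnormalize H v = hzero H"
    and "v \<noteq> hzero H \<Longrightarrow> hnorm H (hnormalize H v) = 1"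
    and "hscale H (hinner H (hnormalize H v) v) (hnormalize H v) = v"
proof -
  show c: "hnormalize H v \<in> hcarrier H" using v by (simp add: hnormalize_def scale_closed)
  show z: "hnormalize H v = hzero H" if "v = hzero H"
    using that by (simp add: hnormalize_def scale_zero)
  show o: "hnorm H (hnormalize H v) = 1" if "v \<noteq> hzero H"
    using that v by (simp add: hnormalize_def hnorm_scale hnorm_eq_0_iff norm_divide hnorm_nonneg)
  show "hscale H (hinner H (hnormalize H v) v) (hnormalize H v) = v"
  proof (cases "v = hzero H")
    case True
    then show ?thesis using z by (simp add: scale_zero)
  next
    case False
    then have "hnorm H v \<noteq> 0" using v by (simp add: hnorm_eq_0_iff)
    then show ?thesis using v
      by (simp add: hnormalize_def hinner_scale_left scale_scale hinner_hnorm power2_eq_square scale_one)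
  qed
qed

lemma hnorm_minus_projection:
  assumes v: "v \<in> hcarrier H" and e: "e \<in> hcarrier H" "e = hzero H \<or> hnorm H e = 1"
  shows "(hnorm H (minus_on v (hscale H (hinner H e v) e)))\<^sup>2 = (hnorm H v)\<^sup>2 - (cmod (hinner H e v))\<^sup>2"
    and "hinner H e (minus_on v (hscale H (hinner H e v) e)) = 0"
proof -
  let ?c = "hinner H e v"
  have ve: "hinner H v e = cnj ?c" by (rule hinner_cnj) (use v e in auto)
  show z: "hinner H e (minus_on v (hscale H ?c e)) = 0"
    using e v by (auto simp: hinner_minus scale_closed hinner_scale hinner_hnorm hinner_zero_left)
  have "hinner H (minus_on v (hscale H ?c e)) (minus_on v (hscale H ?c e))
    = hinner H v (minus_on v (hscale H ?c e))"
    using v e z by (simp add: hinner_minus(2) minus_closed scale_closed hinner_scale_left)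
  also have "\<dots> = hinner H v v - ?c * cnj ?c"
    using v e by (simp add: hinner_minus scale_closed hinner_scale ve)
  finally have "Re (hinner H (minus_on v (hscale H ?c e)) (minus_on v (hscale H ?c e)))
    = Re (hinner H v v) - (cmod ?c)\<^sup>2"
    by (simp add: complex_mult_cnj cmod_power2)
  then show "(hnorm H (minus_on v (hscale H ?c e)))\<^sup>2 = (hnorm H v)\<^sup>2 - (cmod ?c)\<^sup>2"
    using v e by (simp add: hnorm_sq minus_closed scale_closed)
qed

context
  fixes d :: "nat \<Rightarrow> 'h"
  assumes d: "d n \<in> hcarrier H"
begin

lemma gs_Suc: "gs_residual H d (Suc n) w = minus_on (gs_residual H d n w) (hscale H (hinner H (gs_vector H d n) (gs_residual H d n w)) (gs_vector H d n))"
  by (simp add: gs_vector_def Let_def)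

lemma gs_closed: "w \<in> hcarrier H \<Longrightarrow> gs_residual H d n w \<in> hcarrier H" "gs_vector H d n \<in> hcarrier H"
proof -
  show *: "gs_residual H d n w \<in> hcarrier H" if "w \<in> hcarrier H" for n w
    using that d
    by (induction n arbitrary: w) (auto simp: Let_def intro!: add_closed scale_closed hnormalize_cases)
  show "gs_vector H d n \<in> hcarrier H" by (simp add: gs_vector_def hnormalize_cases * d)
qed

lemma gs_vector_cases: "gs_vector H d n = hzero H \<or> hnorm H (gs_vector H d n) = 1"
  using hnormalize_cases(2,3)[OF gs_closed(1)[OF d, of n n]] unfolding gs_vector_def by metis

text \<open>Linearity of the residual, needed to replace \<open>w\<close> by \<open>w\<close> minus
  a nearby vector of the dense sequence.\<close>

lemma gs_minus:
  assumes "v \<in> hcarrier H" "w \<in> hcarrier H"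
  shows "gs_residual H d n (minus_on v w) = minus_on (gs_residual H d n v) (gs_residual H d n w)"
proof (induction n)
  case (Suc n)
  define a where "a = gs_residual H d n v"
  define b where "b = gs_residual H d n w"
  define c where "c = gs_vector H d n"
  have *: "a \<in> hcarrier H" "b \<in> hcarrier H" "c \<in> hcarrier H"
    using assms gs_closed by (simp_all add: a_def b_def c_def)
  let ?a = "hscale H (hinner H c a) c" and ?b = "hscale H (hinner H c b) c"
  have "hscale H (hinner H c (minus_on a b)) c = minus_on ?a ?b"
    using * scale_add_left[of c "hinner H c a" "- hinner H c b"]
    by (simp add: hinner_minus scale_scale)
  then have "minus_on (minus_on a b) (hscale H (hinner H c (minus_on a b)) c)
    = minus_on (hadd H a (hscale H (-1) b)) (hadd H ?a (hscale H (-1) ?b))" by simp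
  also have "\<dots> = hadd H (minus_on a ?a) (minus_on (hscale H (-1) b) (hscale H (-1) ?b))"
    using * by (intro minus_add_minus scale_closed)
  also have "minus_on (hscale H (-1) b) (hscale H (-1) ?b) = hscale H (-1) (minus_on b ?b)"
    using * by (simp add: scale_add_right scale_closed)
  finally show ?case using Suc by (simp only: gs_Suc a_def b_def c_def)
qed simp

text \<open>Subtracting a multiple of the vector with index \<open>n\<close> leaves orthogonality to
  earlier ones intact, since that vector is itself a normalized residual to which the induction
  hypothesis applies.\<close>

lemma gs_orthogonal: "\<lbrakk>i < n; w \<in> hcarrier H\<rbrakk> \<Longrightarrow> hinner H (gs_vector H d i) (gs_residual H d n w) = 0"
proof (induction n arbitrary: w)
  case (Suc n)
  have c: "gs_vector H d i \<in> hcarrier H" "gs_vector H d n \<in> hcarrier H" "gs_residual H d n w \<in> hcarrier H" "gs_residual H d n (d n) \<in> hcarrier H"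
    using Suc gs_closed d by auto
  show ?case
  proof (cases "i = n")
    case True
    then show ?thesis
      using hnorm_minus_projection(2)[OF c(3,2) gs_vector_cases] by (simp only: gs_Suc)
  next
    case False
    then have i: "i < n" using Suc by simp
    have "hinner H (gs_vector H d i) (gs_vector H d n) = 0"
      using Suc.IH[OF i d] c by (simp add: gs_vector_def[of H d n] hnormalize_def hinner_scale)
    then show ?thesis using Suc.IH[OF i Suc.prems(2)] c
      by (simp only: gs_Suc) (simp add: hinner_minus scale_closed hinner_scale)
  qed
qed simp

lemma gs_vectors_orthogonal: "m \<noteq> n \<Longrightarrow> hinner H (gs_vector H d m) (gs_vector H d n) = 0"
proof -
  have lt: "hinner H (gs_vector H d m) (gs_vector H d n) = 0" if "m < n" for m n
    using gs_orthogonal[OF that d[of n]] gs_closed d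
    by (simp add: gs_vector_def[of H d n] hnormalize_def hinner_scale)
  show "hinner H (gs_vector H d m) (gs_vector H d n) = 0" if "m \<noteq> n"
    using that lt[of m n] lt[of n m] hinner_cnj[OF gs_closed(2) gs_closed(2), of n m]
    by (cases m n rule: linorder_cases) auto
qed

text \<open>A residual differs from \<open>w\<close> by multiples of vectors with index below
  \<open>n\<close>, all orthogonal to the one with index \<open>m\<close>.\<close>

lemma gs_hinner_residual:
  assumes "n \<le> m" "w \<in> hcarrier H"
  shows "hinner H (gs_vector H d m) (gs_residual H d n w) = hinner H (gs_vector H d m) w"
  using assms(1)
proof (induction n)
  case (Suc n)
  have "hinner H (gs_vector H d m) (gs_residual H d (Suc n) w) = hinner H (gs_vector H d m) (gs_residual H d n w)"
    unfolding gs_Suc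
    using assms gs_closed Suc.prems gs_vectors_orthogonal[of m n]
    by (simp add: hinner_minus scale_closed hinner_scale)
  then show ?case using Suc by simp
qed simp

text \<open>Bessel's inequality with its exact defect, by iterating Pythagoras.\<close>

lemma gs_residual_norm:
  assumes "w \<in> hcarrier H"
  shows "(hnorm H (gs_residual H d n w))\<^sup>2 = (hnorm H w)\<^sup>2 - (\<Sum>i<n. (cmod (hinner H (gs_vector H d i) w))\<^sup>2)"
proof (induction n)
  case (Suc n)
  show ?case
    using hnorm_minus_projection(1)[OF gs_closed(1)[OF assms] gs_closed(2) gs_vector_cases, of n n]
      Suc gs_hinner_residual[OF order_refl assms, of n]
    by (simp only: gs_Suc) simp
qed simp

text \<open>At step \<open>n\<close> the residual of \<open>d n\<close> is a multiple of the new
  basis vector and is removed entirely; afterwards 0 stays 0.\<close>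

lemma gs_residual_zero: "n < m \<Longrightarrow> gs_residual H d m (d n) = hzero H"
proof (induction m)
  case (Suc m)
  show ?case
  proof (cases "n = m")
    case True
    then show ?thesis
      using hnormalize_cases(4)[OF gs_closed(1)[OF d], of m m] gs_closed(1)[OF d, of m m]
      by (simp only: gs_Suc gs_vector_def) (simp add: minus_eq_zero_iff)
  next
    case False
    then have "gs_residual H d m (d n) = hzero H" using Suc by simp
    then show ?thesis
      by (simp only: gs_Suc)
        (simp add: gs_closed hinner_zero scale_0 add_zero zero_closed scale_zero)
  qed
qed simp

text \<open>Residuals do not increase norms and eventually annihilate each \<open>d n\<close>. Hence
  the residual of \<open>w\<close> equals that of \<open>w\<close> minus \<open>d n\<close>, which
  is small if \<open>d n\<close> is near \<open>w\<close>; so the defect in Bessel's inequality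
  tends to 0.\<close>

lemma gs_parseval:
  assumes dense: "\<And>v \<epsilon>. \<lbrakk>v \<in> hcarrier H; 0 < \<epsilon>\<rbrakk> \<Longrightarrow> \<exists>n. hdist H v (d n) < \<epsilon>" and w: "w \<in> hcarrier H"
  shows "(\<lambda>n. (cmod (hinner H (gs_vector H d n) w))\<^sup>2) sums (hnorm H w)\<^sup>2"
proof -
  have R_le: "hnorm H (gs_residual H d n v) \<le> hnorm H v" if "v \<in> hcarrier H" for n v
  proof (rule power2_le_imp_le)
    have "0 \<le> (\<Sum>i<n. (cmod (hinner H (gs_vector H d i) v))\<^sup>2)" by (intro sum_nonneg) simp
    then show "(hnorm H (gs_residual H d n v))\<^sup>2 \<le> (hnorm H v)\<^sup>2"
      unfolding gs_residual_norm[OF that] by simp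
  qed (rule hnorm_nonneg[OF that])
  have "(\<lambda>n. hnorm H (gs_residual H d n w)) \<longlonglongrightarrow> 0"
  proof (rule LIMSEQ_I)
    fix \<epsilon> :: real assume "0 < \<epsilon>"
    then obtain n where n: "hdist H w (d n) < \<epsilon>" using dense w by blast
    have "hnorm H (gs_residual H d m w) < \<epsilon>" if "m \<ge> Suc n" for m
    proof -
      have "gs_residual H d m (minus_on w (d n)) = gs_residual H d m w"
        using gs_minus[OF w d[of n], of m] gs_residual_zero[of n m] that gs_closed(1)[OF w, of m]
        by (simp add: scale_zero add_zero)
      then show ?thesis 
        using R_le[OF minus_closed[OF w d[of n]], of m] n hdist_in[OF w d[of n]] by simp
    qed
    moreover have "0 \<le> hnorm H (gs_residual H d m w)" for m
      using gs_closed(1)[OF w] by (rule hnorm_nonneg)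
    ultimately show "\<exists>N. \<forall>n\<ge>N. norm (hnorm H (gs_residual H d n w) - 0) < \<epsilon>" by auto
  qed
  then have "(\<lambda>n. (hnorm H w)\<^sup>2 - (hnorm H (gs_residual H d n w))\<^sup>2) \<longlonglongrightarrow> (hnorm H w)\<^sup>2 - 0\<^sup>2"
    by (intro tendsto_intros)
  then show ?thesis using gs_residual_norm[OF w] by (simp add: sums_def)
qed

end

text \<open>Allowing zero vectors lets one index set, the natural numbers, serve for finite and
  infinite dimension alike.\<close>

lemma ex_orthonormal_basis:
  obtains e :: "nat \<Rightarrow> 'h" where "\<And>n. e n \<in> hcarrier H" "\<And>n. e n = hzero H \<or> hnorm H (e n) = 1"
    "\<And>m n. m \<noteq> n \<Longrightarrow> hinner H (e m) (e n) = 0"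
    "\<And>w. w \<in> hcarrier H \<Longrightarrow> (\<lambda>n. (cmod (hinner H (e n) w))\<^sup>2) sums (hnorm H w)\<^sup>2"
proof -
  obtain d :: "nat \<Rightarrow> 'h" where d: "\<And>n. d n \<in> hcarrier H"
    "\<And>v \<epsilon>. \<lbrakk>v \<in> hcarrier H; 0 < \<epsilon>\<rbrakk> \<Longrightarrow> \<exists>n. hdist H v (d n) < \<epsilon>"
    using ex_dense_sequence by blast
  show ?thesis
  proof (rule that[of "gs_vector H d"])
    show "(\<lambda>n. (cmod (hinner H (gs_vector H d n) w))\<^sup>2) sums (hnorm H w)\<^sup>2"
      if "w \<in> hcarrier H" for w
      using d that by (rule gs_parseval)
  qed (fact gs_closed(2)[OF d(1)] gs_vector_cases[OF d(1)] gs_vectors_orthogonal[OF d(1)])+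
qed

text \<open>Polarization of Parseval termwise. The imaginary part is the real part for
  \<open>w\<close> multiplied by minus \<i>.\<close>

lemma parseval_hinner:
  assumes e: "\<And>n. e n \<in> hcarrier H"
    and pars: "\<And>w. w \<in> hcarrier H \<Longrightarrow> (\<lambda>n. (cmod (hinner H (e n) w))\<^sup>2) sums (hnorm H w)\<^sup>2"
    and v: "v \<in> hcarrier H" and w: "w \<in> hcarrier H"
  shows "(\<lambda>n. cnj (hinner H (e n) v) * hinner H (e n) w) sums hinner H v w"
proof -
  have re: "(\<lambda>n. Re (cnj (hinner H (e n) v) * hinner H (e n) w)) sums Re (hinner H v w)"
    if "v \<in> hcarrier H" "w \<in> hcarrier H" for v w
  proof -
    have "(cmod (a + b))\<^sup>2 - (cmod a)\<^sup>2 - (cmod b)\<^sup>2 = 2 * Re (cnj a * b)" for a b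
      by (simp add: cmod_power2 power2_sum algebra_simps)
    moreover have "(\<lambda>n. (cmod (hinner H (e n) (hadd H v w)))\<^sup>2 - (cmod (hinner H (e n) v))\<^sup>2
        - (cmod (hinner H (e n) w))\<^sup>2) sums ((hnorm H (hadd H v w))\<^sup>2 - (hnorm H v)\<^sup>2 - (hnorm H w)\<^sup>2)"
      using that by (intro sums_diff pars add_closed)
    ultimately have "(\<lambda>n. 2 * Re (cnj (hinner H (e n) v) * hinner H (e n) w)) sums (2 * Re (hinner H v w))"
      using that e by (simp add: hinner_add hnorm_add_sq)
    then have "(\<lambda>n. 1 / 2 * (2 * Re (cnj (hinner H (e n) v) * hinner H (e n) w)))
        sums (1 / 2 * (2 * Re (hinner H v w)))" by (rule sums_mult)
    then show ?thesis by (simp add: add_divide_distrib)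
  qed
  have "(\<lambda>n. Re (cnj (hinner H (e n) v) * hinner H (e n) (hscale H (- \<i>) w)))
      sums Re (hinner H v (hscale H (- \<i>) w))"
    using v w by (intro re scale_closed)
  then have "(\<lambda>n. Im (cnj (hinner H (e n) v) * hinner H (e n) w)) sums Im (hinner H v w)"
    using v w e by (simp add: hinner_scale)
  then show ?thesis using re[OF v w] by (simp add: sums_complex_iff)
qed

end

section \<open>Hilbert sums and tensor products\<close>

definition hsum :: "(nat \<Rightarrow> 'h hspace) \<Rightarrow> (nat \<Rightarrow> 'h) hspace"
  where "hsum H =
    \<lparr>hcarrier = {f. (\<forall>n. f n \<in> hcarrier (H n)) \<and> summable (\<lambda>n. (hnorm (H n) (f n))\<^sup>2)},
     hzero = (\<lambda>n. hzero (H n)), hadd = (\<lambda>f g n. hadd (H n) (f n) (g n)),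
     hscale = (\<lambda>c f n. hscale (H n) c (f n)), hinner = (\<lambda>f g. \<Sum>n. hinner (H n) (f n) (g n))\<rparr>"

locale hilbert_sequence =
  fixes H :: "nat \<Rightarrow> 'h hspace"
  assumes hs: "hilbert_space (H n)"
begin

sublocale hilbert_space "H n" for n by (rule hs)

abbreviation "HS \<equiv> hsum H"

lemma hsum_simps:
  "f \<in> hcarrier HS \<longleftrightarrow> (\<forall>n. f n \<in> hcarrier (H n)) \<and> summable (\<lambda>n. (hnorm (H n) (f n))\<^sup>2)"
  "hzero HS = (\<lambda>n. hzero (H n))"
  "hadd HS f g = (\<lambda>n. hadd (H n) (f n) (g n))"
  "hscale HS c f = (\<lambda>n. hscale (H n) c (f n))"
  "hinner HS f g = (\<Sum>n. hinner (H n) (f n) (g n))"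
  by (simp_all add: hsum_def)

lemma hsumD:
  assumes "f \<in> hcarrier HS"
  shows "f n \<in> hcarrier (H n)" "summable (\<lambda>n. (hnorm (H n) (f n))\<^sup>2)"
  using assms by (simp_all add: hsum_simps)

text \<open>By Cauchy-Schwarz in each summand, then by bounding a product by the sum of the
  squares.\<close>

lemma hsum_hinner_summable:
  assumes "f \<in> hcarrier HS" "g \<in> hcarrier HS"
  shows "summable (\<lambda>n. hinner (H n) (f n) (g n))"
proof (rule summable_comparison_test')
  show "summable (\<lambda>n. (hnorm (H n) (f n))\<^sup>2 + (hnorm (H n) (g n))\<^sup>2)"
    using assms by (intro summable_add hsumD)
  fix n
  have "cmod (hinner (H n) (f n) (g n)) \<le> hnorm (H n) (f n) * hnorm (H n) (g n)"
    using assms by (intro cmod_hinner_le hsumD)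
  also have "\<dots> \<le> (hnorm (H n) (f n))\<^sup>2 + (hnorm (H n) (g n))\<^sup>2"
    using sum_squares_bound[of "hnorm (H n) (f n)" "hnorm (H n) (g n)"]
      mult_nonneg_nonneg[OF hnorm_nonneg[OF hsumD(1)[OF assms(1), of n]] hnorm_nonneg[OF hsumD(1)[OF assms(2), of n]]]
    by linarith
  finally show "norm (hinner (H n) (f n) (g n)) \<le> (hnorm (H n) (f n))\<^sup>2 + (hnorm (H n) (g n))\<^sup>2" .
qed

lemma hsum_norm:
  assumes "f \<in> hcarrier HS"
  shows "hnorm HS f = sqrt (\<Sum>n. (hnorm (H n) (f n))\<^sup>2)"
proof -
  have "Re (\<Sum>n. hinner (H n) (f n) (f n)) = (\<Sum>n. Re (hinner (H n) (f n) (f n)))"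
    using sums_Re[OF summable_sums[OF hsum_hinner_summable[OF assms assms]]] by (simp add: sums_iff)
  then show ?thesis using hsumD(1)[OF assms] by (simp add: hnorm_def[of HS] hsum_simps hnorm_sq)
qed

lemma hsum_norm_nonneg: "f \<in> hcarrier HS \<Longrightarrow> 0 \<le> hnorm HS f"
  by (simp add: hsum_norm suminf_nonneg hsumD)

lemma hsum_norm_sq:
  "f \<in> hcarrier HS \<Longrightarrow> (hnorm HS f)\<^sup>2 = (\<Sum>n. (hnorm (H n) (f n))\<^sup>2)"
  by (simp add: hsum_norm suminf_nonneg hsumD)

lemma L2_set_le_hsum_norm:
  assumes "f \<in> hcarrier HS"
  shows "L2_set (\<lambda>n. hnorm (H n) (f n)) {..<N} \<le> hnorm HS f"
  unfolding L2_set_def hsum_norm[OF assms]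
  using hsumD(2)[OF assms] by (intro real_sqrt_le_mono sum_le_suminf) auto

text \<open>Membership and the norm bound both follow from a uniform bound on finite pieces. This
  reduces the triangle inequality and completeness to Minkowski for finite sums, available for
  \<open>L2_set\<close>.\<close>

lemma hsum_memI:
  assumes "\<And>n. f n \<in> hcarrier (H n)" "\<And>N. L2_set (\<lambda>n. hnorm (H n) (f n)) {..<N} \<le> B"
  shows "f \<in> hcarrier HS" "hnorm HS f \<le> B"
proof -
  have B: "0 \<le> B" using assms(2)[of 0] by simp
  have *: "(\<Sum>n<N. (hnorm (H n) (f n))\<^sup>2) \<le> B\<^sup>2" for N
    using power_mono[OF assms(2)[of N], of 2] by (simp add: L2_set_def sum_nonneg)
  have s: "summable (\<lambda>n. (hnorm (H n) (f n))\<^sup>2)"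
    using * by (intro bounded_imp_summable[of _ "B\<^sup>2"]) (auto simp: lessThan_Suc_atMost[symmetric] simp del: sum.lessThan_Suc)
  then show f: "f \<in> hcarrier HS" using assms by (simp add: hsum_simps)
  have "(\<Sum>n. (hnorm (H n) (f n))\<^sup>2) \<le> B\<^sup>2" using * s by (intro suminf_le_const)
  then show "hnorm HS f \<le> B"
    using real_sqrt_le_mono B by (fastforce simp: hsum_norm[OF f])
qed

lemma hsum_triangle:
  assumes f: "f \<in> hcarrier HS" and g: "g \<in> hcarrier HS"
  shows "hadd HS f g \<in> hcarrier HS"
    and "hnorm HS (hadd HS f g) \<le> hnorm HS f + hnorm HS g"
proof -
  have c: "hadd HS f g n \<in> hcarrier (H n)" for n
    using f g by (simp add: hsum_simps add_closed)
  have "L2_set (\<lambda>n. hnorm (H n) (hadd HS f g n)) {..<N} \<le> hnorm HS f + hnorm HS g" for N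
  proof -
    have "L2_set (\<lambda>n. hnorm (H n) (hadd HS f g n)) {..<N}
      \<le> L2_set (\<lambda>n. hnorm (H n) (f n) + hnorm (H n) (g n)) {..<N}"
      using f g by (intro L2_set_mono hnorm_nonneg c) (auto simp: hsum_simps hnorm_triangle)
    also have "\<dots> \<le> L2_set (\<lambda>n. hnorm (H n) (f n)) {..<N} + L2_set (\<lambda>n. hnorm (H n) (g n)) {..<N}"
      by (rule L2_set_triangle_ineq)
    finally show ?thesis using L2_set_le_hsum_norm[OF f, of N] L2_set_le_hsum_norm[OF g, of N] by simp
  qed
  from hsum_memI[OF c this] show "hadd HS f g \<in> hcarrier HS"
    "hnorm HS (hadd HS f g) \<le> hnorm HS f + hnorm HS g" .
qed

lemma hsum_scale_closed:
  assumes "f \<in> hcarrier HS"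
  shows "hscale HS c f \<in> hcarrier HS"
  using hsumD[OF assms] by (auto simp: hsum_simps scale_closed hnorm_scale power_mult_distrib intro: summable_mult)

lemma hsum_complex_normed_space:
  "complex_normed_space (hcarrier HS) (hzero HS) (hadd HS) (hscale HS) (hnorm HS)"
proof
  show "hzero HS \<in> hcarrier HS" by (simp add: hsum_simps zero_closed hnorm_zero)
  fix f assume f: "f \<in> hcarrier HS"
  show "hscale HS c f \<in> hcarrier HS" for c using f by (rule hsum_scale_closed)
  show "hadd HS f (hzero HS) = f"
    using hsumD(1)[OF f] by (simp add: hsum_simps add_zero)
  have "hadd HS f (hscale HS (-1) f) = hzero HS"
    using hsumD(1)[OF f] by (simp add: hsum_simps minus_eq_zero_iff fun_eq_iff)
  then show "\<exists>g\<in>hcarrier HS. hadd HS f g = hzero HS"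
    using hsum_scale_closed[OF f] by blast
  show "hscale HS (c + d) f = hadd HS (hscale HS c f) (hscale HS d f)" for c d
    using hsumD(1)[OF f] by (simp add: hsum_simps scale_add_left)
  show "hscale HS c (hscale HS d f) = hscale HS (c * d) f" for c d
    using hsumD(1)[OF f] by (simp add: hsum_simps scale_scale)
  show "hscale HS 1 f = f"
    using hsumD(1)[OF f] by (simp add: hsum_simps scale_one)
  show "0 \<le> hnorm HS f" using f by (rule hsum_norm_nonneg)
  show "hnorm HS f = 0 \<longleftrightarrow> f = hzero HS"
    using hsumD[OF f] suminf_eq_zero_iff[OF hsumD(2)[OF f]]
    by (auto simp: hsum_norm[OF f] hsum_simps hnorm_eq_0_iff fun_eq_iff)
  show "hnorm HS (hscale HS c f) = cmod c * hnorm HS f" for c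
  proof -
    have "(hnorm (H n) (hscale HS c f n))\<^sup>2 = (cmod c)\<^sup>2 * (hnorm (H n) (f n))\<^sup>2" for n
      using hnorm_scale[OF hsumD(1)[OF f], of n c] by (simp add: hsum_simps(4) power_mult_distrib)
    then have "hnorm HS (hscale HS c f) = sqrt ((cmod c)\<^sup>2 * (\<Sum>n. (hnorm (H n) (f n))\<^sup>2))"
      unfolding hsum_norm[OF hsum_scale_closed[OF f]] by (simp add: suminf_mult[OF hsumD(2)[OF f]])
    then show ?thesis by (simp add: hsum_norm[OF f] real_sqrt_mult)
  qed
  fix g assume g: "g \<in> hcarrier HS"
  show "hadd HS f g \<in> hcarrier HS"
    "hnorm HS (hadd HS f g) \<le> hnorm HS f + hnorm HS g"
    using hsum_triangle[OF f g] .
  show "hadd HS f g = hadd HS g f"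
    using hsumD(1)[OF f] hsumD(1)[OF g] by (simp add: hsum_simps add_commute)
  show "hscale HS c (hadd HS f g) = hadd HS (hscale HS c f) (hscale HS c g)" for c
    using hsumD(1)[OF f] hsumD(1)[OF g] by (simp add: hsum_simps scale_add_right)
  fix h assume h: "h \<in> hcarrier HS"
  show "hadd HS (hadd HS f g) h = hadd HS f (hadd HS g h)"
    using hsumD(1)[OF f] hsumD(1)[OF g] hsumD(1)[OF h] by (simp add: hsum_simps add_assoc)
qed

definition truncate :: "nat \<Rightarrow> (nat \<Rightarrow> 'h) \<Rightarrow> nat \<Rightarrow> 'h"
  where "truncate N f n = (if n < N then f n else hzero (H n))"

lemma truncate_mem:
  assumes "\<And>n. n < N \<Longrightarrow> f n \<in> hcarrier (H n)"
  shows "truncate N f \<in> hcarrier HS"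
proof -
  have "summable (\<lambda>n. (hnorm (H n) (truncate N f n))\<^sup>2)"
    by (rule summable_finite[of "{..<N}"]) (auto simp: truncate_def hnorm_zero)
  moreover have "truncate N f n \<in> hcarrier (H n)" for n
    using assms[of n] zero_closed[of n] by (simp add: truncate_def)
  ultimately show ?thesis unfolding hsum_simps(1) by blast
qed

lemma hsum_hdist:
  assumes "f \<in> hcarrier HS" "g \<in> hcarrier HS"
  shows "summable (\<lambda>n. (hdist (H n) (f n) (g n))\<^sup>2)"
    "(hdist HS f g)\<^sup>2 = (\<Sum>n. (hdist (H n) (f n) (g n))\<^sup>2)"
    "hdist HS f g = hnorm HS (hadd HS f (hscale HS (-1) g))"
    "hadd HS f (hscale HS (-1) g) \<in> hcarrier HS"
proof -
  let ?g = "hadd HS f (hscale HS (-1) g)"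
  show m: "?g \<in> hcarrier HS" using assms by (intro hsum_triangle hsum_scale_closed)
  show d: "hdist HS f g = hnorm HS ?g"
    using assms by (simp add: hdist_def norm_dist_def)
  have e: "hnorm (H n) (?g n) = hdist (H n) (f n) (g n)" for n
    using hdist_in[OF hsumD(1)[OF assms(1)] hsumD(1)[OF assms(2)], of n] by (simp add: hsum_simps)
  show "summable (\<lambda>n. (hdist (H n) (f n) (g n))\<^sup>2)" using hsumD(2)[OF m] by (simp add: e)
  show "(hdist HS f g)\<^sup>2 = (\<Sum>n. (hdist (H n) (f n) (g n))\<^sup>2)"
    using hsum_norm_sq[OF m] d by (simp add: e)
qed

text \<open>The exact tail in the second claim is needed besides the limit: for sections it is
  dominated by a numerical tail common to all units, which makes the truncations converge
  uniformly.\<close>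

lemma hdist_truncate_tendsto:
  assumes f: "f \<in> hcarrier HS"
  shows "(\<lambda>N. hdist HS f (truncate N f)) \<longlonglongrightarrow> 0"
    and "(hdist HS f (truncate N f))\<^sup>2 = (\<Sum>n. (hnorm (H (n + N)) (f (n + N)))\<^sup>2)"
proof -
  have t: "truncate N f \<in> hcarrier HS" for N
    by (rule truncate_mem) (rule hsumD(1)[OF f])
  have d: "hdist (H n) (f n) (truncate N f n) = (if n < N then 0 else hnorm (H n) (f n))" for n N
    using hsumD(1)[OF f] by (simp add: truncate_def hnorm_hdist)
  show sq: "(hdist HS f (truncate N f))\<^sup>2 = (\<Sum>n. (hnorm (H (n + N)) (f (n + N)))\<^sup>2)" for N
    using suminf_split_initial_segment[OF hsum_hdist(1)[OF f t], of N N]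
    by (simp add: hsum_hdist(2)[OF f t] d)
  have "(\<lambda>N. sqrt ((hdist HS f (truncate N f))\<^sup>2)) \<longlonglongrightarrow> sqrt 0"
    unfolding sq using suminf_exist_split2[OF hsumD(2)[OF f]] by (intro tendsto_real_sqrt)
  then show "(\<lambda>N. hdist HS f (truncate N f)) \<longlonglongrightarrow> 0"
    using hsum_hdist(3,4)[OF f t] hsum_norm_nonneg by simp
qed

lemma hdist_component_le:
  assumes "f \<in> hcarrier HS" "g \<in> hcarrier HS"
  shows "hdist (H n) (f n) (g n) \<le> hdist HS f g"
proof (rule power2_le_imp_le)
  have "sum (\<lambda>n. (hdist (H n) (f n) (g n))\<^sup>2) {n} \<le> (\<Sum>n. (hdist (H n) (f n) (g n))\<^sup>2)"
    by (rule sum_le_suminf[OF hsum_hdist(1)[OF assms]]) auto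
  then show "(hdist (H n) (f n) (g n))\<^sup>2 \<le> (hdist HS f g)\<^sup>2"
    by (simp add: hsum_hdist(2)[OF assms])
  show "0 \<le> hdist HS f g"
    unfolding hsum_hdist(3)[OF assms] by (rule hsum_norm_nonneg[OF hsum_hdist(4)[OF assms]])
qed

text \<open>The square-sum norm is bounded crudely by the plain sum, which is enough for density
  since the length \<open>N\<close> is fixed beforehand.\<close>

lemma hdist_truncate_le:
  assumes "\<And>n. n < N \<Longrightarrow> f n \<in> hcarrier (H n)" "\<And>n. n < N \<Longrightarrow> g n \<in> hcarrier (H n)"
  shows "hdist HS (truncate N f) (truncate N g) \<le> (\<Sum>n<N. hdist (H n) (f n) (g n))"
proof -
  have t: "truncate N f \<in> hcarrier HS" "truncate N g \<in> hcarrier HS"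
    using assms by (auto intro: truncate_mem)
  have "hdist HS (truncate N f) (truncate N g) \<ge> 0"
    unfolding hsum_hdist(3)[OF t] by (rule hsum_norm_nonneg[OF hsum_hdist(4)[OF t]])
  then have "hdist HS (truncate N f) (truncate N g)
    = sqrt (\<Sum>n. (hdist (H n) (truncate N f n) (truncate N g n))\<^sup>2)"
    unfolding hsum_hdist(2)[OF t, symmetric] by simp
  also have "(\<Sum>n. (hdist (H n) (truncate N f n) (truncate N g n))\<^sup>2)
    = (\<Sum>n<N. (hdist (H n) (truncate N f n) (truncate N g n))\<^sup>2)"
    by (rule suminf_finite) (auto simp: truncate_def zero_closed)
  also have "\<dots> = (\<Sum>n<N. (hdist (H n) (f n) (g n))\<^sup>2)"
    by (rule sum.cong) (auto simp: truncate_def)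
  also have "sqrt \<dots> = L2_set (\<lambda>n. hdist (H n) (f n) (g n)) {..<N}"
    by (simp add: L2_set_def)
  also have "\<dots> \<le> (\<Sum>n<N. hdist (H n) (f n) (g n))"
    by (rule L2_set_le_sum) (rule hmetric.nonneg)
  finally show ?thesis .
qed

text \<open>The candidate limit is formed component by component. Estimates on the first
  \<open>M\<close> components survive the passage to the limit, and since they are uniform in
  \<open>M\<close> they bound the whole distance.\<close>

lemma hsum_complete:
  assumes f: "\<And>k::nat. f k \<in> hcarrier HS"
    and cauchy: "\<And>\<epsilon>. 0 < \<epsilon> \<Longrightarrow> \<exists>N. \<forall>j\<ge>N. \<forall>k\<ge>N. hdist HS (f j) (f k) < \<epsilon>"
  shows "\<exists>l\<in>hcarrier HS. \<forall>\<epsilon>>0. \<exists>N. \<forall>k\<ge>N. hdist HS (f k) l \<le> \<epsilon>"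
proof -
  have fc: "f k n \<in> hcarrier (H n)" for k n by (rule hsumD(1)[OF f])
  have "\<exists>l. l \<in> hcarrier (H n) \<and> (\<lambda>k. hdist (H n) (f k n) l) \<longlonglongrightarrow> 0" for n
  proof (rule hcauchy_convergent[of "\<lambda>k. f k n" n])
    show "f k n \<in> hcarrier (H n)" for k by (rule fc)
    fix \<epsilon> :: real assume "0 < \<epsilon>"
    then obtain N where "\<forall>j\<ge>N. \<forall>k\<ge>N. hdist HS (f j) (f k) < \<epsilon>" using cauchy by blast
    then show "\<exists>N. \<forall>j\<ge>N. \<forall>k\<ge>N. hdist (H n) (f j n) (f k n) < \<epsilon>"
      using hdist_component_le[OF f f] by (meson le_less_trans)
  qed blast
  then obtain l where l: "\<And>n. l n \<in> hcarrier (H n)" "\<And>n. (\<lambda>k. hdist (H n) (f k n) (l n)) \<longlonglongrightarrow> 0"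
    by metis
  have tend: "(\<lambda>k. hdist (H n) (f m n) (f k n)) \<longlonglongrightarrow> hdist (H n) (f m n) (l n)" for m n
  proof (rule Lim_transform_bound[OF always_eventually l(2)[of n], THEN LIM_zero_cancel], rule allI)
    fix k
    show "norm (hdist (H n) (f m n) (f k n) - hdist (H n) (f m n) (l n)) \<le> norm (hdist (H n) (f k n) (l n))"
      using hdist_triangle[OF fc[of m n] fc[of k n] l(1)[of n]]
        hdist_triangle[OF fc[of m n] l(1)[of n] fc[of k n]] hdist_commute[of n "l n" "f k n"]
      by simp
  qed
  have bound: "\<exists>N. \<forall>m\<ge>N. \<forall>M. L2_set (\<lambda>n. hdist (H n) (f m n) (l n)) {..<M} \<le> \<epsilon>" if "0 < \<epsilon>" for \<epsilon>
  proof -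
    obtain N where N: "\<And>j k. \<lbrakk>j \<ge> N; k \<ge> N\<rbrakk> \<Longrightarrow> hdist HS (f j) (f k) < \<epsilon>"
      using cauchy[OF \<open>0 < \<epsilon>\<close>] by blast
    have "L2_set (\<lambda>n. hdist (H n) (f m n) (l n)) {..<M} \<le> \<epsilon>" if "m \<ge> N" for m M
    proof (rule tendsto_upperbound)
      show "(\<lambda>k. L2_set (\<lambda>n. hdist (H n) (f m n) (f k n)) {..<M})
        \<longlonglongrightarrow> L2_set (\<lambda>n. hdist (H n) (f m n) (l n)) {..<M}"
        unfolding L2_set_def by (intro tendsto_intros tend)
      have "L2_set (\<lambda>n. hdist (H n) (f m n) (f k n)) {..<M} \<le> \<epsilon>" if "k \<ge> N" for k
      proof -
        have "sqrt (\<Sum>n<M. (hdist (H n) (f m n) (f k n))\<^sup>2) \<le> sqrt ((hdist HS (f m) (f k))\<^sup>2)"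
          unfolding hsum_hdist(2)[OF f f]
          by (intro real_sqrt_le_mono sum_le_suminf hsum_hdist(1)[OF f f]) auto
        also have "\<dots> = hdist HS (f m) (f k)"
          using hsum_hdist(3)[OF f f, of m k] hsum_norm_nonneg[OF hsum_hdist(4)[OF f f, of m k]] by simp
        also have "\<dots> \<le> \<epsilon>" using N[OF \<open>m \<ge> N\<close> that] by simp
        finally show ?thesis by (simp add: L2_set_def)
      qed
      then show "\<forall>\<^sub>F k in sequentially. L2_set (\<lambda>n. hdist (H n) (f m n) (f k n)) {..<M} \<le> \<epsilon>"
        unfolding eventually_sequentially by blast
    qed simp
    then show ?thesis by blast
  qed
  have lm: "l \<in> hcarrier HS"
  proof -
    \<comment> \<open>Distance at most 1 from some member already bounds all finite pieces of
      \<open>l\<close>, so \<open>l\<close> is square summable.\<close>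
    obtain m where m: "\<And>M. L2_set (\<lambda>n. hdist (H n) (f m n) (l n)) {..<M} \<le> 1" using bound[of 1] by force
    have "L2_set (\<lambda>n. hnorm (H n) (l n)) {..<M} \<le> hnorm HS (f m) + 1" for M
    proof -
      have "L2_set (\<lambda>n. hnorm (H n) (l n)) {..<M}
        \<le> L2_set (\<lambda>n. hnorm (H n) (f m n) + hdist (H n) (f m n) (l n)) {..<M}"
      proof (rule L2_set_mono)
        fix n
        show "hnorm (H n) (l n) \<le> hnorm (H n) (f m n) + hdist (H n) (f m n) (l n)"
          using hnorm_diff_le_hdist[OF fc[of m n] l(1)[of n]] by simp
        show "0 \<le> hnorm (H n) (l n)" by (rule hnorm_nonneg[OF l(1)])
      qed
      also have "\<dots> \<le> L2_set (\<lambda>n. hnorm (H n) (f m n)) {..<M} + L2_set (\<lambda>n. hdist (H n) (f m n) (l n)) {..<M}"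
        by (rule L2_set_triangle_ineq)
      finally show ?thesis using m[of M] L2_set_le_hsum_norm[OF f, of m M] by simp
    qed
    then show ?thesis by (rule hsum_memI(1)[where f = l, OF l(1)])
  qed
  have "\<exists>N. \<forall>k\<ge>N. hdist HS (f k) l \<le> \<epsilon>" if "0 < \<epsilon>" for \<epsilon>
  proof -
    obtain N where N: "\<And>m M. m \<ge> N \<Longrightarrow> L2_set (\<lambda>n. hdist (H n) (f m n) (l n)) {..<M} \<le> \<epsilon>"
      using bound[OF \<open>0 < \<epsilon>\<close>] by blast
    have "hdist HS (f k) l \<le> \<epsilon>" if "k \<ge> N" for k
    proof -
      let ?g = "hadd HS (f k) (hscale HS (-1) l)"
      have "?g n \<in> hcarrier (H n)" for n by (rule hsumD(1)[OF hsum_hdist(4)[OF f lm]])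
      moreover have "hnorm (H n) (?g n) = hdist (H n) (f k n) (l n)" for n
        using hdist_in[OF fc[of k n] l(1)[of n]] by (simp add: hsum_simps)
      ultimately have "hnorm HS ?g \<le> \<epsilon>"
        using N[OF that] by (intro hsum_memI(2)) auto
      then show ?thesis by (simp add: hsum_hdist(3)[OF f lm])
    qed
    then show ?thesis by blast
  qed
  then show ?thesis using lm by blast
qed

text \<open>Finitely supported sequences with entries from countable dense sets are coded by lists
  of natural numbers: the length gives the truncation point, the entries pick the dense vectors.
  Indices beyond the list are never read.\<close>

lemma hsum_dense_sequence:
  obtains C where "countable C" "C \<subseteq> hcarrier HS"
    "\<And>f \<epsilon>. \<lbrakk>f \<in> hcarrier HS; 0 < \<epsilon>\<rbrakk> \<Longrightarrow> \<exists>g\<in>C. hdist HS f g < \<epsilon>"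
proof -
  have "\<forall>n. \<exists>d :: nat \<Rightarrow> 'h. (\<forall>k. d k \<in> hcarrier (H n)) \<and>
      (\<forall>v\<in>hcarrier (H n). \<forall>\<epsilon>>0. \<exists>k. hdist (H n) v (d k) < \<epsilon>)"
  proof
    fix n
    show "\<exists>d :: nat \<Rightarrow> 'h. (\<forall>k. d k \<in> hcarrier (H n)) \<and>
        (\<forall>v\<in>hcarrier (H n). \<forall>\<epsilon>>0. \<exists>k. hdist (H n) v (d k) < \<epsilon>)"
      by (rule ex_dense_sequence[of n]) blast
  qed
  then obtain d :: "nat \<Rightarrow> nat \<Rightarrow> 'h" where d: "\<And>n k. d n k \<in> hcarrier (H n)"
    "\<And>n v \<epsilon>. \<lbrakk>v \<in> hcarrier (H n); 0 < \<epsilon>\<rbrakk> \<Longrightarrow> \<exists>k. hdist (H n) v (d n k) < \<epsilon>"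
    by metis
  define w where "w ks n = d n (ks ! n)" for ks n
  define c where "c ks = truncate (length ks) (w ks)" for ks
  interpret N: complex_normed_space "hcarrier HS" "hzero HS" "hadd HS" "hscale HS"
    "hnorm HS" by (rule hsum_complex_normed_space)
  interpret M: Metric_space "hcarrier HS" "hdist HS"
    unfolding hdist_def[of HS] by (rule N.norm_dist_Metric_space)
  have c: "c ks \<in> hcarrier HS" for ks
    unfolding c_def by (rule truncate_mem) (simp add: w_def d)
  have "\<exists>g\<in>range c. hdist HS f g < \<epsilon>" if f: "f \<in> hcarrier HS" and \<epsilon>: "0 < \<epsilon>" for f \<epsilon>
  proof -
    have fn: "f n \<in> hcarrier (H n)" for n by (rule hsumD(1)[OF f])
    have "0 < \<epsilon> / 2" using \<epsilon> by simp
    from order_tendstoD(2)[OF hdist_truncate_tendsto(1)[OF f] this]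
    obtain N where N: "hdist HS f (truncate N f) < \<epsilon> / 2"
      unfolding eventually_sequentially by blast
    \<comment> \<open>\<open>N\<close> components with error \<delta> cost at most \<epsilon>/2 in
      total; the added 1 covers \<open>N = 0\<close>.\<close>
    define \<delta> where "\<delta> = (\<epsilon> / 2) / (real N + 1)"
    have "0 < \<delta>" using \<epsilon> by (simp add: \<delta>_def add_nonneg_pos)
    then have "\<forall>n. \<exists>k. hdist (H n) (f n) (d n k) < \<delta>" using d(2) fn by blast
    then obtain k where k: "\<And>n. hdist (H n) (f n) (d n (k n)) < \<delta>" by metis
    define ks where "ks = map k [0..<N]"
    have t: "truncate N f \<in> hcarrier HS" by (rule truncate_mem) (rule fn)
    have "hdist HS (truncate N f) (c ks) = hdist HS (truncate N f) (truncate N (w ks))"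
      by (simp add: c_def ks_def)
    also have "\<dots> \<le> (\<Sum>n<N. hdist (H n) (f n) (w ks n))"
      by (rule hdist_truncate_le) (auto simp: fn w_def d)
    also have "\<dots> \<le> (\<Sum>n<N. \<delta>)"
      using k by (intro sum_mono) (auto simp: w_def ks_def intro: less_imp_le)
    also have "\<dots> = real N * \<delta>" by simp
    also have "\<dots> \<le> \<epsilon> / 2" unfolding \<delta>_def using \<epsilon> by (simp add: field_simps)
    finally have "hdist HS f (c ks) < \<epsilon>"
      using M.triangle[OF f t c, of ks] N by simp
    then show ?thesis by blast
  qed
  then show ?thesis using that[of "range c"] c by auto
qed

lemma hsum_hilbert_space: "hilbert_space HS"
proof -
  obtain C where C: "countable C" "C \<subseteq> hcarrier HS"
    "\<And>f \<epsilon>. \<lbrakk>f \<in> hcarrier HS; 0 < \<epsilon>\<rbrakk> \<Longrightarrow> \<exists>g\<in>C. hdist HS f g < \<epsilon>"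
    using hsum_dense_sequence by blast
  show ?thesis
  proof (rule hilbert_spaceI[OF hsum_complex_normed_space _ _ _ _ C])
    fix f g assume f: "f \<in> hcarrier HS" and g: "g \<in> hcarrier HS"
    have "(\<lambda>n. cnj (hinner (H n) (f n) (g n))) sums cnj (hinner HS f g)"
      unfolding sums_cnj hsum_simps(5) by (rule summable_sums[OF hsum_hinner_summable[OF f g]])
    moreover have "cnj (hinner (H n) (f n) (g n)) = hinner (H n) (g n) (f n)" for n
      using hinner_cnj[OF hsumD(1)[OF f] hsumD(1)[OF g]] by (rule sym)
    ultimately show "hinner HS g f = cnj (hinner HS f g)"
      unfolding hsum_simps(5)[of g f] by (simp add: sums_iff)
    show "hinner HS f (hscale HS c g) = c * hinner HS f g" for c
    proof -
      have "hinner (H n) (f n) (hscale HS c g n) = c * hinner (H n) (f n) (g n)" for n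
        unfolding hsum_simps(4) by (rule hinner_scale[OF hsumD(1)[OF f] hsumD(1)[OF g]])
      then show ?thesis
        unfolding hsum_simps(5) by (simp add: suminf_mult[OF hsum_hinner_summable[OF f g]])
    qed
    show "hinner HS f (hadd HS g h) = hinner HS f g + hinner HS f h"
      if h: "h \<in> hcarrier HS" for h
    proof -
      have "hinner (H n) (f n) (hadd HS g h n) = hinner (H n) (f n) (g n) + hinner (H n) (f n) (h n)" for n
        unfolding hsum_simps(3) by (rule hinner_add[OF hsumD(1)[OF f] hsumD(1)[OF g] hsumD(1)[OF h]])
      then show ?thesis
        unfolding hsum_simps(5)
        by (simp add: suminf_add[OF hsum_hinner_summable[OF f g] hsum_hinner_summable[OF f h], symmetric])
    qed
  qed (rule hsum_complete)
qed

definition hsingle :: "nat \<Rightarrow> 'h \<Rightarrow> nat \<Rightarrow> 'h"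
  where "hsingle n v m = (if m = n then v else hzero (H m))"

lemma hsingle_mem:
  assumes "v \<in> hcarrier (H n)"
  shows "hsingle n v \<in> hcarrier HS"
proof -
  have "summable (\<lambda>m. (hnorm (H m) (hsingle n v m))\<^sup>2)"
    by (rule summable_finite[of "{n}"]) (auto simp: hsingle_def hnorm_zero)
  moreover have "hsingle n v m \<in> hcarrier (H m)" for m
    using assms zero_closed[of m] by (simp add: hsingle_def)
  ultimately show ?thesis unfolding hsum_simps(1) by blast
qed

lemma hinner_hsingle:
  assumes "f \<in> hcarrier HS"
  shows "hinner HS (hsingle n v) f = hinner (H n) v (f n)"
proof -
  have "hinner (H m) (hsingle n v m) (f m) = 0" if "m \<notin> {n}" for m
    using that hinner_zero_left[OF hsumD(1)[OF assms, of m]] by (simp add: hsingle_def)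
  then have "hinner HS (hsingle n v) f = (\<Sum>m\<in>{n}. hinner (H m) (hsingle n v m) (f m))"
    unfolding hsum_simps(5) by (intro suminf_finite) auto
  then show ?thesis by (simp add: hsingle_def)
qed

lemma hnorm_hsingle: "v \<in> hcarrier (H n) \<Longrightarrow> hnorm HS (hsingle n v) = hnorm (H n) v"
  using hinner_hsingle[OF hsingle_mem, of v n n v] by (simp add: hnorm_def) (simp add: hsingle_def)

lemma hlinear_hsingle: "hlinear (H n) HS (hsingle n)"
  unfolding hlinear_def
  using add_zero[OF zero_closed] scale_zero
  by (auto simp: hsingle_mem fun_eq_iff hsum_simps(3,4)) (auto simp: hsingle_def)

lemma truncate_in_hspan:
  assumes f: "\<And>n. f n \<in> hcarrier (H n)"
  shows "truncate N f \<in> hspan HS {hsingle n v | n v. v \<in> hcarrier (H n)}"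
proof (induction N)
  case 0
  have "truncate 0 f = hzero HS" by (simp add: truncate_def fun_eq_iff hsum_simps(2))
  then show ?case by (simp add: hspan.hspan_zero)
next
  case (Suc N)
  have "truncate (Suc N) f = hadd HS (truncate N f) (hsingle N (f N))"
  proof
    fix n
    show "truncate (Suc N) f n = hadd HS (truncate N f) (hsingle N (f N)) n"
      using add_zero[OF f, of n] zero_add[OF f, of n] add_zero[OF zero_closed, of n]
      by (cases n N rule: linorder_cases) (simp_all add: truncate_def hsingle_def hsum_simps(3))
  qed
  moreover have "hsingle N (f N) \<in> {hsingle n v | n v. v \<in> hcarrier (H n)}" using f by blast
  ultimately show ?case using Suc by (auto intro: hspan.intros)
qed

text \<open>Truncations are finite sums of vectors living in one summand and are dense. Within a
  summand the inclusion is isometric and linear, hence carries the closed span of \<open>S n\<close>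
  into the closed span of the images.\<close>

lemma htotal_hsum:
  assumes S: "\<And>n. htotal (H n) (S n)"
  shows "htotal HS {hsingle n v | n v. v \<in> S n}"
proof -
  interpret T: hilbert_space HS by (rule hsum_hilbert_space)
  let ?A = "{hsingle n v | n v. v \<in> hcarrier (H n)}" and ?B = "{hsingle n v | n v. v \<in> S n}"
  have SH: "S n \<subseteq> hcarrier (H n)" for n using S by (simp add: htotal_def)
  have B: "?B \<subseteq> hcarrier HS" using SH hsingle_mem by fastforce
  have A: "?A \<subseteq> hcarrier HS" using hsingle_mem by fastforce
  have "htotal HS ?A" unfolding htotal_def
  proof (intro conjI A subsetI)
    fix f assume f: "f \<in> hcarrier HS"
    have fn: "f n \<in> hcarrier (H n)" for n by (rule hsumD(1)[OF f])
    have "\<exists>w\<in>hspan HS ?A. hdist HS f w < \<epsilon>" if "0 < \<epsilon>" for \<epsilon>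
      using order_tendstoD(2)[OF hdist_truncate_tendsto(1)[OF f] that] truncate_in_hspan[of f, OF fn]
      unfolding eventually_sequentially by blast
    then show "f \<in> hclspan HS ?A" using f by (simp add: hclspan_def)
  qed
  then show ?thesis
  proof (rule T.htotal_trans)
    show "?A \<subseteq> hclspan HS ?B"
    proof
      fix a assume "a \<in> ?A"
      then obtain n v where a: "a = hsingle n v" "v \<in> hcarrier (H n)" by blast
      have "v \<in> hclspan (H n) (S n)" using S a(2) by (auto simp: htotal_def)
      moreover have "hsingle n ` S n \<subseteq> hclspan HS ?B"
        using T.hspan_subset_hclspan[OF B] by (auto intro: hspan.hspan_base)
      moreover have "hnorm HS (hsingle n v) \<le> 1 * hnorm (H n) v" if "v \<in> hcarrier (H n)" for v
        using hnorm_hsingle[OF that] by simp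
      ultimately show "a \<in> hclspan HS ?B"
        unfolding a(1) using hclspan_map[OF hs hsum_hilbert_space hlinear_hsingle _ SH B] by blast
    qed
  qed (rule B)
qed

end

lemma (in hilbert_space) htotal_hcarrier: "htotal H (hcarrier H)"
  using hspan_subset_hclspan[OF order_refl] by (auto simp: htotal_def intro: hspan.hspan_base)

section \<open>Tensor products of Hilbert spaces\<close>

definition hzero_space :: "'h hspace \<Rightarrow> 'h hspace"
  where "hzero_space H = H\<lparr>hcarrier := {hzero H}\<rparr>"

lemma hzero_space_simps:
  "hcarrier (hzero_space H) = {hzero H}" "hzero (hzero_space H) = hzero H"
  "hadd (hzero_space H) = hadd H" "hscale (hzero_space H) = hscale H"
  "hinner (hzero_space H) = hinner H" "hnorm (hzero_space H) = hnorm H"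
  by (simp_all add: hzero_space_def hnorm_def fun_eq_iff)

lemma hzero_space_hilbert_space:
  assumes "hilbert_space H"
  shows "hilbert_space (hzero_space H)"
proof -
  interpret hilbert_space H by fact
  have z: "hadd H (hzero H) (hzero H) = hzero H" by (simp add: add_zero zero_closed)
  have d: "hdist (hzero_space H) (hzero H) (hzero H) = 0"
    by (simp add: hdist_def norm_dist_def hzero_space_simps z scale_zero hnorm_zero)
  show ?thesis
  proof (rule hilbert_spaceI[of _ "{hzero H}"])
    show "complex_normed_space (hcarrier (hzero_space H)) (hzero (hzero_space H)) (hadd (hzero_space H))
        (hscale (hzero_space H)) (hnorm (hzero_space H))"
      by unfold_locales (simp_all add: hzero_space_simps z scale_zero hnorm_zero)
  qed (auto simp: hzero_space_simps z scale_zero hinner_zero zero_closed d intro!: exI[of _ 0])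
qed

text \<open>An arbitrary choice, made space by space; nothing relates the bases chosen in
  neighbouring fibres of a bundle.\<close>

definition hbasis :: "'k hspace \<Rightarrow> nat \<Rightarrow> 'k"
  where "hbasis K = (SOME e. (\<forall>n. e n \<in> hcarrier K \<and> (e n = hzero K \<or> hnorm K (e n) = 1)) \<and>
    (\<forall>m n. m \<noteq> n \<longrightarrow> hinner K (e m) (e n) = 0) \<and>
    (\<forall>w\<in>hcarrier K. (\<lambda>n. (cmod (hinner K (e n) w))\<^sup>2) sums (hnorm K w)\<^sup>2))"

lemma hbasis:
  assumes "hilbert_space K"
  shows "hbasis K n \<in> hcarrier K" "hbasis K n = hzero K \<or> hnorm K (hbasis K n) = 1"
    "m \<noteq> n \<Longrightarrow> hinner K (hbasis K m) (hbasis K n) = 0"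
    "w \<in> hcarrier K \<Longrightarrow> (\<lambda>n. (cmod (hinner K (hbasis K n) w))\<^sup>2) sums (hnorm K w)\<^sup>2"
proof -
  have "\<exists>e. (\<forall>n. e n \<in> hcarrier K \<and> (e n = hzero K \<or> hnorm K (e n) = 1)) \<and>
    (\<forall>m n. m \<noteq> n \<longrightarrow> hinner K (e m) (e n) = 0) \<and>
    (\<forall>w\<in>hcarrier K. (\<lambda>n. (cmod (hinner K (e n) w))\<^sup>2) sums (hnorm K w)\<^sup>2)"
    by (rule hilbert_space.ex_orthonormal_basis[OF assms]) blast
  from someI_ex[OF this, folded hbasis_def]
  show "hbasis K n \<in> hcarrier K" "hbasis K n = hzero K \<or> hnorm K (hbasis K n) = 1"
    "m \<noteq> n \<Longrightarrow> hinner K (hbasis K m) (hbasis K n) = 0"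
    "w \<in> hcarrier K \<Longrightarrow> (\<lambda>n. (cmod (hinner K (hbasis K n) w))\<^sup>2) sums (hnorm K w)\<^sup>2"
    by blast+
qed

text \<open>The tensor product is a Hilbert sum of copies of \<open>H\<close> indexed by an orthonormal basis of \<open>K\<close>;
  the summands at basis vectors 0 vanish.\<close>

definition htensor_summand :: "'h hspace \<Rightarrow> 'k hspace \<Rightarrow> nat \<Rightarrow> 'h hspace"
  where "htensor_summand H K n = (if hbasis K n = hzero K then hzero_space H else H)"

definition htensor :: "'h hspace \<Rightarrow> 'k hspace \<Rightarrow> (nat \<Rightarrow> 'h) hspace"
  where "htensor H K = hsum (htensor_summand H K)"

text \<open>Expanding \<open>w\<close> in the chosen basis identifies the tensor with the sequence
  of multiples of \<open>v\<close> by the coordinates of \<open>w\<close>. Linearity in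
  \<open>w\<close> holds because the inner product is linear in its second variable.\<close>

definition elementary_tensor :: "'h hspace \<Rightarrow> 'k hspace \<Rightarrow> 'h \<Rightarrow> 'k \<Rightarrow> nat \<Rightarrow> 'h"
  where "elementary_tensor H K v w n = hscale H (hinner K (hbasis K n) w) v"

locale hilbert_space_pair = H: hilbert_space H + K: hilbert_space K
  for H :: "'h hspace" and K :: "'k hspace"
begin

lemma summand_hilbert_space: "hilbert_space (htensor_summand H K n)"
  using hzero_space_hilbert_space[OF H.hilbert_space_axioms] H.hilbert_space_axioms
  by (simp add: htensor_summand_def)

sublocale S: hilbert_sequence "htensor_summand H K"
  by (rule hilbert_sequence.intro) (rule summand_hilbert_space)

lemma htensor_hilbert_space: "hilbert_space (htensor H K)"
  unfolding htensor_def by (rule S.hsum_hilbert_space)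

lemma summand_simps:
  "hzero (htensor_summand H K n) = hzero H"
  "hadd (htensor_summand H K n) = hadd H" "hscale (htensor_summand H K n) = hscale H"
  "hinner (htensor_summand H K n) = hinner H" "hnorm (htensor_summand H K n) = hnorm H"
  by (simp_all add: htensor_summand_def hzero_space_simps)

lemma elementary_tensor_component:
  assumes "v \<in> hcarrier H" "w \<in> hcarrier K"
  shows "elementary_tensor H K v w n \<in> hcarrier (htensor_summand H K n)"
  using assms
  by (simp add: elementary_tensor_def htensor_summand_def hzero_space_simps H.scale_closed
      K.hinner_zero_left H.scale_0)

lemma elementary_tensor_mem:
  assumes v: "v \<in> hcarrier H" and w: "w \<in> hcarrier K"
  shows "elementary_tensor H K v w \<in> hcarrier (htensor H K)"
proof -
  have "summable (\<lambda>n. (cmod (hinner K (hbasis K n) w))\<^sup>2 * (hnorm H v)\<^sup>2)"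
    by (intro summable_mult2 sums_summable[OF hbasis(4)[OF K.hilbert_space_axioms w]])
  then have "summable (\<lambda>n. (hnorm (htensor_summand H K n) (elementary_tensor H K v w n))\<^sup>2)"
    using v by (simp add: elementary_tensor_def summand_simps H.hnorm_scale power_mult_distrib)
  then show ?thesis
    using elementary_tensor_component[OF v w] unfolding htensor_def S.hsum_simps(1) by blast
qed

text \<open>Parseval in \<open>K\<close> sums the coordinates. The result is free of the basis,
  which is what permits bases to be chosen without continuity in the base point.\<close>

lemma hinner_elementary_tensor:
  assumes "v \<in> hcarrier H" "w \<in> hcarrier K" "v' \<in> hcarrier H" "w' \<in> hcarrier K"
  shows "hinner (htensor H K) (elementary_tensor H K v w) (elementary_tensor H K v' w')
    = hinner H v v' * hinner K w w'"
proof -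
  have "(\<lambda>n. cnj (hinner K (hbasis K n) w) * hinner K (hbasis K n) w') sums hinner K w w'"
    using hbasis[OF K.hilbert_space_axioms] assms by (intro K.parseval_hinner) auto
  then have "(\<lambda>n. hinner H v v' * (cnj (hinner K (hbasis K n) w) * hinner K (hbasis K n) w'))
      sums (hinner H v v' * hinner K w w')" by (rule sums_mult)
  moreover have "hinner H v v' * (cnj (hinner K (hbasis K n) w) * hinner K (hbasis K n) w') =
    hinner (htensor_summand H K n) (elementary_tensor H K v w n) (elementary_tensor H K v' w' n)" for n
    using assms
    by (simp add: elementary_tensor_def summand_simps H.hinner_scale H.hinner_scale_left H.scale_closed)
  ultimately show ?thesis
    unfolding htensor_def S.hsum_simps(5) by (simp add: sums_iff)
qed

lemma hnorm_elementary_tensor: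
  assumes "v \<in> hcarrier H" "w \<in> hcarrier K"
  shows "hnorm (htensor H K) (elementary_tensor H K v w) = hnorm H v * hnorm K w"
  using hinner_elementary_tensor[OF assms assms] H.Im_hinner[OF assms(1)]
  by (simp add: hnorm_def real_sqrt_mult)

lemma hlinear_elementary_tensor_left:
  assumes "w \<in> hcarrier K"
  shows "hlinear H (htensor H K) (\<lambda>v. elementary_tensor H K v w)"
  unfolding hlinear_def using elementary_tensor_mem assms
  by (auto simp: htensor_def S.hsum_simps(3,4) summand_simps elementary_tensor_def fun_eq_iff
      H.scale_add_right H.scale_scale mult.commute)

lemma hlinear_elementary_tensor_right:
  assumes "v \<in> hcarrier H"
  shows "hlinear K (htensor H K) (elementary_tensor H K v)"
  unfolding hlinear_def using elementary_tensor_mem assms hbasis(1)[OF K.hilbert_space_axioms]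
  by (auto simp: htensor_def S.hsum_simps(3,4) summand_simps elementary_tensor_def fun_eq_iff
      K.hinner_add K.hinner_scale H.scale_add_left H.scale_scale)

text \<open>Tensoring with a basis vector is the inclusion of the matching summand; at a zero basis
  vector that summand contains only 0, so the identity survives.\<close>

lemma elementary_tensor_basis:
  assumes v: "v \<in> hcarrier (htensor_summand H K n)"
  shows "elementary_tensor H K v (hbasis K n) = S.hsingle n v"
proof
  fix m
  note b = hbasis[OF K.hilbert_space_axioms]
  have vH: "v \<in> hcarrier H"
    using v by (auto simp: htensor_summand_def hzero_space_simps H.zero_closed split: if_splits)
  show "elementary_tensor H K v (hbasis K n) m = S.hsingle n v m"
  proof (cases "m = n")
    case True
    show ?thesis
    proof (cases "hbasis K n = hzero K")
      case True
      then have "v = hzero H" using v by (simp add: htensor_summand_def hzero_space_simps)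
      then show ?thesis
        using \<open>m = n\<close> by (simp add: elementary_tensor_def S.hsingle_def H.scale_zero)
    next
      case False
      then have "hnorm K (hbasis K n) = 1" using b(2) by blast
      then have "hinner K (hbasis K n) (hbasis K n) = 1" by (simp add: K.hinner_hnorm b(1))
      then show ?thesis
        using \<open>m = n\<close> vH by (simp add: elementary_tensor_def S.hsingle_def H.scale_one)
    qed
  next
    case False
    then show ?thesis
      using b(3) vH by (simp add: elementary_tensor_def S.hsingle_def H.scale_0 summand_simps)
  qed
qed

text \<open>One variable at a time: for fixed \<open>w\<close> in \<open>B\<close> the tensor is
  bounded and linear in \<open>v\<close>, so all of \<open>H\<close> is reached, and then the same
  holds in \<open>w\<close>. Basis vectors in the second slot yield every summand of the Hilbert
  sum.\<close>

lemma htotal_elementary_tensors: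
  assumes A: "htotal H A" and B: "htotal K B"
  shows "htotal (htensor H K) {elementary_tensor H K v w | v w. v \<in> A \<and> w \<in> B}"
proof -
  interpret T: hilbert_space "htensor H K" by (rule htensor_hilbert_space)
  let ?S = "{S.hsingle n v | n v. v \<in> hcarrier (htensor_summand H K n)}"
  let ?D = "{elementary_tensor H K v w | v w. v \<in> A \<and> w \<in> B}"
  have AH: "A \<subseteq> hcarrier H" "B \<subseteq> hcarrier K" using assms by (auto simp: htotal_def)
  have D: "?D \<subseteq> hcarrier (htensor H K)" using elementary_tensor_mem AH by auto
  have left: "elementary_tensor H K v w \<in> hclspan (htensor H K) ?D" if "v \<in> hcarrier H" "w \<in> B" for v w
  proof -
    have wK: "w \<in> hcarrier K" using that AH by blast
    show ?thesis
    proof (rule hclspan_map[OF H.hilbert_space_axioms htensor_hilbert_space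
          hlinear_elementary_tensor_left[OF wK] _ AH(1) D, where C = "hnorm K w"])
      show "hnorm (htensor H K) (elementary_tensor H K v w) \<le> hnorm K w * hnorm H v"
        if "v \<in> hcarrier H" for v
        using hnorm_elementary_tensor[OF that wK] by simp
      show "(\<lambda>v. elementary_tensor H K v w) ` A \<subseteq> hclspan (htensor H K) ?D"
        using T.hspan_subset_hclspan[OF D] that(2) by (auto intro: hspan.hspan_base)
      show "v \<in> hclspan H A" using A that(1) by (auto simp: htotal_def)
    qed
  qed
  have right: "elementary_tensor H K v w \<in> hclspan (htensor H K) ?D"
    if v: "v \<in> hcarrier H" and w: "w \<in> hcarrier K" for v w
  proof (rule hclspan_map[OF K.hilbert_space_axioms htensor_hilbert_space
        hlinear_elementary_tensor_right[OF v] _ AH(2) D, where C = "hnorm H v"])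
    show "hnorm (htensor H K) (elementary_tensor H K v w) \<le> hnorm H v * hnorm K w"
      if "w \<in> hcarrier K" for w
      using hnorm_elementary_tensor[OF v that] by simp
    show "elementary_tensor H K v ` B \<subseteq> hclspan (htensor H K) ?D"
      using left[OF v] by blast
    show "w \<in> hclspan K B" using B w by (auto simp: htotal_def)
  qed
  have "htotal (hsum (htensor_summand H K)) ?S"
  proof (rule S.htotal_hsum)
    show "htotal (htensor_summand H K n) (hcarrier (htensor_summand H K n))" for n
      by (rule hilbert_space.htotal_hcarrier) (rule summand_hilbert_space)
  qed
  then have "htotal (htensor H K) ?S" unfolding htensor_def .
  then show ?thesis
  proof (rule T.htotal_trans[OF _ _ D])
    show "?S \<subseteq> hclspan (htensor H K) ?D"
    proof
      fix f assume "f \<in> ?S"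
      then obtain n v where f: "f = S.hsingle n v" "v \<in> hcarrier (htensor_summand H K n)" by blast
      then have "v \<in> hcarrier H"
        by (auto simp: htensor_summand_def hzero_space_simps H.zero_closed split: if_splits)
      then show "f \<in> hclspan (htensor H K) ?D"
        unfolding f(1) elementary_tensor_basis[OF f(2), symmetric]
        using hbasis(1)[OF K.hilbert_space_axioms] by (rule right)
    qed
  qed
qed

end

section \<open>Bundles generated by a total family of sections\<close>

text \<open>The approximant may change with the point and with \<epsilon>, which matches how the
  sections of a generated bundle are approximated.\<close>

lemma continuous_on_local_uniform_limit:
  fixes f :: "'a::topological_space \<Rightarrow> 'b::metric_space"
  assumes "\<And>t \<epsilon>. \<lbrakk>t \<in> X; 0 < \<epsilon>\<rbrakk>
    \<Longrightarrow> \<exists>g U. continuous_on X g \<and> open U \<and> t \<in> U \<and> (\<forall>u\<in>U \<inter> X. dist (f u) (g u) \<le> \<epsilon>)"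
  shows "continuous_on X f"
  unfolding continuous_on_def
proof (intro ballI tendstoI)
  fix t and \<epsilon> :: real assume t: "t \<in> X" and "0 < \<epsilon>"
  then have "0 < \<epsilon> / 3" by simp
  from assms[OF t this] obtain g U where g: "continuous_on X g" "open U" "t \<in> U"
    "\<And>u. u \<in> U \<inter> X \<Longrightarrow> dist (f u) (g u) \<le> \<epsilon> / 3" by blast
  have "\<forall>\<^sub>F u in at t within X. dist (g u) (g t) < \<epsilon> / 3"
    using g(1) t \<open>0 < \<epsilon> / 3\<close> unfolding continuous_on_def by (blast intro: tendstoD)
  moreover have "\<forall>\<^sub>F u in at t within X. u \<in> U \<inter> X"
    using g(2,3) by (auto simp: eventually_at_topological)
  ultimately show "\<forall>\<^sub>F u in at t within X. dist (f u) (f t) < \<epsilon>"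
  proof eventually_elim
    case (elim u)
    have "dist (f u) (f t) \<le> dist (f u) (g u) + (dist (g u) (g t) + dist (f t) (g t))"
      by (metis add_mono_thms_linordered_semiring(2) dist_commute dist_triangle order_trans)
    then show ?case using elim g(4)[of u] g(4)[of t] g(3) t by simp
  qed
qed

text \<open>Serves twice: for inner products on the unit space, where both sections are evaluated at
  one point, and for coefficients on \<open>G\<close>, where they are evaluated at source and range.
  The induction runs over one argument at a time.\<close>

lemma hspan_sesquilinear_continuous:
  fixes B :: "'a \<Rightarrow> 'a \<Rightarrow> 'y::topological_space \<Rightarrow> complex"
  assumes zero: "\<And>\<eta> y. \<lbrakk>\<eta> \<in> hspan A S; y \<in> Y\<rbrakk> \<Longrightarrow> B (hzero A) \<eta> y = 0"
      "\<And>\<xi> y. \<lbrakk>\<xi> \<in> hspan A S; y \<in> Y\<rbrakk> \<Longrightarrow> B \<xi> (hzero A) y = 0"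
    and add: "\<And>\<xi> \<xi>' \<eta> y. \<lbrakk>\<xi> \<in> hspan A S; \<xi>' \<in> hspan A S; \<eta> \<in> hspan A S; y \<in> Y\<rbrakk>
        \<Longrightarrow> B (hadd A \<xi> \<xi>') \<eta> y = B \<xi> \<eta> y + B \<xi>' \<eta> y"
      "\<And>\<xi> \<eta> \<eta>' y. \<lbrakk>\<xi> \<in> hspan A S; \<eta> \<in> hspan A S; \<eta>' \<in> hspan A S; y \<in> Y\<rbrakk>
        \<Longrightarrow> B \<xi> (hadd A \<eta> \<eta>') y = B \<xi> \<eta> y + B \<xi> \<eta>' y"
    and scale: "\<And>c \<xi> \<eta> y. \<lbrakk>\<xi> \<in> hspan A S; \<eta> \<in> hspan A S; y \<in> Y\<rbrakk>
        \<Longrightarrow> B (hscale A c \<xi>) \<eta> y = cnj c * B \<xi> \<eta> y"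
      "\<And>c \<xi> \<eta> y. \<lbrakk>\<xi> \<in> hspan A S; \<eta> \<in> hspan A S; y \<in> Y\<rbrakk>
        \<Longrightarrow> B \<xi> (hscale A c \<eta>) y = c * B \<xi> \<eta> y"
    and base: "\<And>\<xi> \<eta>. \<lbrakk>\<xi> \<in> S; \<eta> \<in> S\<rbrakk> \<Longrightarrow> continuous_on Y (B \<xi> \<eta>)"
    and \<xi>: "\<xi> \<in> hspan A S" and \<eta>: "\<eta> \<in> hspan A S"
  shows "continuous_on Y (B \<xi> \<eta>)"
proof -
  have 1: "continuous_on Y (B \<xi> \<eta>)" if \<xi>: "\<xi> \<in> S" for \<xi>
    using \<eta>
  proof induction
    case hspan_zero
    show ?case using zero(2)[OF hspan.hspan_base[OF \<xi>]] by (simp cong: continuous_on_cong)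
  next
    case (hspan_base \<eta>)
    then show ?case using \<xi> by (intro base)
  next
    case (hspan_add \<eta> \<eta>')
    have "continuous_on Y (\<lambda>y. B \<xi> \<eta> y + B \<xi> \<eta>' y)"
      using hspan_add by (intro continuous_intros)
    then show ?case
      using add(2)[OF hspan.hspan_base[OF \<xi>] hspan_add(1,2)] by (simp cong: continuous_on_cong)
  next
    case (hspan_scale \<eta> c)
    have "continuous_on Y (\<lambda>y. c * B \<xi> \<eta> y)"
      using hspan_scale by (intro continuous_intros)
    then show ?case
      using scale(2)[OF hspan.hspan_base[OF \<xi>] hspan_scale(1)] by (simp cong: continuous_on_cong)
  qed
  show ?thesis
    using \<xi>
  proof induction
    case hspan_zero
    show ?case using zero(1)[OF \<eta>] by (simp cong: continuous_on_cong)
  next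
    case (hspan_base \<xi>)
    then show ?case by (rule 1)
  next
    case (hspan_add \<xi> \<xi>')
    have "continuous_on Y (\<lambda>y. B \<xi> \<eta> y + B \<xi>' \<eta> y)"
      using hspan_add by (intro continuous_intros)
    then show ?case
      using add(1)[OF hspan_add(1,2) \<eta>] by (simp cong: continuous_on_cong)
  next
    case (hspan_scale \<xi> c)
    have "continuous_on Y (\<lambda>y. cnj c * B \<xi> \<eta> y)"
      using hspan_scale by (intro continuous_intros)
    then show ?case
      using scale(1)[OF hspan_scale(1) \<eta>] by (simp cong: continuous_on_cong)
  qed
qed

text \<open>Packages the pointwise operations so that \<open>hspan\<close> applies to sections.
  \<open>hinner\<close> is left undefined because sections carry no natural scalar-valued inner
  product.\<close>

definition section_space :: "'b set \<Rightarrow> ('b \<Rightarrow> 'h hspace) \<Rightarrow> ('b \<Rightarrow> 'h) hspace"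
  where "section_space X H = \<lparr>hcarrier = (\<Pi>\<^sub>E u\<in>X. hcarrier (H u)), hzero = (\<lambda>u\<in>X. hzero (H u)),
    hadd = (\<lambda>\<xi> \<eta>. \<lambda>u\<in>X. hadd (H u) (\<xi> u) (\<eta> u)), hscale = (\<lambda>c \<xi>. \<lambda>u\<in>X. hscale (H u) c (\<xi> u)),
    hinner = undefined\<rparr>"

lemma section_space_simps:
  "hzero (section_space X H) = (\<lambda>u\<in>X. hzero (H u))"
  "hadd (section_space X H) \<xi> \<eta> = (\<lambda>u\<in>X. hadd (H u) (\<xi> u) (\<eta> u))"
  "hscale (section_space X H) c \<xi> = (\<lambda>u\<in>X. hscale (H u) c (\<xi> u))"
  by (simp_all add: section_space_def)

text \<open>The usual continuous field determined by a total family: closing the span under locally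
  uniform approximation builds in the locality axiom.\<close>

definition generated_bundle ::
  "'b::topological_space set \<Rightarrow> ('b \<Rightarrow> 'h hspace) \<Rightarrow> ('b \<Rightarrow> 'h) set \<Rightarrow> ('b, 'h) hilbert_bundle"
  where "generated_bundle X H \<Lambda> = \<lparr>fibre = H,
    sections = {\<xi> \<in> (\<Pi>\<^sub>E u\<in>X. hcarrier (H u)). \<forall>t\<in>X. \<forall>\<epsilon>>0. \<exists>\<xi>'\<in>hspan (section_space X H) \<Lambda>.
      \<exists>U. open U \<and> t \<in> U \<and> (\<forall>u\<in>U \<inter> X. hdist (H u) (\<xi> u) (\<xi>' u) \<le> \<epsilon>)}\<rparr>"

lemma fibre_generated_bundle: "fibre (generated_bundle X H \<Lambda>) = H"
  by (simp add: generated_bundle_def)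

lemma generated_sectionI:
  assumes "\<xi> \<in> (\<Pi>\<^sub>E u\<in>X. hcarrier (H u))"
    and "\<And>t \<epsilon>. \<lbrakk>t \<in> X; 0 < \<epsilon>\<rbrakk> \<Longrightarrow> \<exists>\<xi>'\<in>hspan (section_space X H) \<Lambda>.
      \<exists>U. open U \<and> t \<in> U \<and> (\<forall>u\<in>U \<inter> X. hdist (H u) (\<xi> u) (\<xi>' u) \<le> \<epsilon>)"
  shows "\<xi> \<in> sections (generated_bundle X H \<Lambda>)"
  using assms by (simp add: generated_bundle_def)

lemma generated_sectionE:
  assumes "\<xi> \<in> sections (generated_bundle X H \<Lambda>)" "t \<in> X" "0 < \<epsilon>"
  obtains \<xi>' U where "\<xi>' \<in> hspan (section_space X H) \<Lambda>" "open U" "t \<in> U"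
    "\<And>u. u \<in> U \<Longrightarrow> u \<in> X \<Longrightarrow> hdist (H u) (\<xi> u) (\<xi>' u) \<le> \<epsilon>"
proof -
  have "\<exists>\<xi>'\<in>hspan (section_space X H) \<Lambda>.
      \<exists>U. open U \<and> t \<in> U \<and> (\<forall>u\<in>U \<inter> X. hdist (H u) (\<xi> u) (\<xi>' u) \<le> \<epsilon>)"
    using assms by (simp add: generated_bundle_def)
  then show ?thesis using that by blast
qed

text \<open>Continuity is asked for inner products of pairs of generators rather than for norms of
  their linear combinations; it passes to the span by sesquilinearity and is easy to check on the
  generators used later.\<close>

locale generating_sections =
  fixes X :: "'b::topological_space set" and H :: "'b \<Rightarrow> 'h hspace" and \<Lambda> :: "('b \<Rightarrow> 'h) set"
  assumes fib: "u \<in> X \<Longrightarrow> hilbert_space (H u)"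
    and gen_subset: "\<Lambda> \<subseteq> (\<Pi>\<^sub>E u\<in>X. hcarrier (H u))"
    and gen_continuous: "\<lbrakk>\<xi> \<in> \<Lambda>; \<eta> \<in> \<Lambda>\<rbrakk> \<Longrightarrow> continuous_on X (\<lambda>u. hinner (H u) (\<xi> u) (\<eta> u))"
    and gen_total: "u \<in> X \<Longrightarrow> htotal (H u) ((\<lambda>\<xi>. \<xi> u) ` \<Lambda>)"
begin

abbreviation "span_sections \<equiv> hspan (section_space X H) \<Lambda>"
abbreviation "gen_sections \<equiv> sections (generated_bundle X H \<Lambda>)"

lemma span_subset: "\<xi> \<in> span_sections \<Longrightarrow> \<xi> \<in> (\<Pi>\<^sub>E u\<in>X. hcarrier (H u))"
proof (induction rule: hspan.induct)
  case hspan_zero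
  then show ?case
    by (auto simp: section_space_simps intro!: complex_vector_space.zero_closed[OF hilbert_space.axioms(1)[OF fib]])
next
  case (hspan_base \<xi>)
  then show ?case using gen_subset by blast
next
  case (hspan_add \<xi> \<eta>)
  then show ?case
    by (auto simp: section_space_simps intro!: complex_vector_space.add_closed[OF hilbert_space.axioms(1)[OF fib]])
next
  case (hspan_scale \<xi> c)
  then show ?case
    by (auto simp: section_space_simps intro!: complex_vector_space.scale_closed[OF hilbert_space.axioms(1)[OF fib]])
qed

lemma span_mem: "\<lbrakk>\<xi> \<in> span_sections; u \<in> X\<rbrakk> \<Longrightarrow> \<xi> u \<in> hcarrier (H u)"
  using span_subset by (auto simp: PiE_iff)

lemma sections_mem: "\<lbrakk>\<xi> \<in> gen_sections; u \<in> X\<rbrakk> \<Longrightarrow> \<xi> u \<in> hcarrier (H u)"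
  by (auto simp: generated_bundle_def PiE_iff)

lemma span_continuous:
  assumes "\<xi> \<in> span_sections" "\<eta> \<in> span_sections"
  shows "continuous_on X (\<lambda>u. hinner (H u) (\<xi> u) (\<eta> u))"
proof (rule hspan_sesquilinear_continuous[OF _ _ _ _ _ _ _ assms])
  fix \<xi> u assume a: "\<xi> \<in> span_sections" "u \<in> X"
  interpret hilbert_space "H u" by (rule fib[OF a(2)])
  show "hinner (H u) (hzero (section_space X H) u) (\<xi> u) = 0"
    "hinner (H u) (\<xi> u) (hzero (section_space X H) u) = 0"
    using a by (simp_all add: section_space_simps hinner_zero hinner_zero_left span_mem)
next
  fix \<xi> \<eta> \<zeta> u assume a: "\<xi> \<in> span_sections" "\<eta> \<in> span_sections" "\<zeta> \<in> span_sections" "u \<in> X"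
  interpret hilbert_space "H u" by (rule fib[OF a(4)])
  show "hinner (H u) (hadd (section_space X H) \<xi> \<eta> u) (\<zeta> u) = hinner (H u) (\<xi> u) (\<zeta> u) + hinner (H u) (\<eta> u) (\<zeta> u)"
    "hinner (H u) (\<xi> u) (hadd (section_space X H) \<eta> \<zeta> u) = hinner (H u) (\<xi> u) (\<eta> u) + hinner (H u) (\<xi> u) (\<zeta> u)"
    using a by (simp_all add: section_space_simps hinner_add hinner_add_left span_mem)
next
  fix c \<xi> \<eta> u assume a: "\<xi> \<in> span_sections" "\<eta> \<in> span_sections" "u \<in> X"
  interpret hilbert_space "H u" by (rule fib[OF a(3)])
  show "hinner (H u) (hscale (section_space X H) c \<xi> u) (\<eta> u) = cnj c * hinner (H u) (\<xi> u) (\<eta> u)"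
    "hinner (H u) (\<xi> u) (hscale (section_space X H) c \<eta> u) = c * hinner (H u) (\<xi> u) (\<eta> u)"
    using a by (simp_all add: section_space_simps hinner_scale hinner_scale_left span_mem)
qed (rule gen_continuous)

lemma span_subset_sections: "span_sections \<subseteq> gen_sections"
proof
  fix \<xi> assume \<xi>: "\<xi> \<in> span_sections"
  show "\<xi> \<in> gen_sections"
  proof (rule generated_sectionI[OF span_subset[OF \<xi>]])
    fix t and \<epsilon> :: real assume "t \<in> X" "0 < \<epsilon>"
    have "hdist (H u) (\<xi> u) (\<xi> u) \<le> \<epsilon>" if "u \<in> X" for u
    proof -
      interpret hilbert_space "H u" by (rule fib[OF that])
      show ?thesis using span_mem[OF \<xi> that] \<open>0 < \<epsilon>\<close> by simp
    qed
    then show "\<exists>\<xi>'\<in>span_sections. \<exists>U. open U \<and> t \<in> U \<and> (\<forall>u\<in>U \<inter> X. hdist (H u) (\<xi> u) (\<xi>' u) \<le> \<epsilon>)"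
      using \<xi> by (intro bexI[OF _ \<xi>] exI[of _ UNIV]) auto
  qed
qed

lemma span_values: "u \<in> X \<Longrightarrow> (\<lambda>\<xi>. \<xi> u) ` span_sections = hspan (H u) ((\<lambda>\<xi>. \<xi> u) ` \<Lambda>)"
  by (rule hspan_image) (simp_all add: section_space_simps)

text \<open>Each axiom passes from the span to locally uniform limits. The norm function is locally
  a uniform limit of continuous ones because the norm is 1-Lipschitz, and locality holds since an
  approximant of an approximant is again an approximant.\<close>

lemma generated_bundle_continuous: "continuous_hilbert_bundle X (generated_bundle X H \<Lambda>)"
proof (rule continuous_hilbert_bundle.intro)
  show "hilbert_space (fibre (generated_bundle X H \<Lambda>) u)" if "u \<in> X" for u
    unfolding fibre_generated_bundle by (rule fib[OF that])
  show "gen_sections \<subseteq> (\<Pi>\<^sub>E u\<in>X. hcarrier (fibre (generated_bundle X H \<Lambda>) u))"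
    by (auto simp: generated_bundle_def)
  have "(\<lambda>u\<in>X. hzero (H u)) \<in> span_sections"
    using hspan.hspan_zero[of "section_space X H"] by (simp add: section_space_simps)
  then show "(\<lambda>u\<in>X. hzero (fibre (generated_bundle X H \<Lambda>) u)) \<in> gen_sections"
    unfolding fibre_generated_bundle using span_subset_sections by blast
next
  fix \<xi> \<eta> assume \<xi>: "\<xi> \<in> gen_sections" and \<eta>: "\<eta> \<in> gen_sections"
  show "(\<lambda>u\<in>X. hadd (fibre (generated_bundle X H \<Lambda>) u) (\<xi> u) (\<eta> u)) \<in> gen_sections"
    unfolding fibre_generated_bundle
  proof (rule generated_sectionI)
    show "(\<lambda>u\<in>X. hadd (H u) (\<xi> u) (\<eta> u)) \<in> (\<Pi>\<^sub>E u\<in>X. hcarrier (H u))"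
      using sections_mem[OF \<xi>] sections_mem[OF \<eta>]
      by (auto intro!: complex_vector_space.add_closed[OF hilbert_space.axioms(1)[OF fib]])
    fix t and \<epsilon> :: real assume t: "t \<in> X" and "0 < \<epsilon>"
    then have e: "0 < \<epsilon> / 2" by simp
    obtain \<xi>' U where U: "\<xi>' \<in> span_sections" "open U" "t \<in> U"
      "\<And>u. u \<in> U \<Longrightarrow> u \<in> X \<Longrightarrow> hdist (H u) (\<xi> u) (\<xi>' u) \<le> \<epsilon> / 2"
      using generated_sectionE[OF \<xi> t e] by metis
    obtain \<eta>' V where V: "\<eta>' \<in> span_sections" "open V" "t \<in> V"
      "\<And>u. u \<in> V \<Longrightarrow> u \<in> X \<Longrightarrow> hdist (H u) (\<eta> u) (\<eta>' u) \<le> \<epsilon> / 2"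
      using generated_sectionE[OF \<eta> t e] by metis
    have "hdist (H u) ((\<lambda>u\<in>X. hadd (H u) (\<xi> u) (\<eta> u)) u) (hadd (section_space X H) \<xi>' \<eta>' u) \<le> \<epsilon>"
      if "u \<in> U \<inter> V \<inter> X" for u
    proof -
      have u: "u \<in> X" "u \<in> U" "u \<in> V" using that by auto
      interpret hilbert_space "H u" by (rule fib[OF u(1)])
      show ?thesis
        using hdist_add_le[OF sections_mem[OF \<xi> u(1)] sections_mem[OF \<eta> u(1)]
          span_mem[OF U(1) u(1)] span_mem[OF V(1) u(1)]] U(4)[OF u(2,1)] V(4)[OF u(3,1)] u(1)
        by (simp add: section_space_simps)
    qed
    then show "\<exists>\<zeta>\<in>span_sections. \<exists>U. open U \<and> t \<in> U \<and>
        (\<forall>u\<in>U \<inter> X. hdist (H u) ((\<lambda>u\<in>X. hadd (H u) (\<xi> u) (\<eta> u)) u) (\<zeta> u) \<le> \<epsilon>)"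
      using U V by (intro bexI[OF _ hspan.hspan_add[OF U(1) V(1)]] exI[of _ "U \<inter> V"]) auto
  qed
next
  fix \<xi> c assume \<xi>: "\<xi> \<in> gen_sections"
  show "(\<lambda>u\<in>X. hscale (fibre (generated_bundle X H \<Lambda>) u) c (\<xi> u)) \<in> gen_sections"
    unfolding fibre_generated_bundle
  proof (rule generated_sectionI)
    show "(\<lambda>u\<in>X. hscale (H u) c (\<xi> u)) \<in> (\<Pi>\<^sub>E u\<in>X. hcarrier (H u))"
      using sections_mem[OF \<xi>]
      by (auto intro!: complex_vector_space.scale_closed[OF hilbert_space.axioms(1)[OF fib]])
    fix t and \<epsilon> :: real assume t: "t \<in> X" and "0 < \<epsilon>"
    then have e: "0 < \<epsilon> / (cmod c + 1)" by (simp add: add_nonneg_pos)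
    obtain \<xi>' U where U: "\<xi>' \<in> span_sections" "open U" "t \<in> U"
      "\<And>u. u \<in> U \<Longrightarrow> u \<in> X \<Longrightarrow> hdist (H u) (\<xi> u) (\<xi>' u) \<le> \<epsilon> / (cmod c + 1)"
      using generated_sectionE[OF \<xi> t e] by metis
    have "hdist (H u) ((\<lambda>u\<in>X. hscale (H u) c (\<xi> u)) u) (hscale (section_space X H) c \<xi>' u) \<le> \<epsilon>"
      if "u \<in> U \<inter> X" for u
    proof -
      have u: "u \<in> X" "u \<in> U" using that by auto
      interpret hilbert_space "H u" by (rule fib[OF u(1)])
      have "cmod c * hdist (H u) (\<xi> u) (\<xi>' u) \<le> cmod c * (\<epsilon> / (cmod c + 1))"
        using U(4)[OF u(2,1)] by (intro mult_left_mono) auto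
      also have "\<dots> = \<epsilon> * (cmod c / (cmod c + 1))" by simp
      also have "\<dots> \<le> \<epsilon> * 1"
        using \<open>0 < \<epsilon>\<close> by (intro mult_left_mono) (auto simp: divide_le_eq_1 add_nonneg_pos)
      finally show ?thesis
        using hdist_scale[OF sections_mem[OF \<xi> u(1)] span_mem[OF U(1) u(1)], of c] u(1)
        by (simp add: section_space_simps)
    qed
    then show "\<exists>\<zeta>\<in>span_sections. \<exists>U. open U \<and> t \<in> U \<and>
        (\<forall>u\<in>U \<inter> X. hdist (H u) ((\<lambda>u\<in>X. hscale (H u) c (\<xi> u)) u) (\<zeta> u) \<le> \<epsilon>)"
      using U by (intro bexI[OF _ hspan.hspan_scale[OF U(1), of c]] exI[of _ U]) auto
  qed
next
  fix u assume u: "u \<in> X"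
  interpret hilbert_space "H u" by (rule fib[OF u])
  have "\<exists>w\<in>(\<lambda>\<xi>. \<xi> u) ` gen_sections. hdist (H u) v w < r"
    if v: "v \<in> hcarrier (H u)" and r: "0 < r" for v r
  proof -
    obtain w where "w \<in> hspan (H u) ((\<lambda>\<xi>. \<xi> u) ` \<Lambda>)" "hdist (H u) v w < r"
      using htotalD[OF gen_total[OF u] v r] by blast
    then show ?thesis
      unfolding span_values[OF u, symmetric] using span_subset_sections by blast
  qed
  moreover have "(\<lambda>\<xi>. \<xi> u) ` gen_sections \<subseteq> hcarrier (H u)" using sections_mem u by blast
  ultimately show "htopology (fibre (generated_bundle X H \<Lambda>) u) closure_of ((\<lambda>\<xi>. \<xi> u) ` gen_sections)
      = hcarrier (fibre (generated_bundle X H \<Lambda>) u)"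
    unfolding fibre_generated_bundle htopology_def hmetric.metric_closure_of
    by (auto simp: hmetric.in_mball) blast
next
  fix \<xi> assume \<xi>: "\<xi> \<in> gen_sections"
  show "continuous_on X (\<lambda>u. hnorm (fibre (generated_bundle X H \<Lambda>) u) (\<xi> u))"
    unfolding fibre_generated_bundle
  proof (rule continuous_on_local_uniform_limit)
    fix t and \<epsilon> :: real assume t: "t \<in> X" and e: "0 < \<epsilon>"
    obtain \<xi>' U where U: "\<xi>' \<in> span_sections" "open U" "t \<in> U"
      "\<And>u. u \<in> U \<Longrightarrow> u \<in> X \<Longrightarrow> hdist (H u) (\<xi> u) (\<xi>' u) \<le> \<epsilon>"
      using generated_sectionE[OF \<xi> t e] by metis
    have "continuous_on X (\<lambda>u. hnorm (H u) (\<xi>' u))"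
      unfolding hnorm_def by (intro continuous_intros span_continuous U)
    moreover have "dist (hnorm (H u) (\<xi> u)) (hnorm (H u) (\<xi>' u)) \<le> \<epsilon>" if "u \<in> U \<inter> X" for u
    proof -
      have u: "u \<in> X" "u \<in> U" using that by auto
      interpret hilbert_space "H u" by (rule fib[OF u(1)])
      show ?thesis
        using hnorm_diff_le_hdist[OF sections_mem[OF \<xi> u(1)] span_mem[OF U(1) u(1)]] U(4)[OF u(2,1)]
        by (simp add: dist_real_def)
    qed
    ultimately show "\<exists>g U. continuous_on X g \<and> open U \<and> t \<in> U \<and>
        (\<forall>u\<in>U \<inter> X. dist (hnorm (H u) (\<xi> u)) (g u) \<le> \<epsilon>)"
      using U by blast
  qed
next
  fix \<xi> assume \<xi>: "\<xi> \<in> (\<Pi>\<^sub>E u\<in>X. hcarrier (fibre (generated_bundle X H \<Lambda>) u))"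
    and loc: "\<And>t \<epsilon>. \<lbrakk>t \<in> X; 0 < \<epsilon>\<rbrakk> \<Longrightarrow> \<exists>\<xi>'\<in>gen_sections. \<exists>U. open U \<and> t \<in> U \<and>
      (\<forall>u\<in>U \<inter> X. hdist (fibre (generated_bundle X H \<Lambda>) u) (\<xi> u) (\<xi>' u) \<le> \<epsilon>)"
  show "\<xi> \<in> gen_sections"
  proof (rule generated_sectionI)
    show "\<xi> \<in> (\<Pi>\<^sub>E u\<in>X. hcarrier (H u))" using \<xi> unfolding fibre_generated_bundle .
    fix t and \<epsilon> :: real assume t: "t \<in> X" and "0 < \<epsilon>"
    then have e: "0 < \<epsilon> / 2" by simp
    obtain \<eta> U where U: "\<eta> \<in> gen_sections" "open U" "t \<in> U"
      "\<And>u. u \<in> U \<inter> X \<Longrightarrow> hdist (H u) (\<xi> u) (\<eta> u) \<le> \<epsilon> / 2"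
      using loc[OF t e] unfolding fibre_generated_bundle by blast
    obtain \<zeta> V where V: "\<zeta> \<in> span_sections" "open V" "t \<in> V"
      "\<And>u. u \<in> V \<Longrightarrow> u \<in> X \<Longrightarrow> hdist (H u) (\<eta> u) (\<zeta> u) \<le> \<epsilon> / 2"
      using generated_sectionE[OF U(1) t e] by metis
    have "hdist (H u) (\<xi> u) (\<zeta> u) \<le> \<epsilon>" if "u \<in> U \<inter> V \<inter> X" for u
    proof -
      have u: "u \<in> X" "u \<in> U \<inter> X" "u \<in> V" using that by auto
      interpret hilbert_space "H u" by (rule fib[OF u(1)])
      have "\<xi> u \<in> hcarrier (H u)" using \<xi> u(1) by (auto simp: fibre_generated_bundle)
      from hdist_triangle[OF this sections_mem[OF U(1) u(1)] span_mem[OF V(1) u(1)]]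
      show ?thesis using U(4)[OF u(2)] V(4)[OF u(3,1)] by simp
    qed
    then show "\<exists>\<zeta>\<in>span_sections. \<exists>U. open U \<and> t \<in> U \<and> (\<forall>u\<in>U \<inter> X. hdist (H u) (\<xi> u) (\<zeta> u) \<le> \<epsilon>)"
      using U V by (intro bexI[OF _ V(1)] exI[of _ "U \<inter> V"]) auto
  qed
qed

end

lemma hnorm_le_section_norm:
  assumes "\<xi> \<in> bounded_sections X E" "u \<in> X"
  shows "hnorm (fibre E u) (\<xi> u) \<le> section_norm X E \<xi>"
  using assms unfolding section_norm_def bounded_sections_def by (auto intro: cSUP_upper)

text \<open>The mixed form, with \<open>b\<close> in one term and \<open>a'\<close> in the other,
  comes from changing one variable at a time; just one approximant then needs a norm bound.\<close>

lemma (in hilbert_space) cmod_hinner_diff_le: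
  assumes a: "a \<in> hcarrier H" "a' \<in> hcarrier H" and b: "b \<in> hcarrier H" "b' \<in> hcarrier H"
  shows "cmod (hinner H a b - hinner H a' b') \<le> hdist H a a' * hnorm H b + hnorm H a' * hdist H b b'"
proof -
  have "hinner H a b - hinner H a' b' = hinner H (minus_on a a') b + hinner H a' (minus_on b b')"
    using a b by (simp add: hinner_minus)
  then have "cmod (hinner H a b - hinner H a' b')
      \<le> cmod (hinner H (minus_on a a') b) + cmod (hinner H a' (minus_on b b'))"
    by (simp add: norm_triangle_ineq)
  also have "\<dots> \<le> hnorm H (minus_on a a') * hnorm H b + hnorm H a' * hnorm H (minus_on b b')"
    using a b by (intro add_mono cmod_hinner_le minus_closed)
  finally show ?thesis using a b by (simp add: hdist_in)
qed

text \<open>The pairs of an element and its inverse, in either order, are composable and depend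
  continuously on the element; multiplication is continuous on composable pairs.\<close>

lemma continuous_range_source_map:
  assumes "topological_groupoid G"
  shows "continuous_on UNIV (range_map G)" "continuous_on UNIV (source_map G)"
proof -
  interpret topological_groupoid G by fact
  have "(ginv G x, x) \<in> composable G" for x using inv_composable[of "ginv G x"] inv_inv by simp
  then have c: "continuous_on UNIV (\<lambda>x. (\<lambda>(x, y). gmult G x y) (x, ginv G x))"
    "continuous_on UNIV (\<lambda>x. (\<lambda>(x, y). gmult G x y) (ginv G x, x))"
    using inv_composable
    by (intro continuous_on_compose2[OF continuous_mult] continuous_on_Pair continuous_inv
        continuous_on_id; auto)+
  show "continuous_on UNIV (range_map G)" "continuous_on UNIV (source_map G)"
    using c by (simp_all add: range_map_def[abs_def] source_map_def[abs_def])
qed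

section \<open>Generated bundles with an action of the groupoid\<close>

context topological_groupoid
begin

abbreviation "X \<equiv> unit_space G"
abbreviation "src \<equiv> source_map G"
abbreviation "rng \<equiv> range_map G"

lemma units: "src x \<in> X" "rng x \<in> X"
  by (rule source_map_in_unit_space[OF topological_groupoid_axioms], simp add: unit_space_def)

end

text \<open>The action is algebraic and given fibre by fibre; its only topological condition
  concerns coefficients of generators.\<close>

locale generating_G_sections = topological_groupoid G + generating_sections "unit_space G" H \<Lambda>
  for G :: "'g::topological_space groupoid" and H :: "'g \<Rightarrow> 'h hspace" and \<Lambda> :: "('g \<Rightarrow> 'h) set" +
  fixes L :: "'g \<Rightarrow> 'h \<Rightarrow> 'h"
  assumes isometry: "linear_isometry_onto (H (source_map G x)) (H (range_map G x)) (L x)"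
    and mult: "\<lbrakk>(x, y) \<in> composable G; v \<in> hcarrier (H (source_map G y))\<rbrakk>
      \<Longrightarrow> L (gmult G x y) v = L x (L y v)"
    and coeff: "\<lbrakk>\<xi> \<in> \<Lambda>; \<eta> \<in> \<Lambda>\<rbrakk> \<Longrightarrow> continuous_on UNIV
      (\<lambda>x. hinner (H (range_map G x)) (L x (\<xi> (source_map G x))) (\<eta> (range_map G x)))"
begin

lemma fibs: "hilbert_space (H (src x))" "hilbert_space (H (rng x))"
  by (auto intro: fib units)

lemma L_mem: "v \<in> hcarrier (H (src x)) \<Longrightarrow> L x v \<in> hcarrier (H (rng x))"
  using isometry[of x] by (auto simp: linear_isometry_onto_def)

lemma span_coefficient_continuous:
  assumes "\<xi> \<in> span_sections" "\<eta> \<in> span_sections"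
  shows "continuous_on UNIV (coefficient G (generated_bundle X H \<Lambda>) L \<xi> \<eta>)"
  unfolding coefficient_def[abs_def] fibre_generated_bundle
proof (rule hspan_sesquilinear_continuous[OF _ _ _ _ _ _ _ assms])
  fix \<xi> x assume a: "\<xi> \<in> span_sections"
  interpret R: hilbert_space "H (rng x)" by (rule fibs)
  note z = hlinear_zero[OF fibs linear_isometry_onto_hlinear[OF isometry]]
  show "hinner (H (rng x)) (L x (hzero (section_space X H) (src x))) (\<xi> (rng x)) = 0"
    "hinner (H (rng x)) (L x (\<xi> (src x))) (hzero (section_space X H) (rng x)) = 0"
    using a by (simp_all add: section_space_simps R.hinner_zero R.hinner_zero_left span_mem units z L_mem)
next
  note L = hlinearD[OF linear_isometry_onto_hlinear[OF isometry]]
  fix \<xi> \<eta> \<zeta> x assume a: "\<xi> \<in> span_sections" "\<eta> \<in> span_sections" "\<zeta> \<in> span_sections"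
  interpret R: hilbert_space "H (rng x)" by (rule fibs)
  show "hinner (H (rng x)) (L x (hadd (section_space X H) \<xi> \<eta> (src x))) (\<zeta> (rng x))
      = hinner (H (rng x)) (L x (\<xi> (src x))) (\<zeta> (rng x))
      + hinner (H (rng x)) (L x (\<eta> (src x))) (\<zeta> (rng x))"
    "hinner (H (rng x)) (L x (\<xi> (src x))) (hadd (section_space X H) \<eta> \<zeta> (rng x))
      = hinner (H (rng x)) (L x (\<xi> (src x))) (\<eta> (rng x))
      + hinner (H (rng x)) (L x (\<xi> (src x))) (\<zeta> (rng x))"
    using a by (simp_all add: section_space_simps R.hinner_add R.hinner_add_left span_mem units L L_mem)
next
  note L = hlinearD[OF linear_isometry_onto_hlinear[OF isometry]]
  fix c \<xi> \<eta> x assume a: "\<xi> \<in> span_sections" "\<eta> \<in> span_sections"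
  interpret R: hilbert_space "H (rng x)" by (rule fibs)
  show "hinner (H (rng x)) (L x (hscale (section_space X H) c \<xi> (src x))) (\<eta> (rng x))
      = cnj c * hinner (H (rng x)) (L x (\<xi> (src x))) (\<eta> (rng x))"
    "hinner (H (rng x)) (L x (\<xi> (src x))) (hscale (section_space X H) c \<eta> (rng x))
      = c * hinner (H (rng x)) (L x (\<xi> (src x))) (\<eta> (rng x))"
    using a by (simp_all add: section_space_simps R.hinner_scale R.hinner_scale_left span_mem units L L_mem)
qed (rule coeff)

text \<open>Near \<open>x0\<close> a coefficient is compared with one of span sections that
  approximate the first section near the source of \<open>x0\<close> and the second near its range.
  Boundedness of the sections turns these errors into a uniform error of the product.\<close>

lemma generated_G_hilbert_bundle: "G_hilbert_bundle G (generated_bundle X H \<Lambda>) L"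
proof (intro G_hilbert_bundle.intro G_hilbert_bundle_axioms.intro generated_bundle_continuous)
  let ?E = "generated_bundle X H \<Lambda>"
  show "linear_isometry_onto (fibre ?E (src x)) (fibre ?E (rng x)) (L x)" for x
    unfolding fibre_generated_bundle by (rule isometry)
  show "L (gmult G x y) v = L x (L y v)"
    if "(x, y) \<in> composable G" "v \<in> hcarrier (fibre ?E (src y))" for x y v
    using mult that unfolding fibre_generated_bundle by blast
  fix \<xi> \<eta> assume b: "\<xi> \<in> bounded_sections X ?E" "\<eta> \<in> bounded_sections X ?E"
  then have \<xi>: "\<xi> \<in> gen_sections" and \<eta>: "\<eta> \<in> gen_sections" by (auto simp: bounded_sections_def)
  define M where "M = \<bar>section_norm X ?E \<xi>\<bar> + \<bar>section_norm X ?E \<eta>\<bar>"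
  have M: "0 \<le> M" "u \<in> X \<Longrightarrow> hnorm (H u) (\<xi> u) \<le> M" "u \<in> X \<Longrightarrow> hnorm (H u) (\<eta> u) \<le> M" for u
    using hnorm_le_section_norm[OF b(1), of u] hnorm_le_section_norm[OF b(2), of u]
    by (auto simp: M_def fibre_generated_bundle)
  show "continuous_on UNIV (coefficient G ?E L \<xi> \<eta>)"
  proof (rule continuous_on_local_uniform_limit)
    fix x0 :: 'g and \<epsilon> :: real assume "0 < \<epsilon>"
    \<comment> \<open>Since \<delta> \<le> 1, the approximant has norm at most \<open>M + 1\<close>,
      and the two error terms add up to \<open>\<delta> * M + (M + 1) * \<delta>\<close>, which is
      at most \<epsilon>.\<close>
    define \<delta> where "\<delta> = min 1 (\<epsilon> / (2 * M + 1))"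
    have \<delta>: "0 < \<delta>" "\<delta> \<le> 1" using \<open>0 < \<epsilon>\<close> M(1) by (auto simp: \<delta>_def)
    have "\<delta> * (2 * M + 1) \<le> \<epsilon> / (2 * M + 1) * (2 * M + 1)"
      unfolding \<delta>_def using M(1) by (intro mult_right_mono) auto
    then have \<delta>\<epsilon>: "\<delta> * (2 * M + 1) \<le> \<epsilon>" using M(1) by simp
    obtain \<xi>' U where U: "\<xi>' \<in> span_sections" "open U" "src x0 \<in> U"
      "\<And>u. u \<in> U \<Longrightarrow> u \<in> X \<Longrightarrow> hdist (H u) (\<xi> u) (\<xi>' u) \<le> \<delta>"
      using generated_sectionE[OF \<xi> units(1)[of x0] \<delta>(1)] by metis
    obtain \<eta>' V where V: "\<eta>' \<in> span_sections" "open V" "rng x0 \<in> V"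
      "\<And>u. u \<in> V \<Longrightarrow> u \<in> X \<Longrightarrow> hdist (H u) (\<eta> u) (\<eta>' u) \<le> \<delta>"
      using generated_sectionE[OF \<eta> units(2)[of x0] \<delta>(1)] by metis
    let ?W = "src -` U \<inter> rng -` V"
    note cont = continuous_range_source_map[OF topological_groupoid_axioms]
    have "open ?W" using open_vimage[OF U(2) cont(2)] open_vimage[OF V(2) cont(1)] by (rule open_Int)
    moreover have "dist (coefficient G ?E L \<xi> \<eta> x) (coefficient G ?E L \<xi>' \<eta>' x) \<le> \<epsilon>" if "x \<in> ?W" for x
    proof -
      let ?s = "src x" and ?r = "rng x"
      interpret R: hilbert_space "H ?r" by (rule fibs)
      interpret S: hilbert_space "H ?s" by (rule fibs)
      have m: "\<xi> ?s \<in> hcarrier (H ?s)" "\<xi>' ?s \<in> hcarrier (H ?s)" "\<eta> ?r \<in> hcarrier (H ?r)" "\<eta>' ?r \<in> hcarrier (H ?r)"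
        using sections_mem \<xi> \<eta> span_mem U(1) V(1) units by auto
      have d: "hdist (H ?s) (\<xi> ?s) (\<xi>' ?s) \<le> \<delta>" "hdist (H ?r) (\<eta> ?r) (\<eta>' ?r) \<le> \<delta>"
        using that U(4) V(4) units by auto
      have n: "hnorm (H ?r) (L x (\<xi>' ?s)) = hnorm (H ?s) (\<xi>' ?s)"
        using isometry[of x] m(2) by (simp add: linear_isometry_onto_def)
      have "hnorm (H ?s) (\<xi>' ?s) \<le> M + 1"
        using S.hnorm_diff_le_hdist[OF m(1,2)] d(1) \<delta>(2) M(2)[OF units(1)[of x]] by simp
      then have "hdist (H ?s) (\<xi> ?s) (\<xi>' ?s) * hnorm (H ?r) (\<eta> ?r) + hnorm (H ?s) (\<xi>' ?s) * hdist (H ?r) (\<eta> ?r) (\<eta>' ?r)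
        \<le> \<delta> * M + (M + 1) * \<delta>"
        using d \<delta>(1) M(1) M(3)[OF units(2)[of x]] by (intro add_mono mult_mono) (auto intro: R.hnorm_nonneg m)
      also have "\<dots> \<le> \<epsilon>" using \<delta>\<epsilon> by (simp add: algebra_simps)
      finally show ?thesis
        using R.cmod_hinner_diff_le[OF L_mem[OF m(1)] L_mem[OF m(2)] m(3,4)]
        unfolding linear_isometry_onto_hdist[OF fibs isometry m(1,2)] n
        by (simp add: coefficient_def fibre_generated_bundle dist_norm)
    qed
    ultimately show "\<exists>g W. continuous_on UNIV g \<and> open W \<and> x0 \<in> W \<and>
        (\<forall>x\<in>W \<inter> UNIV. dist (coefficient G ?E L \<xi> \<eta> x) (g x) \<le> \<epsilon>)"
      using span_coefficient_continuous[OF U(1) V(1)] U(3) V(3) by blast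
  qed
qed

end

section \<open>Bounded sections\<close>

lemma (in hilbert_space) hinner_polarization:
  assumes "v \<in> hcarrier H" "w \<in> hcarrier H"
  shows "hinner H v w = Complex (((hnorm H (hadd H v w))\<^sup>2 - (hnorm H v)\<^sup>2 - (hnorm H w)\<^sup>2) / 2)
    (- ((hnorm H (hadd H v (hscale H \<i> w)))\<^sup>2 - (hnorm H v)\<^sup>2 - (hnorm H w)\<^sup>2) / 2)"
  using assms by (intro hinner_eqI) auto

context continuous_hilbert_bundle
begin

lemma section_mem: "\<lbrakk>\<xi> \<in> sections E; u \<in> X\<rbrakk> \<Longrightarrow> \<xi> u \<in> hcarrier (fibre E u)"
  using sections_subset by (auto simp: PiE_iff)

lemma bounded_section_mem: "\<lbrakk>\<xi> \<in> bounded_sections X E; u \<in> X\<rbrakk> \<Longrightarrow> \<xi> u \<in> hcarrier (fibre E u)"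
  by (auto simp: bounded_sections_def intro: section_mem)

text \<open>The bundle axioms speak of norms of sections only; polarization expresses the inner
  product through norms of sums of sections.\<close>

lemma continuous_hinner:
  assumes \<xi>: "\<xi> \<in> sections E" and \<eta>: "\<eta> \<in> sections E"
  shows "continuous_on X (\<lambda>u. hinner (fibre E u) (\<xi> u) (\<eta> u))"
proof -
  have a: "continuous_on X (\<lambda>u. hnorm (fibre E u) (hadd (fibre E u) (\<xi> u) (hscale (fibre E u) c (\<eta> u))))" for c
    using sections_norm[OF sections_add[OF \<xi> sections_scale[OF \<eta>, of c]]] by (simp cong: continuous_on_cong)
  have b: "continuous_on X (\<lambda>u. hnorm (fibre E u) (hadd (fibre E u) (\<xi> u) (\<eta> u)))"
    using sections_norm[OF sections_add[OF \<xi> \<eta>]] by (simp cong: continuous_on_cong)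
  have "continuous_on X (\<lambda>u. Complex
    (((hnorm (fibre E u) (hadd (fibre E u) (\<xi> u) (\<eta> u)))\<^sup>2 - (hnorm (fibre E u) (\<xi> u))\<^sup>2 - (hnorm (fibre E u) (\<eta> u))\<^sup>2) / 2)
    (- ((hnorm (fibre E u) (hadd (fibre E u) (\<xi> u) (hscale (fibre E u) \<i> (\<eta> u))))\<^sup>2 - (hnorm (fibre E u) (\<xi> u))\<^sup>2 - (hnorm (fibre E u) (\<eta> u))\<^sup>2) / 2))"
    unfolding Complex_eq by (intro continuous_intros a b sections_norm[OF \<xi>] sections_norm[OF \<eta>]) auto
  moreover have "hinner (fibre E u) (\<xi> u) (\<eta> u) = Complex
    (((hnorm (fibre E u) (hadd (fibre E u) (\<xi> u) (\<eta> u)))\<^sup>2 - (hnorm (fibre E u) (\<xi> u))\<^sup>2 - (hnorm (fibre E u) (\<eta> u))\<^sup>2) / 2)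
    (- ((hnorm (fibre E u) (hadd (fibre E u) (\<xi> u) (hscale (fibre E u) \<i> (\<eta> u))))\<^sup>2 - (hnorm (fibre E u) (\<xi> u))\<^sup>2 - (hnorm (fibre E u) (\<eta> u))\<^sup>2) / 2)"
    if "u \<in> X" for u
    by (rule hilbert_space.hinner_polarization[OF fibre_hilbert[OF that] section_mem[OF \<xi> that] section_mem[OF \<eta> that]])
  ultimately show ?thesis by (simp cong: continuous_on_cong)
qed

text \<open>Near \<open>t\<close> the product is uniformly close to the constant multiple of \<xi>
  by \<open>f t\<close>, which is a section; locality does the rest.\<close>

lemma sections_continuous_scale:
  fixes f :: "'b \<Rightarrow> complex"
  assumes f: "continuous_on X f" and \<xi>: "\<xi> \<in> sections E"
  shows "(\<lambda>u\<in>X. hscale (fibre E u) (f u) (\<xi> u)) \<in> sections E"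
proof (rule sections_local)
  show "(\<lambda>u\<in>X. hscale (fibre E u) (f u) (\<xi> u)) \<in> (\<Pi>\<^sub>E u\<in>X. hcarrier (fibre E u))"
    using section_mem[OF \<xi>]
    by (auto intro!: complex_vector_space.scale_closed[OF hilbert_space.axioms(1)[OF fibre_hilbert]])
  fix t and \<epsilon> :: real assume t: "t \<in> X" and \<epsilon>: "0 < \<epsilon>"
  have "continuous_on X (\<lambda>u. cmod (f u - f t) * hnorm (fibre E u) (\<xi> u))"
    by (intro continuous_intros f sections_norm \<xi>)
  then have "((\<lambda>u. cmod (f u - f t) * hnorm (fibre E u) (\<xi> u)) \<longlongrightarrow> cmod (f t - f t) * hnorm (fibre E t) (\<xi> t)) (at t within X)"
    using t unfolding continuous_on_def by blast
  from order_tendstoD(2)[OF this, of \<epsilon>] \<epsilon>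
  have "\<forall>\<^sub>F u in at t within X. cmod (f u - f t) * hnorm (fibre E u) (\<xi> u) < \<epsilon>" by simp
  then obtain U where U: "open U" "t \<in> U"
    "\<And>u. \<lbrakk>u \<in> U; u \<noteq> t; u \<in> X\<rbrakk> \<Longrightarrow> cmod (f u - f t) * hnorm (fibre E u) (\<xi> u) < \<epsilon>"
    unfolding eventually_at_topological by blast
  have "hdist (fibre E u) ((\<lambda>u\<in>X. hscale (fibre E u) (f u) (\<xi> u)) u) ((\<lambda>u\<in>X. hscale (fibre E u) (f t) (\<xi> u)) u) \<le> \<epsilon>"
    if "u \<in> U \<inter> X" for u
  proof -
    have u: "u \<in> U" "u \<in> X" using that by auto
    interpret hilbert_space "fibre E u" by (rule fibre_hilbert[OF u(2)])
    have m: "\<xi> u \<in> hcarrier (fibre E u)" by (rule section_mem[OF \<xi> u(2)])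
    have "minus_on (hscale (fibre E u) (f u) (\<xi> u)) (hscale (fibre E u) (f t) (\<xi> u)) = hscale (fibre E u) (f u - f t) (\<xi> u)"
      using scale_add_left[OF m, of "f u" "- f t"] by (simp add: scale_scale m)
    then have "hdist (fibre E u) (hscale (fibre E u) (f u) (\<xi> u)) (hscale (fibre E u) (f t) (\<xi> u))
        = cmod (f u - f t) * hnorm (fibre E u) (\<xi> u)"
      by (simp add: hdist_in scale_closed m hnorm_scale)
    then show ?thesis using U(3)[OF u(1) _ u(2)] u(2) \<epsilon> by (cases "u = t") auto
  qed
  then show "\<exists>\<xi>'\<in>sections E. \<exists>U. open U \<and> t \<in> U \<and>
      (\<forall>u\<in>U \<inter> X. hdist (fibre E u) ((\<lambda>u\<in>X. hscale (fibre E u) (f u) (\<xi> u)) u) (\<xi>' u) \<le> \<epsilon>)"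
    using U(1,2) by (intro bexI[OF _ sections_scale[OF \<xi>, of "f t"]] exI[of _ U]) auto
qed

text \<open>Coefficients are required to be continuous for bounded sections only, so the values of
  sections must be realized by bounded ones.\<close>

lemma ex_bounded_section:
  assumes \<xi>: "\<xi> \<in> sections E" and t: "t \<in> X"
  shows "\<exists>\<eta>\<in>bounded_sections X E. \<eta> t = \<xi> t"
proof -
  \<comment> \<open>A damping factor equal to 1 at \<open>t\<close> that keeps the norm of the
    scaled section below 1 plus the norm of \<xi> at \<open>t\<close>.\<close>
  define f where "f u = complex_of_real ((1 + hnorm (fibre E t) (\<xi> t)) / (1 + hnorm (fibre E u) (\<xi> u)))" for u
  have nn: "0 \<le> hnorm (fibre E u) (\<xi> u)" if "u \<in> X" for u
    by (rule hilbert_space.hnorm_nonneg[OF fibre_hilbert[OF that] section_mem[OF \<xi> that]])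
  then have ne: "1 + hnorm (fibre E u) (\<xi> u) \<noteq> 0" if "u \<in> X" for u using that by fastforce
  have "continuous_on X f"
    unfolding f_def using ne by (intro continuous_intros sections_norm \<xi>) auto
  then have s: "(\<lambda>u\<in>X. hscale (fibre E u) (f u) (\<xi> u)) \<in> sections E" (is "?\<eta> \<in> _")
    by (rule sections_continuous_scale[OF _ \<xi>])
  have "hnorm (fibre E u) (?\<eta> u) \<le> 1 + hnorm (fibre E t) (\<xi> t)" if u: "u \<in> X" for u
  proof -
    have "hnorm (fibre E u) (?\<eta> u) = cmod (f u) * hnorm (fibre E u) (\<xi> u)"
      using u by (simp add: hilbert_space.hnorm_scale[OF fibre_hilbert[OF u] section_mem[OF \<xi> u]])
    also have "\<dots> = (1 + hnorm (fibre E t) (\<xi> t)) * (hnorm (fibre E u) (\<xi> u) / (1 + hnorm (fibre E u) (\<xi> u)))"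
      using nn[OF u] nn[OF t] by (simp add: f_def norm_divide norm_mult del: of_real_divide of_real_add)
    also have "\<dots> \<le> (1 + hnorm (fibre E t) (\<xi> t)) * 1"
      using nn[OF u] nn[OF t] by (intro mult_left_mono) auto
    finally show ?thesis by simp
  qed
  then have "?\<eta> \<in> bounded_sections X E" using s by (auto simp: bounded_sections_def bdd_above_def)
  moreover have "?\<eta> t = \<xi> t"
  proof -
    have "f t = 1" unfolding f_def using ne[OF t] by (metis divide_self of_real_1)
    then show ?thesis
      using t complex_vector_space.scale_one[OF hilbert_space.axioms(1)[OF fibre_hilbert[OF t]] section_mem[OF \<xi> t]]
      by simp
  qed
  ultimately show ?thesis by blast
qed

text \<open>This makes bounded sections usable as building blocks for the generators of sum and
  tensor bundles.\<close>

lemma htotal_bounded_sections: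
  assumes u: "u \<in> X"
  shows "htotal (fibre E u) ((\<lambda>\<xi>. \<xi> u) ` bounded_sections X E)"
  unfolding htotal_def
proof (intro conjI subsetI)
  interpret hilbert_space "fibre E u" by (rule fibre_hilbert[OF u])
  show "v \<in> hcarrier (fibre E u)" if "v \<in> (\<lambda>\<xi>. \<xi> u) ` bounded_sections X E" for v
    using that bounded_section_mem u by blast
  fix v assume v: "v \<in> hcarrier (fibre E u)"
  then have c: "v \<in> htopology (fibre E u) closure_of ((\<lambda>\<xi>. \<xi> u) ` sections E)" by (simp add: sections_dense u)
  have "\<exists>w\<in>hspan (fibre E u) ((\<lambda>\<xi>. \<xi> u) ` bounded_sections X E). hdist (fibre E u) v w < r" if r: "0 < r" for r
  proof -
    obtain \<xi> where \<xi>: "\<xi> \<in> sections E" "hdist (fibre E u) v (\<xi> u) < r"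
      using c r unfolding htopology_def hmetric.metric_closure_of hmetric.in_mball mem_Collect_eq by blast
    then obtain \<eta> where "\<eta> \<in> bounded_sections X E" "\<eta> u = \<xi> u" using ex_bounded_section u by blast
    then show ?thesis using \<xi>(2) by (metis hspan.hspan_base imageI)
  qed
  then show "v \<in> hclspan (fibre E u) ((\<lambda>\<xi>. \<xi> u) ` bounded_sections X E)"
    using v by (simp add: hclspan_def)
qed

end

section \<open>Hilbert sums, tensor products and the constant bundle\<close>

lemma (in G_hilbert_bundle) coefficient_le:
  assumes G: "topological_groupoid G"
    and \<xi>: "\<xi> \<in> bounded_sections (unit_space G) E" and \<eta>: "\<eta> \<in> bounded_sections (unit_space G) E"
  shows "cmod (coefficient G E L \<xi> \<eta> x)
      \<le> section_norm (unit_space G) E \<xi> * section_norm (unit_space G) E \<eta>"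
proof -
  let ?s = "source_map G x" and ?r = "range_map G x"
  have u: "?s \<in> unit_space G" "?r \<in> unit_space G"
    by (rule source_map_in_unit_space[OF G], simp add: unit_space_def)
  interpret R: hilbert_space "fibre E ?r" by (rule fibre_hilbert[OF u(2)])
  interpret S: hilbert_space "fibre E ?s" by (rule fibre_hilbert[OF u(1)])
  note m = bounded_section_mem[OF \<xi> u(1)] bounded_section_mem[OF \<eta> u(2)]
  have Lm: "L x (\<xi> ?s) \<in> hcarrier (fibre E ?r)" "hnorm (fibre E ?r) (L x (\<xi> ?s)) = hnorm (fibre E ?s) (\<xi> ?s)"
    using L_isometry[of x] m(1) by (auto simp: linear_isometry_onto_def)
  have "cmod (coefficient G E L \<xi> \<eta> x) \<le> hnorm (fibre E ?s) (\<xi> ?s) * hnorm (fibre E ?r) (\<eta> ?r)"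
    unfolding coefficient_def Lm(2)[symmetric] by (rule R.cmod_hinner_le[OF Lm(1) m(2)])
  also have "\<dots> \<le> section_norm (unit_space G) E \<xi> * section_norm (unit_space G) E \<eta>"
    using hnorm_le_section_norm[OF \<xi> u(1)] hnorm_le_section_norm[OF \<eta> u(2)]
      S.hnorm_nonneg[OF m(1)] R.hnorm_nonneg[OF m(2)]
    by (intro mult_mono) auto
  finally show ?thesis .
qed

lemma (in continuous_hilbert_bundle) section_norm_nonneg:
  assumes "X \<noteq> {}" "\<xi> \<in> bounded_sections X E"
  shows "0 \<le> section_norm X E \<xi>"
proof -
  obtain u where u: "u \<in> X" using assms by blast
  show ?thesis
    using hilbert_space.hnorm_nonneg[OF fibre_hilbert[OF u] bounded_section_mem[OF assms(2) u]]
      hnorm_le_section_norm[OF assms(2) u] by simp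
qed

lemma section_norm_le:
  assumes "X \<noteq> {}" "\<And>u. u \<in> X \<Longrightarrow> hnorm (fibre E u) (\<xi> u) \<le> B"
  shows "section_norm X E \<xi> \<le> B"
  unfolding section_norm_def using assms by (intro cSUP_least)

lemma bounded_sectionI:
  assumes "\<xi> \<in> sections E" "\<And>u. u \<in> X \<Longrightarrow> hnorm (fibre E u) (\<xi> u) \<le> B"
  shows "\<xi> \<in> bounded_sections X E"
  using assms by (auto simp: bounded_sections_def bdd_above_def)

lemma (in continuous_hilbert_bundle) scaled_section:
  assumes X: "X \<noteq> {}" and \<xi>: "\<xi> \<in> bounded_sections X E"
  shows "(\<lambda>u\<in>X. hscale (fibre E u) c (\<xi> u)) \<in> bounded_sections X E"
    and "section_norm X E (\<lambda>u\<in>X. hscale (fibre E u) c (\<xi> u)) \<le> cmod c * section_norm X E \<xi>"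
proof -
  let ?\<eta> = "\<lambda>u\<in>X. hscale (fibre E u) c (\<xi> u)"
  have s: "?\<eta> \<in> sections E" using \<xi> by (intro sections_scale) (simp add: bounded_sections_def)
  have n: "hnorm (fibre E u) (?\<eta> u) \<le> cmod c * section_norm X E \<xi>" if u: "u \<in> X" for u
    using hilbert_space.hnorm_scale[OF fibre_hilbert[OF u] bounded_section_mem[OF \<xi> u], of c]
      mult_left_mono[OF hnorm_le_section_norm[OF \<xi> u], of "cmod c"] u by simp
  show "?\<eta> \<in> bounded_sections X E" by (rule bounded_sectionI[OF s n])
  show "section_norm X E ?\<eta> \<le> cmod c * section_norm X E \<xi>" by (rule section_norm_le[OF X n])
qed

section \<open>Countable Hilbert sums of bundles\<close>

locale G_hilbert_bundle_sequence = topological_groupoid G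
  for G :: "'g::topological_space groupoid" +
  fixes E :: "nat \<Rightarrow> ('g, 'h) hilbert_bundle"
    and L :: "nat \<Rightarrow> 'g \<Rightarrow> 'h \<Rightarrow> 'h"
  assumes bundles: "G_hilbert_bundle G (E n) (L n)"
begin

sublocale G_hilbert_bundle G "E n" "L n" for n by (rule bundles)

definition sum_fibre :: "'g \<Rightarrow> (nat \<Rightarrow> 'h) hspace"
  where "sum_fibre u = hsum (\<lambda>n. fibre (E n) u)"

definition sum_L :: "'g \<Rightarrow> (nat \<Rightarrow> 'h) \<Rightarrow> nat \<Rightarrow> 'h"
  where "sum_L x f n = L n x (f n)"

definition summand_section :: "nat \<Rightarrow> ('g \<Rightarrow> 'h) \<Rightarrow> 'g \<Rightarrow> nat \<Rightarrow> 'h"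
  where "summand_section n \<xi> = (\<lambda>u\<in>X. hilbert_sequence.hsingle (\<lambda>n. fibre (E n) u) n (\<xi> u))"

text \<open>Generators live in a single summand, so inner products and coefficients of two of them
  vanish unless the summands coincide; no infinite series enters the continuity conditions.\<close>

definition sum_generators :: "('g \<Rightarrow> nat \<Rightarrow> 'h) set"
  where "sum_generators = {summand_section n \<xi> | n \<xi>. \<xi> \<in> bounded_sections X (E n)}"

lemma fibres: "u \<in> X \<Longrightarrow> hilbert_sequence (\<lambda>n. fibre (E n) u)"
  by (rule hilbert_sequence.intro) (rule fibre_hilbert)

lemma L_zero: "L n x (hzero (fibre (E n) (src x))) = hzero (fibre (E n) (rng x))"
  by (rule hlinear_zero[OF fibre_hilbert[OF units(1)] fibre_hilbert[OF units(2)]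
        linear_isometry_onto_hlinear[OF L_isometry]])

lemma hinner_summand_section:
  assumes u: "u \<in> X" and m: "\<eta> \<in> bounded_sections X (E m)"
  shows "hinner (sum_fibre u) (hilbert_sequence.hsingle (\<lambda>n. fibre (E n) u) n v) (summand_section m \<eta> u)
    = (if n = m then hinner (fibre (E n) u) v (\<eta> u) else hinner (fibre (E n) u) v (hzero (fibre (E n) u)))"
proof -
  interpret F: hilbert_sequence "\<lambda>n. fibre (E n) u" by (rule fibres[OF u])
  have "\<eta> u \<in> hcarrier (fibre (E m) u)" using bounded_section_mem[OF m u] .
  from F.hinner_hsingle[OF F.hsingle_mem[OF this], of n v]
  show ?thesis using u by (auto simp: sum_fibre_def summand_section_def F.hsingle_def)
qed

text \<open>For surjectivity, preimages are picked in each component; they are square summable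
  because each component map preserves norms.\<close>

lemma linear_isometry_onto_sum:
  "linear_isometry_onto (sum_fibre (src x)) (sum_fibre (rng x)) (sum_L x)"
proof -
  let ?s = "src x" and ?r = "rng x"
  interpret R: hilbert_sequence "\<lambda>n. fibre (E n) ?r" by (rule fibres[OF units(2)])
  interpret S: hilbert_sequence "\<lambda>n. fibre (E n) ?s" by (rule fibres[OF units(1)])
  note L = hlinearD[OF linear_isometry_onto_hlinear[OF L_isometry]]
  have n: "hnorm (fibre (E n) ?r) (L n x v) = hnorm (fibre (E n) ?s) v"
    if "v \<in> hcarrier (fibre (E n) ?s)" for n v
    using L_isometry[of n x] that by (simp add: linear_isometry_onto_def)
  have mem: "sum_L x f \<in> hcarrier (sum_fibre ?r)" if "f \<in> hcarrier (sum_fibre ?s)" for f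
    using that unfolding sum_fibre_def R.hsum_simps(1) S.hsum_simps(1) sum_L_def
    by (auto simp: n L)
  show ?thesis unfolding linear_isometry_onto_def
  proof (intro conjI ballI allI)
    show "sum_L x ` hcarrier (sum_fibre ?s) = hcarrier (sum_fibre ?r)"
    proof (intro equalityI subsetI)
      show "g \<in> hcarrier (sum_fibre ?r)" if "g \<in> sum_L x ` hcarrier (sum_fibre ?s)" for g
        using that mem by blast
      show "g \<in> sum_L x ` hcarrier (sum_fibre ?s)" if g: "g \<in> hcarrier (sum_fibre ?r)" for g
      proof -
        have gn: "g n \<in> hcarrier (fibre (E n) ?r)" "summable (\<lambda>n. (hnorm (fibre (E n) ?r) (g n))\<^sup>2)" for n
          using g unfolding sum_fibre_def R.hsum_simps(1) by auto
        have "\<forall>n. \<exists>v. v \<in> hcarrier (fibre (E n) ?s) \<and> L n x v = g n"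
        proof
          fix n
          have "g n \<in> L n x ` hcarrier (fibre (E n) ?s)"
            using L_isometry[of n x] gn(1)[of n] by (simp add: linear_isometry_onto_def)
          then show "\<exists>v. v \<in> hcarrier (fibre (E n) ?s) \<and> L n x v = g n" by auto
        qed
        then obtain f where f: "\<And>n. f n \<in> hcarrier (fibre (E n) ?s)" "\<And>n. L n x (f n) = g n" by metis
        have "hnorm (fibre (E n) ?s) (f n) = hnorm (fibre (E n) ?r) (g n)" for n
          using n[OF f(1)[of n]] f(2)[of n] by simp
        then have "f \<in> hcarrier (sum_fibre ?s)"
          using f(1) gn(2) unfolding sum_fibre_def S.hsum_simps(1) by simp
        moreover have "g = sum_L x f" using f(2) by (simp add: sum_L_def fun_eq_iff)
        ultimately show ?thesis by blast
      qed
    qed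
  next
    fix f g assume f: "f \<in> hcarrier (sum_fibre ?s)" and g: "g \<in> hcarrier (sum_fibre ?s)"
    have c: "f n \<in> hcarrier (fibre (E n) ?s)" "g n \<in> hcarrier (fibre (E n) ?s)" for n
      using f g unfolding sum_fibre_def S.hsum_simps(1) by auto
    show "sum_L x (hadd (sum_fibre ?s) f g) = hadd (sum_fibre ?r) (sum_L x f) (sum_L x g)"
      unfolding sum_fibre_def R.hsum_simps(3) S.hsum_simps(3) by (auto simp: sum_L_def fun_eq_iff L c)
  next
    fix k f assume f: "f \<in> hcarrier (sum_fibre ?s)"
    have c: "f n \<in> hcarrier (fibre (E n) ?s)" for n
      using f unfolding sum_fibre_def S.hsum_simps(1) by auto
    show "sum_L x (hscale (sum_fibre ?s) k f) = hscale (sum_fibre ?r) k (sum_L x f)"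
      unfolding sum_fibre_def R.hsum_simps(4) S.hsum_simps(4) by (auto simp: sum_L_def fun_eq_iff L c)
  next
    fix f assume f: "f \<in> hcarrier (sum_fibre ?s)"
    have c: "f n \<in> hcarrier (fibre (E n) ?s)" for n
      using f unfolding sum_fibre_def S.hsum_simps(1) by auto
    show "hnorm (sum_fibre ?r) (sum_L x f) = hnorm (sum_fibre ?s) f"
      using mem[OF f] f unfolding sum_fibre_def
      by (simp add: R.hsum_norm S.hsum_norm) (simp add: sum_L_def n c)
  qed
qed

sublocale sum: generating_G_sections G sum_fibre sum_generators sum_L
proof (intro generating_G_sections.intro generating_sections.intro generating_G_sections_axioms.intro topological_groupoid_axioms)
  fix u assume u: "u \<in> X"
  interpret F: hilbert_sequence "\<lambda>n. fibre (E n) u" by (rule fibres[OF u])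
  show "hilbert_space (sum_fibre u)" unfolding sum_fibre_def by (rule F.hsum_hilbert_space)
  have "{F.hsingle n v | n v. v \<in> (\<lambda>\<xi>. \<xi> u) ` bounded_sections X (E n)} = (\<lambda>\<zeta>. \<zeta> u) ` sum_generators" (is "?l = ?r")
  proof (intro equalityI subsetI)
    fix a assume "a \<in> ?l"
    then obtain n \<xi> where *: "\<xi> \<in> bounded_sections X (E n)" "a = F.hsingle n (\<xi> u)" by blast
    then have "summand_section n \<xi> \<in> sum_generators" "a = summand_section n \<xi> u"
      using u by (auto simp: sum_generators_def summand_section_def)
    then show "a \<in> ?r" by blast
  next
    fix a assume "a \<in> ?r"
    then obtain n \<xi> where "\<xi> \<in> bounded_sections X (E n)" "a = summand_section n \<xi> u"
      unfolding sum_generators_def by blast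
    then show "a \<in> ?l" using u by (auto simp: summand_section_def)
  qed
  then show "htotal (sum_fibre u) ((\<lambda>\<zeta>. \<zeta> u) ` sum_generators)"
    unfolding sum_fibre_def using F.htotal_hsum[OF htotal_bounded_sections[OF u]] by simp
next
  show "sum_generators \<subseteq> (\<Pi>\<^sub>E u\<in>X. hcarrier (sum_fibre u))"
  proof
    fix \<zeta> assume "\<zeta> \<in> sum_generators"
    then obtain n \<xi> where \<zeta>: "\<zeta> = summand_section n \<xi>" "\<xi> \<in> bounded_sections X (E n)"
      unfolding sum_generators_def by blast
    have "hilbert_sequence.hsingle (\<lambda>n. fibre (E n) u) n (\<xi> u) \<in> hcarrier (sum_fibre u)" if u: "u \<in> X" for u
      unfolding sum_fibre_def
      by (rule hilbert_sequence.hsingle_mem[OF fibres[OF u] bounded_section_mem[OF \<zeta>(2) u]])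
    then show "\<zeta> \<in> (\<Pi>\<^sub>E u\<in>X. hcarrier (sum_fibre u))"
      unfolding \<zeta>(1) summand_section_def by auto
  qed
next
  fix \<xi> \<eta> assume "\<xi> \<in> sum_generators" "\<eta> \<in> sum_generators"
  then obtain n \<alpha> m \<beta> where \<alpha>: "\<xi> = summand_section n \<alpha>" "\<alpha> \<in> bounded_sections X (E n)"
    and \<beta>: "\<eta> = summand_section m \<beta>" "\<beta> \<in> bounded_sections X (E m)" by (auto simp: sum_generators_def)
  have e: "hinner (sum_fibre u) (\<xi> u) (\<eta> u) = (if n = m then hinner (fibre (E n) u) (\<alpha> u) (\<beta> u) else 0)"
    if u: "u \<in> X" for u
  proof -
    have "\<xi> u = hilbert_sequence.hsingle (\<lambda>n. fibre (E n) u) n (\<alpha> u)"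
      using u by (simp add: \<alpha>(1) summand_section_def)
    then show ?thesis
      using hinner_summand_section[OF u \<beta>(2), of n "\<alpha> u"]
        hilbert_space.hinner_zero[OF fibre_hilbert[OF u] bounded_section_mem[OF \<alpha>(2) u]]
      by (simp add: \<beta>(1))
  qed
  have "continuous_on X (\<lambda>u. if n = m then hinner (fibre (E n) u) (\<alpha> u) (\<beta> u) else 0)"
    using \<alpha>(2) \<beta>(2) continuous_hinner[of \<alpha> n \<beta>] by (cases "n = m") (auto simp: bounded_sections_def)
  then show "continuous_on X (\<lambda>u. hinner (sum_fibre u) (\<xi> u) (\<eta> u))"
    using e by (simp cong: continuous_on_cong)
  have "hinner (sum_fibre (rng x)) (sum_L x (\<xi> (src x))) (\<eta> (rng x))
    = (if n = m then coefficient G (E n) (L n) \<alpha> \<beta> x else 0)" for x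
  proof -
    let ?s = "src x" and ?r = "rng x"
    have "sum_L x (\<xi> ?s) = hilbert_sequence.hsingle (\<lambda>n. fibre (E n) ?r) n (L n x (\<alpha> ?s))"
      using units(1)[of x] L_zero[of _ x]
      by (auto simp: \<alpha>(1) summand_section_def sum_L_def fun_eq_iff
          hilbert_sequence.hsingle_def[OF fibres[OF units(1)]] hilbert_sequence.hsingle_def[OF fibres[OF units(2)]])
    moreover have "L n x (\<alpha> ?s) \<in> hcarrier (fibre (E n) ?r)"
      using hlinearD(1)[OF linear_isometry_onto_hlinear[OF L_isometry] bounded_section_mem[OF \<alpha>(2) units(1)]] .
    ultimately show ?thesis
      using hinner_summand_section[OF units(2)[of x] \<beta>(2), of n "L n x (\<alpha> ?s)"]
        hilbert_space.hinner_zero[OF fibre_hilbert[OF units(2)[of x]]]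
      by (simp add: \<beta>(1) coefficient_def)
  qed
  moreover have "continuous_on UNIV (\<lambda>x. if n = m then coefficient G (E n) (L n) \<alpha> \<beta> x else 0)"
    using \<alpha>(2) \<beta>(2) coefficient_continuous[of \<alpha> n \<beta>] by (cases "n = m") auto
  ultimately show "continuous_on UNIV
      (\<lambda>x. hinner (sum_fibre (rng x)) (sum_L x (\<xi> (src x))) (\<eta> (rng x)))" by simp
next
  show "linear_isometry_onto (sum_fibre (src x)) (sum_fibre (rng x)) (sum_L x)" for x
    by (rule linear_isometry_onto_sum)
  fix x y f assume xy: "(x, y) \<in> composable G" and f: "f \<in> hcarrier (sum_fibre (src y))"
  interpret S: hilbert_sequence "\<lambda>n. fibre (E n) (src y)" by (rule fibres[OF units(1)])
  show "sum_L (gmult G x y) f = sum_L x (sum_L y f)"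
    using L_mult[OF xy] f unfolding sum_fibre_def S.hsum_simps(1) by (auto simp: sum_L_def fun_eq_iff)
qed

abbreviation "sum_bundle \<equiv> generated_bundle X sum_fibre sum_generators"

definition sum_section :: "(nat \<Rightarrow> 'g \<Rightarrow> 'h) \<Rightarrow> 'g \<Rightarrow> nat \<Rightarrow> 'h"
  where "sum_section \<zeta> = (\<lambda>u\<in>X. \<lambda>n. \<zeta> n u)"

text \<open>Truncations are finite sums of generators. Their squared error at \<open>u\<close> is at
  most the tail of the series of squared section norms, which does not depend on \<open>u\<close>;
  approximation is thus uniform on the whole unit space.\<close>

lemma sum_section_bounded:
  assumes \<zeta>: "\<And>n. \<zeta> n \<in> bounded_sections X (E n)"
    and sm: "summable (\<lambda>n. (section_norm X (E n) (\<zeta> n))\<^sup>2)"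
  shows "sum_section \<zeta> \<in> bounded_sections X sum_bundle"
    and "section_norm X sum_bundle (sum_section \<zeta>) \<le> sqrt (\<Sum>n. (section_norm X (E n) (\<zeta> n))\<^sup>2)"
proof -
  let ?c = "\<lambda>n. (section_norm X (E n) (\<zeta> n))\<^sup>2"
  have n0: "0 \<le> hnorm (fibre (E n) u) (\<zeta> n u)" if "u \<in> X" for u n
    by (rule hilbert_space.hnorm_nonneg[OF fibre_hilbert[OF that] bounded_section_mem[OF \<zeta> that]])
  have le: "(hnorm (fibre (E n) u) (\<zeta> n u))\<^sup>2 \<le> ?c n" if "u \<in> X" for u n
    by (rule power_mono[OF hnorm_le_section_norm[OF \<zeta> that] n0[OF that]])
  have smu: "summable (\<lambda>n. (hnorm (fibre (E n) u) (\<zeta> n u))\<^sup>2)" if "u \<in> X" for u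
    using le[OF that] by (intro summable_comparison_test'[OF sm]) auto
  have mem: "sum_section \<zeta> u \<in> hcarrier (sum_fibre u)" if u: "u \<in> X" for u
  proof -
    interpret F: hilbert_sequence "\<lambda>n. fibre (E n) u" by (rule fibres[OF u])
    show ?thesis
      unfolding sum_fibre_def F.hsum_simps(1) using u smu bounded_section_mem[OF \<zeta> u]
      by (simp add: sum_section_def)
  qed
  have norm: "hnorm (sum_fibre u) (sum_section \<zeta> u) \<le> sqrt (\<Sum>n. ?c n)" if u: "u \<in> X" for u
  proof -
    interpret F: hilbert_sequence "\<lambda>n. fibre (E n) u" by (rule fibres[OF u])
    show ?thesis
      using F.hsum_norm[OF mem[OF u, unfolded sum_fibre_def]] u suminf_le[OF le[OF u] smu[OF u] sm]
      by (simp add: sum_fibre_def sum_section_def)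
  qed
  define trunc where "trunc N = (\<lambda>u\<in>X. hilbert_sequence.truncate (\<lambda>n. fibre (E n) u) N (sum_section \<zeta> u))" for N
  have span: "trunc N \<in> sum.span_sections" for N
  proof (induction N)
    case 0
    have "trunc 0 = hzero (section_space X sum_fibre)"
    proof
      fix u
      show "trunc 0 u = hzero (section_space X sum_fibre) u"
      proof (cases "u \<in> X")
        case True
        interpret F: hilbert_sequence "\<lambda>n. fibre (E n) u" by (rule fibres[OF True])
        show ?thesis
          using True by (simp add: trunc_def section_space_simps sum_fibre_def F.hsum_simps(2) F.truncate_def fun_eq_iff)
      qed (simp add: trunc_def section_space_simps)
    qed
    then show ?case by (simp add: hspan.hspan_zero)
  next
    case (Suc N)
    have "trunc (Suc N) = hadd (section_space X sum_fibre) (trunc N) (summand_section N (\<zeta> N))"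
    proof
      fix u
      show "trunc (Suc N) u = hadd (section_space X sum_fibre) (trunc N) (summand_section N (\<zeta> N)) u"
      proof (cases "u \<in> X")
        case u: True
        interpret F: hilbert_sequence "\<lambda>n. fibre (E n) u" by (rule fibres[OF u])
        have "trunc (Suc N) u n = hadd (fibre (E n) u) (trunc N u n) (summand_section N (\<zeta> N) u n)" for n
          using F.add_zero[OF bounded_section_mem[OF \<zeta> u], of n] F.zero_add[OF bounded_section_mem[OF \<zeta> u], of n]
            F.add_zero[OF F.zero_closed, of n] u
          by (cases n N rule: linorder_cases)
            (simp_all add: trunc_def summand_section_def sum_section_def F.truncate_def F.hsingle_def)
        then show ?thesis
          using u by (simp add: section_space_simps sum_fibre_def F.hsum_simps(3) fun_eq_iff)
      qed (simp add: trunc_def section_space_simps)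
    qed
    moreover have "summand_section N (\<zeta> N) \<in> sum_generators" using \<zeta> by (auto simp: sum_generators_def)
    ultimately show ?case using Suc by (auto intro: hspan.intros)
  qed
  have "sum_section \<zeta> \<in> sections sum_bundle"
  proof (rule generated_sectionI)
    show "sum_section \<zeta> \<in> (\<Pi>\<^sub>E u\<in>X. hcarrier (sum_fibre u))"
      using mem by (auto simp: PiE_iff sum_section_def extensional_def)
    fix t and \<epsilon> :: real assume "t \<in> X" "0 < \<epsilon>"
    then have "0 < \<epsilon>\<^sup>2" by simp
    from order_tendstoD(2)[OF suminf_exist_split2[OF sm] this]
    obtain N where N: "(\<Sum>n. ?c (n + N)) < \<epsilon>\<^sup>2" unfolding eventually_sequentially by blast
    have "hdist (sum_fibre u) (sum_section \<zeta> u) (trunc N u) \<le> \<epsilon>" if u: "u \<in> X" for u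
    proof (rule power2_le_imp_le)
      interpret F: hilbert_sequence "\<lambda>n. fibre (E n) u" by (rule fibres[OF u])
      have "(hdist (sum_fibre u) (sum_section \<zeta> u) (trunc N u))\<^sup>2
          = (\<Sum>n. (hnorm (fibre (E (n + N)) u) (\<zeta> (n + N) u))\<^sup>2)"
        using F.hdist_truncate_tendsto(2)[OF mem[OF u, unfolded sum_fibre_def], of N] u
        by (simp add: sum_fibre_def trunc_def sum_section_def)
      also have "\<dots> \<le> (\<Sum>n. ?c (n + N))"
        by (intro suminf_le le[OF u] summable_ignore_initial_segment[OF smu[OF u]]
            summable_ignore_initial_segment[OF sm])
      finally show "(hdist (sum_fibre u) (sum_section \<zeta> u) (trunc N u))\<^sup>2 \<le> \<epsilon>\<^sup>2" using N by simp
    qed (use \<open>0 < \<epsilon>\<close> in simp)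
    then show "\<exists>\<xi>'\<in>sum.span_sections. \<exists>U. open U \<and> t \<in> U \<and>
        (\<forall>u\<in>U \<inter> X. hdist (sum_fibre u) (sum_section \<zeta> u) (\<xi>' u) \<le> \<epsilon>)"
      by (intro bexI[OF _ span[of N]] exI[of _ UNIV]) auto
  qed
  then show "sum_section \<zeta> \<in> bounded_sections X sum_bundle"
    using norm by (intro bounded_sectionI) (auto simp: fibre_generated_bundle)
  have "X \<noteq> {}" by (simp add: unit_space_def)
  then show "section_norm X sum_bundle (sum_section \<zeta>) \<le> sqrt (\<Sum>n. ?c n)"
    using norm by (intro section_norm_le) (auto simp: fibre_generated_bundle)
qed

text \<open>Both sides unfold to the same series, since the inner product of the Hilbert sum is
  defined by it.\<close>

lemma coefficient_sum_section:
  "coefficient G sum_bundle sum_L (sum_section \<zeta>) (sum_section \<zeta>') x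
    = (\<Sum>n. coefficient G (E n) (L n) (\<zeta> n) (\<zeta>' n) x)"
proof -
  interpret R: hilbert_sequence "\<lambda>n. fibre (E n) (rng x)" by (rule fibres[OF units(2)])
  show ?thesis
    using units[of x]
    by (simp add: coefficient_def fibre_generated_bundle sum_fibre_def R.hsum_simps(5) sum_L_def sum_section_def)
qed

end

section \<open>Tensor products of bundles\<close>

locale G_hilbert_bundle_pair = topological_groupoid G + A: G_hilbert_bundle G E L + B: G_hilbert_bundle G E' L'
  for G :: "'g::topological_space groupoid" and E :: "('g, 'h) hilbert_bundle" and L
    and E' :: "('g, 'k) hilbert_bundle" and L'
begin

definition tensor_fibre :: "'g \<Rightarrow> (nat \<Rightarrow> 'h) hspace"
  where "tensor_fibre u = htensor (fibre E u) (fibre E' u)"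

definition tensor :: "'g \<Rightarrow> 'h \<Rightarrow> 'k \<Rightarrow> nat \<Rightarrow> 'h"
  where "tensor u = elementary_tensor (fibre E u) (fibre E' u)"

definition tensor_section :: "('g \<Rightarrow> 'h) \<Rightarrow> ('g \<Rightarrow> 'k) \<Rightarrow> 'g \<Rightarrow> nat \<Rightarrow> 'h"
  where "tensor_section \<xi> \<eta> = (\<lambda>u\<in>X. tensor u (\<xi> u) (\<eta> u))"

definition tensor_generators :: "('g \<Rightarrow> nat \<Rightarrow> 'h) set"
  where "tensor_generators = {tensor_section \<xi> \<eta> | \<xi> \<eta>. \<xi> \<in> bounded_sections X E \<and> \<eta> \<in> bounded_sections X E'}"

text \<open>Specified by its values on elementary tensors: the bases chosen at source and range are
  unrelated, so acting on coordinates would not give the tensor product of the two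
  isometries.\<close>

definition tensor_L :: "'g \<Rightarrow> (nat \<Rightarrow> 'h) \<Rightarrow> nat \<Rightarrow> 'h"
  where "tensor_L x = (SOME T.
    linear_isometry_onto (tensor_fibre (src x)) (tensor_fibre (rng x)) T \<and>
    (\<forall>v\<in>hcarrier (fibre E (src x)). \<forall>w\<in>hcarrier (fibre E' (src x)).
      T (tensor (src x) v w) = tensor (rng x) (L x v) (L' x w)))"

lemma fibre_pair: "u \<in> X \<Longrightarrow> hilbert_space_pair (fibre E u) (fibre E' u)"
  by (intro hilbert_space_pair.intro A.fibre_hilbert B.fibre_hilbert)

lemma tensor_facts:
  assumes "u \<in> X"
  shows "hilbert_space (tensor_fibre u)"
    and "\<lbrakk>v \<in> hcarrier (fibre E u); w \<in> hcarrier (fibre E' u)\<rbrakk> \<Longrightarrow> tensor u v w \<in> hcarrier (tensor_fibre u)"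
    and "\<lbrakk>v \<in> hcarrier (fibre E u); w \<in> hcarrier (fibre E' u); v' \<in> hcarrier (fibre E u); w' \<in> hcarrier (fibre E' u)\<rbrakk>
      \<Longrightarrow> hinner (tensor_fibre u) (tensor u v w) (tensor u v' w') = hinner (fibre E u) v v' * hinner (fibre E' u) w w'"
    and "\<lbrakk>v \<in> hcarrier (fibre E u); w \<in> hcarrier (fibre E' u)\<rbrakk>
      \<Longrightarrow> hnorm (tensor_fibre u) (tensor u v w) = hnorm (fibre E u) v * hnorm (fibre E' u) w"
    and "\<lbrakk>htotal (fibre E u) S; htotal (fibre E' u) S'\<rbrakk>
      \<Longrightarrow> htotal (tensor_fibre u) {tensor u v w | v w. v \<in> S \<and> w \<in> S'}"
  unfolding tensor_fibre_def tensor_def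
      apply (rule hilbert_space_pair.htensor_hilbert_space[OF fibre_pair[OF assms]])
     apply (erule (1) hilbert_space_pair.elementary_tensor_mem[OF fibre_pair[OF assms]])
    apply (erule (3) hilbert_space_pair.hinner_elementary_tensor[OF fibre_pair[OF assms]])
   apply (erule (1) hilbert_space_pair.hnorm_elementary_tensor[OF fibre_pair[OF assms]])
  apply (erule (1) hilbert_space_pair.htotal_elementary_tensors[OF fibre_pair[OF assms]])
  done

lemma htotal_tensors:
  assumes u: "u \<in> X"
  shows "htotal (tensor_fibre u) {tensor u v w | v w. v \<in> hcarrier (fibre E u) \<and> w \<in> hcarrier (fibre E' u)}"
  by (rule tensor_facts(5)[OF u hilbert_space.htotal_hcarrier[OF A.fibre_hilbert[OF u]]
        hilbert_space.htotal_hcarrier[OF B.fibre_hilbert[OF u]]])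

lemma L_mem:
  "v \<in> hcarrier (fibre E (src x)) \<Longrightarrow> L x v \<in> hcarrier (fibre E (rng x))"
  "w \<in> hcarrier (fibre E' (src x)) \<Longrightarrow> L' x w \<in> hcarrier (fibre E' (rng x))"
  using A.L_isometry[of x] B.L_isometry[of x] by (auto simp: linear_isometry_onto_def)

text \<open>Both isometries preserve inner products, hence so does the assignment on elementary
  tensors. These are total at the source, and their images are total at the range because both
  isometries are onto; \<open>isometric_extension\<close> then applies.\<close>

lemma tensor_L:
  "linear_isometry_onto (tensor_fibre (src x)) (tensor_fibre (rng x)) (tensor_L x)"
  "\<lbrakk>v \<in> hcarrier (fibre E (src x)); w \<in> hcarrier (fibre E' (src x))\<rbrakk>
    \<Longrightarrow> tensor_L x (tensor (src x) v w) = tensor (rng x) (L x v) (L' x w)"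
proof -
  let ?s = "src x" and ?r = "rng x"
  let ?V = "hcarrier (fibre E ?s)" and ?W = "hcarrier (fibre E' ?s)"
  let ?P = "(\<lambda>(v, w). (tensor ?s v w, tensor ?r (L x v) (L' x w))) ` (?V \<times> ?W)"
  have setcompr: "{f v w | v w. v \<in> V \<and> w \<in> W} = (\<lambda>(v, w). f v w) ` (V \<times> W)" for f V W by auto
  note hl = A.fibre_hilbert[OF units(1)] A.fibre_hilbert[OF units(2)] A.L_isometry
  note hl' = B.fibre_hilbert[OF units(1)] B.fibre_hilbert[OF units(2)] B.L_isometry
  have "\<exists>T. linear_isometry_onto (tensor_fibre ?s) (tensor_fibre ?r) T \<and> (\<forall>(a, b)\<in>?P. T a = b)"
  proof (rule isometric_extension)
    show "hilbert_space (tensor_fibre ?s)" "hilbert_space (tensor_fibre ?r)"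
      by (rule tensor_facts(1)[OF units(1)], rule tensor_facts(1)[OF units(2)])
    have "fst ` ?P = (\<lambda>(v, w). tensor ?s v w) ` (?V \<times> ?W)"
      by (simp add: image_image split_def)
    then show "htotal (tensor_fibre ?s) (fst ` ?P)"
      using htotal_tensors[OF units(1)] unfolding setcompr by simp
    \<comment> \<open>Surjectivity in each factor shows that the second components are all the
      elementary tensors at the range.\<close>
    have "snd ` ?P = (\<lambda>(v, w). tensor ?r v w) ` ((\<lambda>(v, w). (L x v, L' x w)) ` (?V \<times> ?W))"
      by (simp add: image_image split_def)
    also have "(\<lambda>(v, w). (L x v, L' x w)) ` (?V \<times> ?W) = (L x ` ?V) \<times> (L' x ` ?W)"
      by (rule image_paired_Times)
    also have "L x ` ?V = hcarrier (fibre E ?r)"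
      using A.L_isometry[of x] by (simp add: linear_isometry_onto_def)
    also have "L' x ` ?W = hcarrier (fibre E' ?r)"
      using B.L_isometry[of x] by (simp add: linear_isometry_onto_def)
    finally show "htotal (tensor_fibre ?r) (snd ` ?P)"
      using htotal_tensors[OF units(2)] unfolding setcompr by simp
  next
    fix a b a' b' assume "(a, b) \<in> ?P" "(a', b') \<in> ?P"
    then obtain v w v' w' where *: "a = tensor ?s v w" "b = tensor ?r (L x v) (L' x w)" "v \<in> ?V" "w \<in> ?W"
      "a' = tensor ?s v' w'" "b' = tensor ?r (L x v') (L' x w')" "v' \<in> ?V" "w' \<in> ?W" by auto
    show "hinner (tensor_fibre ?s) a a' = hinner (tensor_fibre ?r) b b'"
      using *(3,4,7,8) unfolding *(1,2,5,6)
      by (simp add: tensor_facts(3) units L_mem linear_isometry_onto_hinner[OF hl] linear_isometry_onto_hinner[OF hl'])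
  qed
  then have ex: "\<exists>T. linear_isometry_onto (tensor_fibre ?s) (tensor_fibre ?r) T \<and>
      (\<forall>v\<in>?V. \<forall>w\<in>?W. T (tensor ?s v w) = tensor ?r (L x v) (L' x w))" by simp
  from someI_ex[OF ex, folded tensor_L_def]
  show "linear_isometry_onto (tensor_fibre ?s) (tensor_fibre ?r) (tensor_L x)"
    "\<lbrakk>v \<in> ?V; w \<in> ?W\<rbrakk> \<Longrightarrow> tensor_L x (tensor ?s v w) = tensor ?r (L x v) (L' x w)" by simp_all
qed

text \<open>\<open>tensor_L\<close> is a mere choice at each element, but two isometries that agree
  on elementary tensors are equal.\<close>

lemma tensor_L_mult:
  assumes xy: "(x, y) \<in> composable G" and f: "f \<in> hcarrier (tensor_fibre (src y))"
  shows "tensor_L (gmult G x y) f = tensor_L x (tensor_L y f)"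
proof (rule linear_isometry_onto_eqI[where T = "tensor_L (gmult G x y)" and T' = "\<lambda>f. tensor_L x (tensor_L y f)",
      OF _ _ _ _ htotal_tensors[OF units(1)] _ f])
  note m = source_range_gmult[OF topological_groupoid_axioms xy]
  show "hilbert_space (tensor_fibre (src y))" "hilbert_space (tensor_fibre (rng x))"
    by (rule tensor_facts(1)[OF units(1)], rule tensor_facts(1)[OF units(2)])
  show "linear_isometry_onto (tensor_fibre (src y)) (tensor_fibre (rng x)) (tensor_L (gmult G x y))"
    using tensor_L(1)[of "gmult G x y"] m by simp
  show "linear_isometry_onto (tensor_fibre (src y)) (tensor_fibre (rng x)) (\<lambda>f. tensor_L x (tensor_L y f))"
    by (rule linear_isometry_onto_compose[OF tensor_L(1)[of y] tensor_L(1)[of x, unfolded m(3)]])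
  fix a assume "a \<in> {tensor (src y) v w | v w. v \<in> hcarrier (fibre E (src y))
    \<and> w \<in> hcarrier (fibre E' (src y))}"
  then obtain v w where a: "a = tensor (src y) v w" "v \<in> hcarrier (fibre E (src y))"
    "w \<in> hcarrier (fibre E' (src y))" by blast
  have "tensor_L (gmult G x y) a = tensor (rng x) (L x (L y v)) (L' x (L' y w))"
    using tensor_L(2)[of v "gmult G x y" w] A.L_mult[OF xy a(2)] B.L_mult[OF xy a(3)] a m by simp
  moreover have "tensor_L y a = tensor (src x) (L y v) (L' y w)"
    unfolding a(1) m(3) by (rule tensor_L(2)[OF a(2,3)])
  moreover have "L y v \<in> hcarrier (fibre E (src x))" "L' y w \<in> hcarrier (fibre E' (src x))"
    unfolding m(3) by (rule L_mem(1)[OF a(2)], rule L_mem(2)[OF a(3)])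
  ultimately show "tensor_L (gmult G x y) a = tensor_L x (tensor_L y a)"
    using tensor_L(2)[of "L y v" x "L' y w"] by simp
qed

text \<open>Inner products and coefficients of tensor sections factor into those of the two bundles,
  so their continuity is that of a product.\<close>

sublocale T: generating_G_sections G tensor_fibre tensor_generators tensor_L
proof (intro generating_G_sections.intro generating_sections.intro generating_G_sections_axioms.intro topological_groupoid_axioms)
  fix u assume u: "u \<in> X"
  show "hilbert_space (tensor_fibre u)" by (rule tensor_facts(1)[OF u])
  have "{tensor u v w | v w. v \<in> (\<lambda>\<xi>. \<xi> u) ` bounded_sections X E \<and> w \<in> (\<lambda>\<xi>. \<xi> u) ` bounded_sections X E'}
    = (\<lambda>\<zeta>. \<zeta> u) ` tensor_generators" (is "?l = ?r")
  proof (intro equalityI subsetI)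
    fix a assume "a \<in> ?l"
    then obtain \<xi> \<eta> where *: "\<xi> \<in> bounded_sections X E" "\<eta> \<in> bounded_sections X E'" "a = tensor u (\<xi> u) (\<eta> u)" by blast
    then have "tensor_section \<xi> \<eta> \<in> tensor_generators" "a = tensor_section \<xi> \<eta> u"
      using u by (auto simp: tensor_generators_def tensor_section_def)
    then show "a \<in> ?r" by blast
  next
    fix a assume "a \<in> ?r"
    then obtain \<xi> \<eta> where "\<xi> \<in> bounded_sections X E" "\<eta> \<in> bounded_sections X E'" "a = tensor_section \<xi> \<eta> u"
      unfolding tensor_generators_def by blast
    then show "a \<in> ?l" using u by (auto simp: tensor_section_def)
  qed
  then show "htotal (tensor_fibre u) ((\<lambda>\<zeta>. \<zeta> u) ` tensor_generators)"
    using tensor_facts(5)[OF u A.htotal_bounded_sections[OF u] B.htotal_bounded_sections[OF u]] by simp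
next
  show "tensor_generators \<subseteq> (\<Pi>\<^sub>E u\<in>X. hcarrier (tensor_fibre u))"
  proof
    fix \<zeta> assume "\<zeta> \<in> tensor_generators"
    then obtain \<xi> \<eta> where \<zeta>: "\<zeta> = tensor_section \<xi> \<eta>"
      "\<xi> \<in> bounded_sections X E" "\<eta> \<in> bounded_sections X E'"
      unfolding tensor_generators_def by blast
    have "tensor u (\<xi> u) (\<eta> u) \<in> hcarrier (tensor_fibre u)" if u: "u \<in> X" for u
      by (rule tensor_facts(2)[OF u A.bounded_section_mem[OF \<zeta>(2) u] B.bounded_section_mem[OF \<zeta>(3) u]])
    then show "\<zeta> \<in> (\<Pi>\<^sub>E u\<in>X. hcarrier (tensor_fibre u))"
      unfolding \<zeta>(1) tensor_section_def by auto
  qed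
next
  fix \<zeta> \<zeta>' assume "\<zeta> \<in> tensor_generators" "\<zeta>' \<in> tensor_generators"
  then obtain \<xi> \<eta> \<xi>' \<eta>' where *: "\<zeta> = tensor_section \<xi> \<eta>" "\<zeta>' = tensor_section \<xi>' \<eta>'"
    and b: "\<xi> \<in> bounded_sections X E" "\<eta> \<in> bounded_sections X E'" "\<xi>' \<in> bounded_sections X E" "\<eta>' \<in> bounded_sections X E'"
    by (auto simp: tensor_generators_def)
  have s: "\<xi> \<in> sections E" "\<eta> \<in> sections E'" "\<xi>' \<in> sections E" "\<eta>' \<in> sections E'"
    using b by (auto simp: bounded_sections_def)
  have "continuous_on X (\<lambda>u. hinner (fibre E u) (\<xi> u) (\<xi>' u) * hinner (fibre E' u) (\<eta> u) (\<eta>' u))"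
    by (intro continuous_intros A.continuous_hinner B.continuous_hinner s)
  then show "continuous_on X (\<lambda>u. hinner (tensor_fibre u) (\<zeta> u) (\<zeta>' u))"
    using A.bounded_section_mem[OF b(1)] A.bounded_section_mem[OF b(3)]
      B.bounded_section_mem[OF b(2)] B.bounded_section_mem[OF b(4)]
    by (simp add: * tensor_section_def tensor_facts(3) cong: continuous_on_cong)
  have "hinner (tensor_fibre (rng x)) (tensor_L x (\<zeta> (src x))) (\<zeta>' (rng x))
    = coefficient G E L \<xi> \<xi>' x * coefficient G E' L' \<eta> \<eta>' x" for x
    using A.bounded_section_mem[OF b(1) units(1)[of x]] A.bounded_section_mem[OF b(3) units(2)[of x]]
      B.bounded_section_mem[OF b(2) units(1)[of x]] B.bounded_section_mem[OF b(4) units(2)[of x]]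
    by (simp add: * tensor_section_def units tensor_L(2) tensor_facts(3) L_mem coefficient_def)
  moreover have "continuous_on UNIV (\<lambda>x. coefficient G E L \<xi> \<xi>' x * coefficient G E' L' \<eta> \<eta>' x)"
    by (intro continuous_intros A.coefficient_continuous B.coefficient_continuous b)
  ultimately show "continuous_on UNIV (\<lambda>x. hinner (tensor_fibre (rng x)) (tensor_L x (\<zeta> (src x))) (\<zeta>' (rng x)))"
    by simp
qed (rule tensor_L(1), rule tensor_L_mult)

abbreviation "tensor_bundle \<equiv> generated_bundle X tensor_fibre tensor_generators"

lemma tensor_section_bounded:
  assumes \<xi>: "\<xi> \<in> bounded_sections X E" and \<eta>: "\<eta> \<in> bounded_sections X E'"
  shows "tensor_section \<xi> \<eta> \<in> bounded_sections X tensor_bundle"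
    and "section_norm X tensor_bundle (tensor_section \<xi> \<eta>) \<le> section_norm X E \<xi> * section_norm X E' \<eta>"
proof -
  have X: "X \<noteq> {}" by (simp add: unit_space_def)
  have "tensor_section \<xi> \<eta> \<in> tensor_generators" using assms by (auto simp: tensor_generators_def)
  then have s: "tensor_section \<xi> \<eta> \<in> sections tensor_bundle"
    using T.span_subset_sections by (auto intro: hspan.hspan_base)
  have n: "hnorm (fibre tensor_bundle u) (tensor_section \<xi> \<eta> u) \<le> section_norm X E \<xi> * section_norm X E' \<eta>"
    if u: "u \<in> X" for u
  proof -
    note m = A.bounded_section_mem[OF \<xi> u] B.bounded_section_mem[OF \<eta> u]
    have "hnorm (fibre tensor_bundle u) (tensor_section \<xi> \<eta> u) = hnorm (fibre E u) (\<xi> u) * hnorm (fibre E' u) (\<eta> u)"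
      using tensor_facts(4)[OF u m] u by (simp add: fibre_generated_bundle tensor_section_def)
    also have "\<dots> \<le> section_norm X E \<xi> * section_norm X E' \<eta>"
      by (intro mult_mono hnorm_le_section_norm \<xi> \<eta> u A.section_norm_nonneg[OF X]
          hilbert_space.hnorm_nonneg[OF B.fibre_hilbert[OF u] m(2)])
    finally show ?thesis .
  qed
  show "tensor_section \<xi> \<eta> \<in> bounded_sections X tensor_bundle" by (rule bounded_sectionI[OF s n])
  show "section_norm X tensor_bundle (tensor_section \<xi> \<eta>) \<le> section_norm X E \<xi> * section_norm X E' \<eta>"
    by (rule section_norm_le[OF X n])
qed

lemma coefficient_tensor_section:
  assumes b: "\<xi> \<in> bounded_sections X E" "\<eta> \<in> bounded_sections X E'" "\<xi>' \<in> bounded_sections X E" "\<eta>' \<in> bounded_sections X E'"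
  shows "coefficient G tensor_bundle tensor_L (tensor_section \<xi> \<eta>) (tensor_section \<xi>' \<eta>') x
    = coefficient G E L \<xi> \<xi>' x * coefficient G E' L' \<eta> \<eta>' x"
  using A.bounded_section_mem[OF b(1) units(1)[of x]] A.bounded_section_mem[OF b(3) units(2)[of x]]
    B.bounded_section_mem[OF b(2) units(1)[of x]] B.bounded_section_mem[OF b(4) units(2)[of x]]
  by (simp add: fibre_generated_bundle tensor_section_def units tensor_L(2) tensor_facts(3) L_mem coefficient_def)

end

section \<open>The trivial line bundle\<close>

definition complex_hspace :: "complex hspace"
  where "complex_hspace = \<lparr>hcarrier = UNIV, hzero = 0, hadd = (+), hscale = (*), hinner = (\<lambda>v w. cnj v * w)\<rparr>"

lemma complex_hspace_simps:
  "hcarrier complex_hspace = UNIV" "hzero complex_hspace = 0" "hadd complex_hspace = (+)"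
  "hscale complex_hspace = (*)" "hinner complex_hspace v w = cnj v * w" "hnorm complex_hspace v = cmod v"
  "hdist complex_hspace v w = dist v w"
proof -
  have "cmod v = sqrt (Re (cnj v * v))" for v by (simp add: cmod_def power2_eq_square)
  then show *: "hnorm complex_hspace v = cmod v" for v by (simp add: hnorm_def complex_hspace_def)
  show "hdist complex_hspace v w = dist v w"
    by (simp add: hdist_def norm_dist_def * dist_norm) (simp add: complex_hspace_def)
qed (simp_all add: complex_hspace_def)

lemma complex_hspace_hilbert_space: "hilbert_space complex_hspace"
proof -
  obtain C :: "complex set" where C: "countable C" "\<And>U. open U \<Longrightarrow> U \<noteq> {} \<Longrightarrow> \<exists>c\<in>C. c \<in> U"
    using countable_dense_exists[where 'a = complex] by blast
  show ?thesis
  proof (rule hilbert_spaceI[of _ C])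
    show "complex_normed_space (hcarrier complex_hspace) (hzero complex_hspace) (hadd complex_hspace)
        (hscale complex_hspace) (hnorm complex_hspace)"
      by unfold_locales
        (auto simp: complex_hspace_simps algebra_simps norm_mult norm_triangle_ineq intro: exI[of _ "- v" for v])
    fix f :: "nat \<Rightarrow> complex" assume "\<And>\<epsilon>. 0 < \<epsilon> \<Longrightarrow> \<exists>N. \<forall>m\<ge>N. \<forall>n\<ge>N. hdist complex_hspace (f m) (f n) < \<epsilon>"
    then have "Cauchy f" unfolding Cauchy_def complex_hspace_simps by blast
    then obtain l where "f \<longlonglongrightarrow> l" using Cauchy_convergent_iff convergent_def by blast
    then have "\<forall>\<epsilon>>0. \<exists>N. \<forall>n\<ge>N. dist (f n) l \<le> \<epsilon>" unfolding LIMSEQ_def by (meson less_imp_le)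
    then show "\<exists>l\<in>hcarrier complex_hspace. \<forall>\<epsilon>>0. \<exists>N. \<forall>n\<ge>N. hdist complex_hspace (f n) l \<le> \<epsilon>"
      by (auto simp: complex_hspace_simps)
  next
    fix v and \<epsilon> :: real assume "0 < \<epsilon>"
    then obtain c where "c \<in> C" "c \<in> ball v \<epsilon>" using C(2)[of "ball v \<epsilon>"] by auto
    then show "\<exists>c\<in>C. hdist complex_hspace v c < \<epsilon>" by (auto simp: complex_hspace_simps)
  qed (use C(1) in \<open>auto simp: complex_hspace_simps algebra_simps\<close>)
qed

lemma ex_bundle_coefficient_one:
  assumes G: "topological_groupoid G"
  shows "\<exists>(E :: ('g::topological_space, complex) hilbert_bundle) L \<xi>. G_hilbert_bundle G E L \<and>
    \<xi> \<in> bounded_sections (unit_space G) E \<and> section_norm (unit_space G) E \<xi> \<le> 1 \<and>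
    coefficient G E L \<xi> \<xi> = (\<lambda>x. 1)"
proof -
  let ?X = "unit_space G"
  define one :: "'g \<Rightarrow> complex" where "one = (\<lambda>u\<in>?X. 1)"
  have u: "source_map G x \<in> ?X" "range_map G x \<in> ?X" for x
    by (rule source_map_in_unit_space[OF G], simp add: unit_space_def)
  interpret G: topological_groupoid G by (rule G)
  interpret C: hilbert_space complex_hspace by (rule complex_hspace_hilbert_space)
  interpret generating_G_sections G "\<lambda>u. complex_hspace" "{one}" "\<lambda>x v. v"
  proof (intro generating_G_sections.intro generating_sections.intro generating_G_sections_axioms.intro G)
    show "hilbert_space complex_hspace" by (rule complex_hspace_hilbert_space)
    show "{one} \<subseteq> (\<Pi>\<^sub>E u\<in>?X. hcarrier complex_hspace)" by (auto simp: one_def complex_hspace_simps)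
    show "htotal complex_hspace ((\<lambda>\<xi>. \<xi> u) ` {one})" if u: "u \<in> ?X" for u
    proof -
      have "v \<in> hspan complex_hspace {1}" for v
      proof -
        have "hscale complex_hspace v 1 \<in> hspan complex_hspace {1}" by (intro hspan.intros) simp
        then show ?thesis by (simp add: complex_hspace_simps)
      qed
      then have "UNIV \<subseteq> hclspan complex_hspace {1}"
        using C.hspan_subset_hclspan[of "{1}"] unfolding complex_hspace_simps by blast
      then show ?thesis using u by (simp add: htotal_def complex_hspace_simps one_def)
    qed
    show "linear_isometry_onto complex_hspace complex_hspace (\<lambda>v. v)" by (simp add: linear_isometry_onto_def)
    show "continuous_on ?X (\<lambda>u. hinner complex_hspace (\<xi> u) (\<eta> u))"
      if "\<xi> \<in> {one}" "\<eta> \<in> {one}" for \<xi> \<eta>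
    proof -
      have "hinner complex_hspace (\<xi> u) (\<eta> u) = 1" if "u \<in> ?X" for u
        using \<open>\<xi> \<in> {one}\<close> \<open>\<eta> \<in> {one}\<close> that by (simp add: complex_hspace_simps one_def)
      then show ?thesis by (simp cong: continuous_on_cong)
    qed
    show "continuous_on UNIV (\<lambda>x. hinner complex_hspace (\<xi> (source_map G x)) (\<eta> (range_map G x)))"
      if "\<xi> \<in> {one}" "\<eta> \<in> {one}" for \<xi> \<eta>
      using that u by (simp add: complex_hspace_simps one_def)
  qed simp
  let ?E = "generated_bundle ?X (\<lambda>u. complex_hspace) {one}"
  have s: "one \<in> sections ?E" using span_subset_sections by (auto intro: hspan.hspan_base)
  have n: "hnorm (fibre ?E u) (one u) \<le> 1" if "u \<in> ?X" for u
    using that by (simp add: fibre_generated_bundle one_def complex_hspace_simps)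
  have "?X \<noteq> {}" by (simp add: unit_space_def)
  then have "section_norm ?X ?E one \<le> 1" using n by (rule section_norm_le)
  moreover have "coefficient G ?E (\<lambda>x v. v) one one = (\<lambda>x. 1)"
    by (simp add: coefficient_def fun_eq_iff fibre_generated_bundle complex_hspace_simps one_def u)
  ultimately show ?thesis using generated_G_hilbert_bundle bounded_sectionI[OF s n] by blast
qed

section \<open>The Fourier-Stieltjes norm\<close>

text \<open>Carries an estimate proved for every bound above the norm down to the norm itself. A
  zero factor is treated apart because the argument divides by it.\<close>

lemma le_mult_of_le_mult_greater:
  fixes a k y :: real
  assumes "0 \<le> k" "\<And>c. a < c \<Longrightarrow> y \<le> k * c"
  shows "y \<le> k * a"
proof (cases "k = 0")
  case True
  then show ?thesis using assms(2)[of "a + 1"] by simp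
next
  case False
  then have k: "0 < k" using assms(1) by simp
  have "y / k \<le> a"
  proof (rule dense_ge)
    fix c assume "a < c"
    then show "y / k \<le> c" using assms(2) k by (simp add: field_simps)
  qed
  then show ?thesis using k by (simp add: field_simps)
qed

context topological_groupoid
begin

abbreviation "snorm \<equiv> section_norm X"
abbreviation "BG \<equiv> fourier_stieltjes G"

lemma unit_space_nonempty: "X \<noteq> {}"
  by (simp add: unit_space_def)

lemma FS_representation_norm_nonneg:
  assumes "FS_representation G E L \<xi> \<eta> \<phi>"
  shows "0 \<le> snorm E \<xi>" "0 \<le> snorm E \<eta>"
proof -
  interpret G_hilbert_bundle G E L using assms by (simp add: FS_representation_def)
  have b: "\<xi> \<in> bounded_sections X E" "\<eta> \<in> bounded_sections X E"
    using assms by (simp_all add: FS_representation_def)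
  show "0 \<le> snorm E \<xi>" "0 \<le> snorm E \<eta>"
    by (rule section_norm_nonneg[OF unit_space_nonempty b(1)], rule section_norm_nonneg[OF unit_space_nonempty b(2)])
qed

lemma FS_representationD:
  assumes "FS_representation G E L \<xi> \<eta> \<phi>"
  shows "\<phi> \<in> BG"
    and "FS_norm G \<phi> \<le> snorm E \<xi> * snorm E \<eta>"
proof -
  show "\<phi> \<in> BG" using assms by (auto simp: fourier_stieltjes_def)
  show "FS_norm G \<phi> \<le> snorm E \<xi> * snorm E \<eta>"
    unfolding FS_norm_def
  proof (rule cInf_lower)
    show "bdd_below {snorm E \<xi> * snorm E \<eta> |
        E L \<xi> \<eta>. FS_representation G E L \<xi> \<eta> \<phi>}"
    proof (rule bdd_belowI[of _ 0])
      fix a assume "a \<in> {snorm E \<xi> * snorm E \<eta> |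
        E L \<xi> \<eta>. FS_representation G E L \<xi> \<eta> \<phi>}"
      then obtain E L \<xi> \<eta> where r: "FS_representation G E L \<xi> \<eta> \<phi>"
        "a = snorm E \<xi> * snorm E \<eta>" by blast
      show "0 \<le> a" unfolding r(2) by (rule mult_nonneg_nonneg[OF FS_representation_norm_nonneg[OF r(1)]])
    qed
  qed (use assms in blast)
qed

text \<open>The fibre type is arbitrary here: this is the entry point for the constructed bundles,
  whose fibres are sequences of vectors or complex numbers.\<close>

lemma coefficient_fourier_stieltjes:
  assumes "G_hilbert_bundle G E L"
    and "\<xi> \<in> bounded_sections X E" "\<eta> \<in> bounded_sections X E"
  shows "coefficient G E L \<xi> \<eta> \<in> BG"
    and "FS_norm G (coefficient G E L \<xi> \<eta>)
      \<le> snorm E \<xi> * snorm E \<eta>"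
proof -
  obtain E' L' \<xi>' \<eta>' where *: "FS_representation G E' L' \<xi>' \<eta>' (coefficient G E L \<xi> \<eta>)"
    "snorm E' \<xi>' = snorm E \<xi>"
    "snorm E' \<eta>' = snorm E \<eta>"
    using G_hilbert_bundle_transfer[OF topological_groupoid_axioms assms] by (elim exE conjE)
  from FS_representationD[OF *(1)]
  show "coefficient G E L \<xi> \<eta> \<in> BG"
    "FS_norm G (coefficient G E L \<xi> \<eta>) \<le> snorm E \<xi> * snorm E \<eta>"
    unfolding *(2,3) .
qed

text \<open>The strict inequality stands in for an optimal representation, since the infimum might
  not be attained.\<close>

lemma ex_FS_representation_less:
  assumes "\<phi> \<in> BG" "FS_norm G \<phi> < c"
  obtains E L \<xi> \<eta> where "FS_representation G E L \<xi> \<eta> \<phi>"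
    "snorm E \<xi> * snorm E \<eta> < c"
proof -
  let ?S = "{snorm E \<xi> * snorm E \<eta> |
    E L \<xi> \<eta>. FS_representation G E L \<xi> \<eta> \<phi>}"
  have "?S \<noteq> {}" using assms(1) by (auto simp: fourier_stieltjes_def)
  moreover have "Inf ?S < c" using assms(2) unfolding FS_norm_def .
  ultimately have "\<exists>y\<in>?S. y < c" by (rule cInf_lessD)
  then obtain y where "y \<in> ?S" "y < c" by (elim bexE)
  then show ?thesis using that by (elim CollectE exE conjE) simp
qed

text \<open>Every representation bounds the values by the product of its section norms.
  Definiteness, nonnegativity and the pointwise convergence in the completeness proof all rest on
  this.\<close>

lemma cmod_le_FS_norm:
  assumes "\<phi> \<in> BG"
  shows "cmod (\<phi> x) \<le> FS_norm G \<phi>"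
proof (rule dense_ge)
  fix c assume "FS_norm G \<phi> < c"
  then obtain E L \<xi> \<eta> where r: "FS_representation G E L \<xi> \<eta> \<phi>"
    "snorm E \<xi> * snorm E \<eta> < c"
    using ex_FS_representation_less[OF assms] by blast
  then have "cmod (\<phi> x) \<le> snorm E \<xi> * snorm E \<eta>"
    using G_hilbert_bundle.coefficient_le[OF _ topological_groupoid_axioms]
    unfolding FS_representation_def by blast
  then show "cmod (\<phi> x) \<le> c" using r(2) by simp
qed

lemma FS_norm_nonneg: "\<phi> \<in> BG \<Longrightarrow> 0 \<le> FS_norm G \<phi>"
  using cmod_le_FS_norm[of \<phi>] norm_ge_zero order_trans by blast

lemma coefficient_scale_right:
  assumes "G_hilbert_bundle G E L"
    and \<xi>: "\<xi> \<in> bounded_sections X E" and \<eta>: "\<eta> \<in> bounded_sections X E"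
  shows "coefficient G E L \<xi> (\<lambda>u\<in>X. hscale (fibre E u) c (\<eta> u)) x = c * coefficient G E L \<xi> \<eta> x"
    and "coefficient G E L (\<lambda>u\<in>X. hscale (fibre E u) c (\<xi> u)) \<eta> x = cnj c * coefficient G E L \<xi> \<eta> x"
proof -
  interpret G_hilbert_bundle G E L by fact
  let ?s = "src x" and ?r = "rng x"
  have u: "?s \<in> X" "?r \<in> X"
    by (rule units)+
  interpret R: hilbert_space "fibre E ?r" by (rule fibre_hilbert[OF u(2)])
  note m = bounded_section_mem[OF \<xi> u(1)] bounded_section_mem[OF \<eta> u(2)]
  note L = hlinearD[OF linear_isometry_onto_hlinear[OF L_isometry[of x]] m(1)]
  show "coefficient G E L \<xi> (\<lambda>u\<in>X. hscale (fibre E u) c (\<eta> u)) x = c * coefficient G E L \<xi> \<eta> x"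
    "coefficient G E L (\<lambda>u\<in>X. hscale (fibre E u) c (\<xi> u)) \<eta> x = cnj c * coefficient G E L \<xi> \<eta> x"
    using u m L by (simp_all add: coefficient_def R.hinner_scale R.hinner_scale_left)
qed

lemma FS_scale_le:
  assumes "\<phi> \<in> BG"
  shows "(\<lambda>x. k * \<phi> x) \<in> BG" and "FS_norm G (\<lambda>x. k * \<phi> x) \<le> cmod k * FS_norm G \<phi>"
proof -
  have *: "(\<lambda>x. k * \<phi> x) \<in> BG \<and> FS_norm G (\<lambda>x. k * \<phi> x) \<le> cmod k * c"
    if c: "FS_norm G \<phi> < c" for c
  proof -
    obtain E L \<xi> \<eta> where r: "FS_representation G E L \<xi> \<eta> \<phi>"
      "snorm E \<xi> * snorm E \<eta> < c"
      using ex_FS_representation_less[OF assms c] by blast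
    interpret G_hilbert_bundle G E L using r(1) by (simp add: FS_representation_def)
    have b: "\<xi> \<in> bounded_sections X E" "\<eta> \<in> bounded_sections X E"
      "\<phi> = coefficient G E L \<xi> \<eta>" using r(1) by (auto simp: FS_representation_def)
    let ?\<eta> = "\<lambda>u\<in>X. hscale (fibre E u) k (\<eta> u)"
    note s = scaled_section[OF unit_space_nonempty b(2), of k]
    have e: "(\<lambda>x. k * \<phi> x) = coefficient G E L \<xi> ?\<eta>"
      unfolding b(3) fun_eq_iff using coefficient_scale_right(1)[OF G_hilbert_bundle_axioms b(1,2)] by simp
    have "snorm E \<xi> * snorm E ?\<eta>
        \<le> snorm E \<xi> * (cmod k * snorm E \<eta>)"
      by (intro mult_left_mono s(2) FS_representation_norm_nonneg(1)[OF r(1)])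
    also have "\<dots> = cmod k * (snorm E \<xi> * snorm E \<eta>)" by simp
    also have "\<dots> \<le> cmod k * c" using r(2) by (intro mult_left_mono) auto
    finally show ?thesis
      unfolding e using coefficient_fourier_stieltjes[OF G_hilbert_bundle_axioms b(1) s(1)] by simp
  qed
  show "(\<lambda>x. k * \<phi> x) \<in> BG"
    by (rule conjunct1[OF *[of "FS_norm G \<phi> + 1"]]) simp
  show "FS_norm G (\<lambda>x. k * \<phi> x) \<le> cmod k * FS_norm G \<phi>"
    by (rule le_mult_of_le_mult_greater[OF norm_ge_zero conjunct2[OF *]])
qed

lemma FS_norm_scale:
  assumes "\<phi> \<in> BG"
  shows "FS_norm G (\<lambda>x. k * \<phi> x) = cmod k * FS_norm G \<phi>"
proof (rule antisym)
  show "FS_norm G (\<lambda>x. k * \<phi> x) \<le> cmod k * FS_norm G \<phi>" by (rule FS_scale_le(2)[OF assms])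
  show "cmod k * FS_norm G \<phi> \<le> FS_norm G (\<lambda>x. k * \<phi> x)"
  proof (cases "k = 0")
    case True
    then show ?thesis using FS_norm_nonneg[OF FS_scale_le(1)[OF assms, of k]] by simp
  next
    case False
    \<comment> \<open>The reverse inequality is the forward one for the factor
      \<open>1 / k\<close>.\<close>
    have "FS_norm G \<phi> \<le> cmod (1 / k) * FS_norm G (\<lambda>x. k * \<phi> x)"
      using FS_scale_le(2)[OF FS_scale_le(1)[OF assms, of k], of "1 / k"] False by simp
    then show ?thesis using False by (simp add: norm_divide field_simps)
  qed
qed

lemma FS_one:
  shows "(\<lambda>x. 1) \<in> BG" and "FS_norm G (\<lambda>x. 1) = 1"
proof -
  obtain E :: "('g, complex) hilbert_bundle" and L \<xi> where *: "G_hilbert_bundle G E L"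
    "\<xi> \<in> bounded_sections X E" "snorm E \<xi> \<le> 1"
    "coefficient G E L \<xi> \<xi> = (\<lambda>x. 1)"
    using ex_bundle_coefficient_one[OF topological_groupoid_axioms] by blast
  interpret G_hilbert_bundle G E L by fact
  note c = coefficient_fourier_stieltjes[OF *(1,2,2), unfolded *(4)]
  show "(\<lambda>x. 1) \<in> BG" by (rule c(1))
  have "snorm E \<xi> * snorm E \<xi> \<le> 1 * 1"
    using *(3) section_norm_nonneg[OF unit_space_nonempty *(2)] by (intro mult_mono) auto
  \<comment> \<open>The lower bound is the supremum estimate: the function has value 1 on the
    nonempty space \<open>G\<close>.\<close>
  then show "FS_norm G (\<lambda>x. 1) = 1"
    using c(2) cmod_le_FS_norm[OF c(1)] by simp
qed

lemma FS_zero: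
  shows "(\<lambda>x. 0) \<in> BG" and "FS_norm G (\<lambda>x. 0) = 0"
  using FS_scale_le(1)[OF FS_one(1), of 0] FS_norm_scale[OF FS_one(1), of 0] by simp_all

text \<open>Scaling \<open>\<xi>\<close> and \<open>\<eta>\<close> by reciprocal factors balances their norms.\<close>

lemma ex_FS_representation_balanced:
  assumes "\<phi> \<in> BG" "FS_norm G \<phi> < c"
  shows "\<exists>E L \<xi> \<eta>. FS_representation G E L \<xi> \<eta> \<phi> \<and>
    snorm E \<xi> \<le> sqrt c \<and> snorm E \<eta> \<le> sqrt c"
proof -
  obtain E L \<xi> \<eta> where r: "FS_representation G E L \<xi> \<eta> \<phi>"
    "snorm E \<xi> * snorm E \<eta> < c"
    using ex_FS_representation_less[OF assms] by blast
  interpret G_hilbert_bundle G E L using r(1) by (simp add: FS_representation_def)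
  have b: "\<xi> \<in> bounded_sections X E" "\<eta> \<in> bounded_sections X E"
    "\<phi> = coefficient G E L \<xi> \<eta>" using r(1) by (auto simp: FS_representation_def)
  define p where "p = snorm E \<xi>"
  define q where "q = snorm E \<eta>"
  have pq: "0 \<le> p" "0 \<le> q" "p * q < c" using FS_representation_norm_nonneg[OF r(1)] r(2) by (auto simp: p_def q_def)
  have c: "0 < c" by (rule le_less_trans[OF mult_nonneg_nonneg[OF pq(1,2)] pq(3)])
  \<comment> \<open>Otherwise \<open>t = q / sqrt c\<close> makes the second norm exactly
    \<open>sqrt c\<close> and the first at most \<open>sqrt c\<close> by \<open>p * q < c\<close>.
    If \<open>q = 0\<close> only \<open>p\<close> has to be shrunk.\<close>
  have "\<exists>t>0. t * p \<le> sqrt c \<and> q / t \<le> sqrt c"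
  proof (cases "q = 0")
    case True
    have "sqrt c / (p + 1) * p = sqrt c * (p / (p + 1))" by simp
    also have "\<dots> \<le> sqrt c * 1" using pq c by (intro mult_left_mono) auto
    finally show ?thesis using True c pq by (intro exI[of _ "sqrt c / (p + 1)"]) auto
  next
    case False
    have "q / sqrt c * p = (p * q) / sqrt c" by simp
    also have "\<dots> \<le> c / sqrt c" using pq c by (intro divide_right_mono) auto
    also have "\<dots> = sqrt c" using c by (simp add: real_div_sqrt)
    finally show ?thesis using False pq c by (intro exI[of _ "q / sqrt c"]) auto
  qed
  then obtain t where t: "0 < t" "t * p \<le> sqrt c" "q / t \<le> sqrt c" by blast
  let ?s = "complex_of_real t" and ?s' = "complex_of_real (1 / t)"
  let ?\<xi> = "\<lambda>u\<in>X. hscale (fibre E u) ?s (\<xi> u)"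
  let ?\<eta> = "\<lambda>u\<in>X. hscale (fibre E u) ?s' (\<eta> u)"
  note s = scaled_section[OF unit_space_nonempty b(1), of ?s] scaled_section[OF unit_space_nonempty b(2), of ?s']
  have "coefficient G E L ?\<xi> ?\<eta> x = \<phi> x" for x
    using coefficient_scale_right(1)[OF G_hilbert_bundle_axioms s(1) b(2), of ?s' x]
      coefficient_scale_right(2)[OF G_hilbert_bundle_axioms b(1,2), of ?s x] t(1)
    by (simp add: b(3))
  then have "FS_representation G E L ?\<xi> ?\<eta> \<phi>"
    using s(1,3) G_hilbert_bundle_axioms by (auto simp: FS_representation_def)
  moreover have "snorm E ?\<xi> \<le> sqrt c" "snorm E ?\<eta> \<le> sqrt c"
    using s(2,4) t by (simp_all add: p_def q_def norm_divide)
  ultimately show ?thesis by blast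
qed

text \<open>Balancing bounds both section norms of the term \<open>n\<close> by
  \<open>sqrt (c n)\<close>. Their squares are then summable, each of the two sum sections has norm
  at most the root of the total, and the product of the two roots is the total.\<close>

lemma FS_suminf:
  assumes \<phi>: "\<And>n. \<phi> n \<in> BG" and less: "\<And>n. FS_norm G (\<phi> n) < c n" and c: "summable c"
  shows "(\<lambda>x. \<Sum>n. \<phi> n x) \<in> BG" and "FS_norm G (\<lambda>x. \<Sum>n. \<phi> n x) \<le> (\<Sum>n. c n)"
proof -
  have "\<forall>n. \<exists>E L \<xi> \<eta>. FS_representation G E L \<xi> \<eta> (\<phi> n) \<and>
    snorm E \<xi> \<le> sqrt (c n) \<and> snorm E \<eta> \<le> sqrt (c n)"
    using ex_FS_representation_balanced[OF \<phi> less] by blast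
  then obtain E L \<xi> \<eta> where r: "\<And>n. FS_representation G (E n) (L n) (\<xi> n) (\<eta> n) (\<phi> n)"
    and le: "\<And>n. snorm (E n) (\<xi> n) \<le> sqrt (c n)"
      "\<And>n. snorm (E n) (\<eta> n) \<le> sqrt (c n)" by metis
  interpret S: G_hilbert_bundle_sequence G E L
    using r topological_groupoid_axioms
    by (intro G_hilbert_bundle_sequence.intro G_hilbert_bundle_sequence_axioms.intro)
      (auto simp: FS_representation_def)
  have b: "\<xi> n \<in> bounded_sections X (E n)" "\<eta> n \<in> bounded_sections X (E n)"
    and \<phi>_eq: "\<phi> n = coefficient G (E n) (L n) (\<xi> n) (\<eta> n)" for n
    using r[of n] by (auto simp: FS_representation_def)
  have c0: "0 \<le> c n" for n using FS_norm_nonneg[OF \<phi>, of n] less[of n] by simp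
  have sq: "(snorm (E n) (\<xi> n))\<^sup>2 \<le> c n" "(snorm (E n) (\<eta> n))\<^sup>2 \<le> c n" for n
    using power_mono[OF le(1)[of n] FS_representation_norm_nonneg(1)[OF r], of 2]
      power_mono[OF le(2)[of n] FS_representation_norm_nonneg(2)[OF r], of 2] c0[of n] by simp_all
  have sm: "summable (\<lambda>n. (snorm (E n) (\<xi> n))\<^sup>2)"
    "summable (\<lambda>n. (snorm (E n) (\<eta> n))\<^sup>2)"
    using sq by (auto intro!: summable_comparison_test'[OF c])
  note \<xi> = S.sum_section_bounded[of \<xi>, OF b(1) sm(1)]
  note \<eta> = S.sum_section_bounded[of \<eta>, OF b(2) sm(2)]
  have e: "(\<lambda>x. \<Sum>n. \<phi> n x) = coefficient G S.sum_bundle S.sum_L (S.sum_section \<xi>) (S.sum_section \<eta>)"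
    by (simp add: fun_eq_iff S.coefficient_sum_section \<phi>_eq)
  note gen = S.sum.generated_G_hilbert_bundle
  note co = coefficient_fourier_stieltjes[OF gen \<xi>(1) \<eta>(1)]
  show "(\<lambda>x. \<Sum>n. \<phi> n x) \<in> BG" unfolding e by (rule co(1))
  have "snorm S.sum_bundle (S.sum_section \<xi>) \<le> sqrt (\<Sum>n. c n)"
    using \<xi>(2) real_sqrt_le_mono[OF suminf_le[OF sq(1) sm(1) c]] by linarith
  moreover have "snorm S.sum_bundle (S.sum_section \<eta>) \<le> sqrt (\<Sum>n. c n)"
    using \<eta>(2) real_sqrt_le_mono[OF suminf_le[OF sq(2) sm(2) c]] by linarith
  moreover have "0 \<le> snorm S.sum_bundle (S.sum_section \<eta>)"
    by (rule continuous_hilbert_bundle.section_norm_nonneg[OF S.sum.generated_bundle_continuous unit_space_nonempty \<eta>(1)])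
  ultimately have "snorm S.sum_bundle (S.sum_section \<xi>) *
      snorm S.sum_bundle (S.sum_section \<eta>) \<le> sqrt (\<Sum>n. c n) * sqrt (\<Sum>n. c n)"
    using suminf_nonneg[OF c c0] by (intro mult_mono) auto
  also have "\<dots> = (\<Sum>n. c n)" using suminf_nonneg[OF c c0] by simp
  finally show "FS_norm G (\<lambda>x. \<Sum>n. \<phi> n x) \<le> (\<Sum>n. c n)"
    using co(2) unfolding e by linarith
qed

text \<open>The series estimate for a sequence that vanishes after two terms.\<close>

lemma FS_add:
  assumes \<phi>: "\<phi> \<in> BG" and \<psi>: "\<psi> \<in> BG"
  shows "(\<lambda>x. \<phi> x + \<psi> x) \<in> BG"
    and "FS_norm G (\<lambda>x. \<phi> x + \<psi> x) \<le> FS_norm G \<phi> + FS_norm G \<psi>"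
proof -
  define f where "f n = (if n = 0 then \<phi> else if n = 1 then \<psi> else (\<lambda>x. 0))" for n :: nat
  have "(\<lambda>n. f n x) sums (\<Sum>n<2. f n x)" for x
    by (rule sums_finite) (auto simp: f_def)
  then have sum: "(\<lambda>x. \<Sum>n. f n x) = (\<lambda>x. \<phi> x + \<psi> x)"
    by (auto simp: sums_iff fun_eq_iff f_def numeral_2_eq_2)
  have *: "(\<lambda>x. \<phi> x + \<psi> x) \<in> BG \<and>
      FS_norm G (\<lambda>x. \<phi> x + \<psi> x) \<le> FS_norm G \<phi> + FS_norm G \<psi> + \<epsilon>" if "0 < \<epsilon>" for \<epsilon>
  proof -
    \<comment> \<open>The geometric surplus has total \<epsilon> and makes every bound strict,
      including those for the zero terms.\<close>
    define c where "c n = FS_norm G (f n) + \<epsilon> / 2 * (1 / 2) ^ n" for n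
    have "(\<lambda>n. FS_norm G (f n)) sums (\<Sum>n<2. FS_norm G (f n))"
      by (rule sums_finite) (auto simp: f_def FS_zero)
    moreover have "(\<lambda>n. \<epsilon> / 2 * (1 / 2) ^ n) sums (\<epsilon> / 2 * (1 / (1 - 1 / 2)))"
      by (intro sums_mult geometric_sums) simp
    ultimately have c: "c sums (FS_norm G \<phi> + FS_norm G \<psi> + \<epsilon>)"
      unfolding c_def by (auto dest: sums_add simp: f_def numeral_2_eq_2)
    have "f n \<in> BG" "FS_norm G (f n) < c n" for n
      using \<phi> \<psi> FS_zero that by (auto simp: f_def c_def)
    from FS_suminf[of f c, OF this sums_summable[OF c]] show ?thesis
      unfolding sum using sums_unique[OF c] by simp
  qed
  show "(\<lambda>x. \<phi> x + \<psi> x) \<in> BG" by (rule conjunct1[OF *[of 1]]) simp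
  show "FS_norm G (\<lambda>x. \<phi> x + \<psi> x) \<le> FS_norm G \<phi> + FS_norm G \<psi>"
    by (rule field_le_epsilon) (rule conjunct2[OF *])
qed

lemma FS_mult:
  assumes \<phi>: "\<phi> \<in> BG" and \<psi>: "\<psi> \<in> BG"
  shows "(\<lambda>x. \<phi> x * \<psi> x) \<in> BG"
    and "FS_norm G (\<lambda>x. \<phi> x * \<psi> x) \<le> FS_norm G \<phi> * FS_norm G \<psi>"
proof -
  have *: "(\<lambda>x. \<phi> x * \<psi> x) \<in> BG \<and> FS_norm G (\<lambda>x. \<phi> x * \<psi> x) \<le> a * b"
    if a: "FS_norm G \<phi> < a" and b: "FS_norm G \<psi> < b" for a b
  proof -
    obtain E L \<xi> \<eta> where r: "FS_representation G E L \<xi> \<eta> \<phi>"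
      "snorm E \<xi> * snorm E \<eta> < a"
      using ex_FS_representation_less[OF \<phi> a] by blast
    obtain E' L' \<xi>' \<eta>' where r': "FS_representation G E' L' \<xi>' \<eta>' \<psi>"
      "snorm E' \<xi>' * snorm E' \<eta>' < b"
      using ex_FS_representation_less[OF \<psi> b] by blast
    interpret P: G_hilbert_bundle_pair G E L E' L'
      using r(1) r'(1) topological_groupoid_axioms
      by (intro G_hilbert_bundle_pair.intro) (auto simp: FS_representation_def)
    have m: "\<xi> \<in> bounded_sections X E" "\<eta> \<in> bounded_sections X E"
      "\<xi>' \<in> bounded_sections X E'" "\<eta>' \<in> bounded_sections X E'"
      and e: "\<phi> = coefficient G E L \<xi> \<eta>" "\<psi> = coefficient G E' L' \<xi>' \<eta>'"
      using r(1) r'(1) by (auto simp: FS_representation_def)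
    note s = P.tensor_section_bounded[OF m(1,3)] P.tensor_section_bounded[OF m(2,4)]
    have eq: "(\<lambda>x. \<phi> x * \<psi> x) = coefficient G P.tensor_bundle P.tensor_L (P.tensor_section \<xi> \<xi>') (P.tensor_section \<eta> \<eta>')"
      using P.coefficient_tensor_section[OF m(1,3,2,4)] by (simp add: fun_eq_iff e)
    note nn = FS_representation_norm_nonneg[OF r(1)] FS_representation_norm_nonneg[OF r'(1)]
    have "snorm P.tensor_bundle (P.tensor_section \<xi> \<xi>')
        * snorm P.tensor_bundle (P.tensor_section \<eta> \<eta>')
      \<le> (snorm E \<xi> * snorm E' \<xi>')
        * (snorm E \<eta> * snorm E' \<eta>')"
      by (intro mult_mono s(2,4) mult_nonneg_nonneg nn
          continuous_hilbert_bundle.section_norm_nonneg[OF P.T.generated_bundle_continuous unit_space_nonempty s(3)])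
    also have "\<dots> = (snorm E \<xi> * snorm E \<eta>)
        * (snorm E' \<xi>' * snorm E' \<eta>')" by (simp add: mult_ac)
    also have "\<dots> \<le> a * b"
      using r(2) r'(2) FS_norm_nonneg[OF \<phi>] a nn by (intro mult_mono) auto
    finally show ?thesis
      unfolding eq using coefficient_fourier_stieltjes[OF P.T.generated_G_hilbert_bundle s(1,3)] by simp
  qed
  show "(\<lambda>x. \<phi> x * \<psi> x) \<in> BG"
    by (rule conjunct1[OF *[of "FS_norm G \<phi> + 1" "FS_norm G \<psi> + 1"]]) simp_all
  show "FS_norm G (\<lambda>x. \<phi> x * \<psi> x) \<le> FS_norm G \<phi> * FS_norm G \<psi>"
  \<comment> \<open>The two infima are approached separately: the outer rule handles \<psi>, the
    inner one \<phi> with \<open>b\<close> fixed.\<close>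
  proof (rule le_mult_of_le_mult_greater[OF FS_norm_nonneg[OF \<phi>]])
    fix b assume b: "FS_norm G \<psi> < b"
    have "FS_norm G (\<lambda>x. \<phi> x * \<psi> x) \<le> b * FS_norm G \<phi>"
    proof (rule le_mult_of_le_mult_greater)
      show "0 \<le> b" using b FS_norm_nonneg[OF \<psi>] by simp
      show "FS_norm G (\<lambda>x. \<phi> x * \<psi> x) \<le> b * a" if "FS_norm G \<phi> < a" for a
        using conjunct2[OF *[OF that b]] by (simp add: mult.commute)
    qed
    then show "FS_norm G (\<lambda>x. \<phi> x * \<psi> x) \<le> FS_norm G \<phi> * b" by (simp add: mult.commute)
  qed
qed

lemma FS_diff:
  assumes "\<phi> \<in> BG" "\<psi> \<in> BG"
  shows "(\<lambda>x. \<phi> x - \<psi> x) \<in> BG"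
  using FS_add(1)[OF assms(1) FS_scale_le(1)[OF assms(2), of "-1"]] by simp

text \<open>A rapidly Cauchy subsequence telescopes into a series with norms below a geometric one.
  Its sum exists pointwise by the supremum bound, and the series estimate applied to its tails shows
  both membership of the limit and convergence in norm.\<close>

lemma FS_complete:
  fixes f :: "nat \<Rightarrow> 'g \<Rightarrow> complex"
  assumes f: "\<And>n. f n \<in> BG"
    and cauchy: "\<And>\<epsilon>. 0 < \<epsilon> \<Longrightarrow> \<exists>N. \<forall>m\<ge>N. \<forall>n\<ge>N. FS_norm G (\<lambda>x. f m x - f n x) < \<epsilon>"
  shows "\<exists>l\<in>BG. \<forall>\<epsilon>>0. \<exists>N. \<forall>n\<ge>N. FS_norm G (\<lambda>x. f n x - l x) \<le> \<epsilon>"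
proof -
  have "\<exists>M. \<forall>k. (\<forall>m\<ge>M k. \<forall>n\<ge>M k. FS_norm G (\<lambda>x. f m x - f n x) < (1 / 2) ^ k)"
    by (rule choice) (use cauchy in simp)
  then obtain M :: "nat \<Rightarrow> nat" where M: "\<And>k m n. \<lbrakk>m \<ge> M k; n \<ge> M k\<rbrakk> \<Longrightarrow> FS_norm G (\<lambda>x. f m x - f n x) < (1 / 2) ^ k"
    by blast
  \<comment> \<open>Partial sums of \<open>M\<close> are used in place of \<open>M\<close> so that
    consecutive indices \<open>N k\<close> and \<open>N (Suc k)\<close> both lie beyond
    \<open>M k\<close>.\<close>
  define N where "N k = (\<Sum>j\<le>k. M j)" for k
  have N1: "M k \<le> N k" for k unfolding N_def by (rule member_le_sum) auto
  have N: "M k \<le> N k" "M k \<le> N (Suc k)" for k using N1[of k] by (simp_all add: N_def)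
  define \<phi> where "\<phi> k = (\<lambda>x. f (N (Suc k)) x - f (N k) x)" for k
  have \<phi>: "\<phi> k \<in> BG" "FS_norm G (\<phi> k) < (1 / 2) ^ k" for k
    using FS_diff[OF f f] M[OF N(2,1)] by (auto simp: \<phi>_def)
  have geo: "summable (\<lambda>j. (1 / 2 :: real) ^ (j + k))" "(\<Sum>j. (1 / 2 :: real) ^ (j + k)) = 2 * (1 / 2) ^ k" for k
    using suminf_mult[of "\<lambda>j. (1 / 2 :: real) ^ j" "(1 / 2) ^ k"] suminf_geometric[of "1 / 2 :: real"]
    by (auto simp: power_add mult.commute intro!: summable_mult summable_mult2 summable_geometric)
  have sm: "summable (\<lambda>k. \<phi> k x)" for x
  proof (rule summable_comparison_test'[where N = 0])
    show "summable (\<lambda>j. (1 / 2 :: real) ^ j)" using geo(1)[of 0] by simp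
    show "norm (\<phi> k x) \<le> (1 / 2) ^ k" for k using cmod_le_FS_norm[OF \<phi>(1), of k x] \<phi>(2)[of k] by simp
  qed
  define l where "l x = f (N 0) x + (\<Sum>k. \<phi> k x)" for x
  have tail: "(\<lambda>x. \<Sum>j. \<phi> (j + k) x) = (\<lambda>x. l x - f (N k) x)" for k
  proof
    fix x
    have "(\<Sum>j<k. \<phi> j x) = f (N k) x - f (N 0) x" unfolding \<phi>_def by (rule sum_lessThan_telescope)
    then show "(\<Sum>j. \<phi> (j + k) x) = l x - f (N k) x"
      using suminf_split_initial_segment[OF sm, of x k] by (simp add: l_def)
  qed
  have d: "(\<lambda>x. l x - f (N k) x) \<in> BG" "FS_norm G (\<lambda>x. l x - f (N k) x) \<le> 2 * (1 / 2) ^ k" for k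
    using FS_suminf[of "\<lambda>j. \<phi> (j + k)" "\<lambda>j. (1 / 2) ^ (j + k)", OF \<phi> geo(1)] unfolding tail geo(2) .
  \<comment> \<open>The tail with \<open>k = 0\<close> is \<open>l\<close> minus
    \<open>f (N 0)\<close>, so adding back \<open>f (N 0)\<close> recovers \<open>l\<close>.\<close>
  have l: "l \<in> BG" using FS_add(1)[OF d(1)[of 0] f[of "N 0"]] by simp
  have "\<exists>K. \<forall>n\<ge>K. FS_norm G (\<lambda>x. f n x - l x) \<le> \<epsilon>" if "0 < \<epsilon>" for \<epsilon>
  proof -
    have "0 < \<epsilon> / 3" using that by simp
    \<comment> \<open>The tail contributes twice the power and the Cauchy condition once, so three
      times the power must stay below \<epsilon>.\<close>
    from real_arch_pow_inv[OF this, of "1 / 2"] obtain k where k: "(1 / 2) ^ k < \<epsilon> / 3" by auto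
    have "FS_norm G (\<lambda>x. f n x - l x) \<le> \<epsilon>" if "n \<ge> N k" for n
    proof -
      have "FS_norm G (\<lambda>x. f (N k) x - l x) \<le> 2 * (1 / 2) ^ k"
        using FS_norm_scale[OF d(1)[of k], of "-1"] d(2)[of k] by simp
      moreover have "FS_norm G (\<lambda>x. f n x - f (N k) x) < (1 / 2) ^ k"
        using M[of k n "N k"] that N(1)[of k] by simp
      moreover have "FS_norm G (\<lambda>x. f n x - l x) \<le> FS_norm G (\<lambda>x. f n x - f (N k) x) + FS_norm G (\<lambda>x. f (N k) x - l x)"
        using FS_add(2)[OF FS_diff[OF f[of n] f[of "N k"]] FS_diff[OF f[of "N k"] l]] by simp
      ultimately show ?thesis using k by linarith
    qed
    then show ?thesis by blast
  qed
  then show ?thesis using l by blast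
qed

lemma FS_normed_space:
  "complex_normed_space (BG) (\<lambda>x. 0) (\<lambda>\<phi> \<psi> x. \<phi> x + \<psi> x) (\<lambda>c \<phi> x. c * \<phi> x) (FS_norm G)"
proof
  fix \<phi> assume \<phi>: "\<phi> \<in> BG"
  have "(\<lambda>x. - 1 * \<phi> x) \<in> BG" by (rule FS_scale_le(1)[OF \<phi>])
  then show "\<exists>\<psi>\<in>BG. (\<lambda>x. \<phi> x + \<psi> x) = (\<lambda>x. 0)" by (intro bexI) auto
  show "FS_norm G \<phi> = 0 \<longleftrightarrow> \<phi> = (\<lambda>x. 0)"
  proof
    assume "FS_norm G \<phi> = 0"
    then show "\<phi> = (\<lambda>x. 0)" using cmod_le_FS_norm[OF \<phi>] by auto
  qed (simp add: FS_zero)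
qed (simp_all add: FS_zero FS_add FS_scale_le(1) FS_norm_scale FS_norm_nonneg algebra_simps)

end

theorem theorem2:
  fixes G :: "'g::{second_countable_topology, t2_space} groupoid"
    and lam :: "'g \<Rightarrow> 'g measure"
  assumes "topological_groupoid G"
    and "locally_compact_space (euclidean :: 'g topology)"
    and "left_haar_system G lam"
  shows "unital_commutative_banach_algebra (fourier_stieltjes G)
    (\<lambda>x. 0) (\<lambda>\<phi> \<psi> x. \<phi> x + \<psi> x) (\<lambda>c \<phi> x. c * \<phi> x) (FS_norm G)
    (\<lambda>\<phi> \<psi> x. \<phi> x * \<psi> x) (\<lambda>x. 1)"
proof -
  interpret G: topological_groupoid G by fact
  interpret N: complex_normed_space "fourier_stieltjes G" "\<lambda>x. 0" "\<lambda>\<phi> \<psi> x. \<phi> x + \<psi> x" "\<lambda>c \<phi> x. c * \<phi> x" "FS_norm G"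
    by (rule G.FS_normed_space)
  show ?thesis
  proof
    show "Metric_space.mcomplete (fourier_stieltjes G)
        (norm_dist (fourier_stieltjes G) (\<lambda>\<phi> \<psi> x. \<phi> x + \<psi> x) (\<lambda>c \<phi> x. c * \<phi> x) (FS_norm G))"
      by (rule N.norm_dist_mcomplete) (use G.FS_complete in simp)
  qed (simp_all add: N.nonneg N.eq_0_iff N.scale N.triangle G.FS_one G.FS_mult algebra_simps)
qed

end
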